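(* Let $k\in\mathbb{N}$ be fixed, let $p\in[1,\infty)$, and for each integer $n\ge k$ let $X_p^{(n)}$ be a random vector in $\mathbb{R}^n$. Let $(b_n)_{n\in\mathbb{N}}$ be a sequence of positive real numbers with $\lim_{n\to\infty}\frac{b_n}{\sqrt n}=0$. Assume that one of the following holds: (i) for all $n$, $X_p^{(n)}\sim P^{(n)}_{p,R^{(n)}}$ for some random variable $R^{(n)}$ with values almost surely in $(0,\infty)$, and $\lim_{n\to\infty}b_n=\infty$; or (ii) for all $n$, $X_p^{(n)}\sim\sigma_p^{(n)}$, and $\lim_{n\to\infty}\frac{b_n}{\sqrt{\log(n)}}=\infty$. Then the sequence $$\Bigl(\frac{\sqrt n}{b_n}\bigl(\mathrm{e}^{-m_p}\,\mathscr{R}^{(n)}_{k,n,p}(X_p^{(n)})-1\bigr)\Bigr)_{n\ge k}$$ satisfies a moderate deviations principle, i.e. a large deviations principle in $\mathbb{R}$ at speed $(b_n^2)_{n\in\mathbb{N}}$, with good rate function $\mathbb{I}\colon\mathbb{R}\to[0,\infty]$, $\mathbb{I}(t)=\frac{t^2}{2s_p^2}$.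
   Context: For $x\in\mathbb{R}^n$ and $p\in[1,\infty)$ let $\|x\|_p=(\sum_{i=1}^n|x_i|^p)^{1/p}$, $\mathbb{B}_p^n=\{x\in\mathbb{R}^n:\|x\|_p\le1\}$, $\mathbb{S}_p^{n-1}=\{x\in\mathbb{R}^n:\|x\|_p=1\}$. Cone measure: $\mu_p^{(n)}(A)=\lambda^{(n)}(\{ra:r\in[0,1],a\in A\})/\lambda^{(n)}(\mathbb{B}_p^n)$ for Borel $A\subset\mathbb{S}_p^{n-1}$, with $\lambda^{(n)}$ Lebesgue measure. Surface measure $\sigma_p^{(n)}$: the normalized (to total mass 1) $(n-1)$-dimensional Hausdorff measure on $\mathbb{S}_p^{n-1}$. For a random variable $R^{(n)}$ taking values a.s. in $(0,\infty)$, $P^{(n)}_{p,R^{(n)}}$ is the distribution of $R^{(n)}\Theta$, where $\Theta\sim\mu_p^{(n)}$ is independent of $R^{(n)}$ (so $R^{(n)}=1$ gives $\mu_p^{(n)}$). For $x\in\mathbb{R}^n$ and $1\le k\le n$ let $$S^{(n)}_{k,p}(x)=\Bigl(\tbinom{n}{k}^{-1}\sum_{1\le i_1<\dots<i_k\le n}|x_{i_1}|^p\cdots|x_{i_k}|^p\Bigr)^{1/(kp)},$$ and for $1\le k_1\le k_2\le n$ let $\mathscr{R}^{(n)}_{k_1,k_2,p}(x)=S^{(n)}_{k_2,p}(x)/S^{(n)}_{k_1,p}(x)$. The $p$-Gaussian distribution has Lebesgue density $x\mapsto \frac{1}{2p^{1/p}\Gamma(1+1/p)}\mathrm{e}^{-|x|^p/p}$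 on $\mathbb{R}$. For $X$ a $p$-Gaussian random variable, $m_p=\mathbb{E}[\log|X|]$ and $s_p^2=\operatorname{Var}\bigl[\log|X|-\tfrac1p|X|^p\bigr]$. A good rate function on $\mathbb{R}^d$ is a function $\mathbb{I}\colon\mathbb{R}^d\to[0,\infty]$, not identically $\infty$, with compact sublevel sets $\mathbb{I}^{-1}([0,a])$, $a\in[0,\infty)$. A sequence $(\xi_n)$ of $\mathbb{R}^d$-valued random variables satisfies a large deviations principle at speed $s_n\to\infty$ with good rate function $\mathbb{I}$ if for all Borel $A\subset\mathbb{R}^d$, $$-\inf_{x\in A^\circ}\mathbb{I}(x)\le\liminf_{n\to\infty}\tfrac1{s_n}\log\mathbb{P}[\xi_n\in A]\le\limsup_{n\to\infty}\tfrac1{s_n}\log\mathbb{P}[\xi_n\in A]\le-\inf_{x\in\overline A}\mathbb{I}(x).$$ *)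

theory Defs
  imports "HOL-Probability.Probability"
begin

text \<open>
  Vectors of \<open>\<real>\<^sup>n\<close> are the extensional functions on \<open>{..<n}\<close>, that is, the elements of
  \<open>space (Rn n)\<close>; coordinates are numbered from \<open>0\<close>, and \<open>\<real>\<^sup>n\<close> carries its Borel
  sigma-algebra.
\<close>

abbreviation Rn :: "nat \<Rightarrow> (nat \<Rightarrow> real) measure" where
  "Rn n \<equiv> PiM {..<n} (\<lambda>_. borel)"

definition lebesgue_Rn :: "nat \<Rightarrow> (nat \<Rightarrow> real) measure" where
  "lebesgue_Rn n = PiM {..<n} (\<lambda>_. lborel)"

definition scale_vec :: "nat \<Rightarrow> real \<Rightarrow> (nat \<Rightarrow> real) \<Rightarrow> nat \<Rightarrow> real" where
  "scale_vec n r x = (\<lambda>i\<in>{..<n}. r * x i)"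

definition lp_norm :: "nat \<Rightarrow> real \<Rightarrow> (nat \<Rightarrow> real) \<Rightarrow> real" where
  "lp_norm n p x = (\<Sum>i<n. \<bar>x i\<bar> powr p) powr (1 / p)"

definition lp_ball :: "nat \<Rightarrow> real \<Rightarrow> (nat \<Rightarrow> real) set" where
  "lp_ball n p = {x \<in> space (Rn n). lp_norm n p x \<le> 1}"

definition lp_sphere :: "nat \<Rightarrow> real \<Rightarrow> (nat \<Rightarrow> real) set" where
  "lp_sphere n p = {x \<in> space (Rn n). lp_norm n p x = 1}"

text \<open>
  The cone measure and the surface measure are regarded as measures on all of \<open>\<real>\<^sup>n\<close>
  concentrated on the sphere, whence the intersections with \<open>lp_sphere n p\<close>.
\<close>

definition cone_measure :: "nat \<Rightarrow> real \<Rightarrow> (nat \<Rightarrow> real) measure" where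
  "cone_measure n p = measure_of (space (Rn n)) (sets (Rn n))
     (\<lambda>A. emeasure (lebesgue_Rn n)
            {scale_vec n r a | r a. r \<in> {0..1} \<and> a \<in> A \<inter> lp_sphere n p}
          / emeasure (lebesgue_Rn n) (lp_ball n p))"

text \<open>
  Hausdorff outer measure of integer dimension for a distance function \<open>d\<close>. The empty set
  contributes \<open>0\<close> to a covering sum also in dimension \<open>0\<close>, where \<open>0 ^ 0 = 1\<close> makes the
  measure of a nonempty set count its points. The dimension-dependent constant of some
  conventions is omitted; it cancels in the normalized surface measure.
\<close>

definition set_diam :: "('a \<Rightarrow> 'a \<Rightarrow> real) \<Rightarrow> 'a set \<Rightarrow> ennreal" where
  "set_diam d U = (SUP x\<in>U. SUP y\<in>U. ennreal (d x y))"

definition hausdorff_premeasure ::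
    "('a \<Rightarrow> 'a \<Rightarrow> real) \<Rightarrow> nat \<Rightarrow> real \<Rightarrow> 'a set \<Rightarrow> ennreal" where
  "hausdorff_premeasure d s \<delta> A =
     (INF U \<in> {U :: nat \<Rightarrow> 'a set. A \<subseteq> (\<Union>i. U i) \<and> (\<forall>i. set_diam d (U i) \<le> ennreal \<delta>)}.
        \<Sum>i. if U i = {} then 0 else set_diam d (U i) ^ s)"

definition hausdorff_measure :: "('a \<Rightarrow> 'a \<Rightarrow> real) \<Rightarrow> nat \<Rightarrow> 'a set \<Rightarrow> ennreal" where
  "hausdorff_measure d s A = (SUP \<delta>\<in>{0<..}. hausdorff_premeasure d s \<delta> A)"

definition euclidean_dist :: "nat \<Rightarrow> (nat \<Rightarrow> real) \<Rightarrow> (nat \<Rightarrow> real) \<Rightarrow> real" where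
  "euclidean_dist n x y = L2_set (\<lambda>i. x i - y i) {..<n}"

definition surface_measure :: "nat \<Rightarrow> real \<Rightarrow> (nat \<Rightarrow> real) measure" where
  "surface_measure n p = measure_of (space (Rn n)) (sets (Rn n))
     (\<lambda>A. hausdorff_measure (euclidean_dist n) (n - 1) (A \<inter> lp_sphere n p)
          / hausdorff_measure (euclidean_dist n) (n - 1) (lp_sphere n p))"

text \<open>
  The law of \<open>R \<Theta>\<close> for \<open>R\<close> a random variable on \<open>N\<close> and \<open>\<Theta>\<close> distributed according to the
  cone measure; independence is expressed by the product measure.
\<close>

definition radial_law ::
    "nat \<Rightarrow> real \<Rightarrow> 'a measure \<Rightarrow> ('a \<Rightarrow> real) \<Rightarrow> (nat \<Rightarrow> real) measure" where
  "radial_law n p N R =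
     distr (distr N borel R \<Otimes>\<^sub>M cone_measure n p) (Rn n) (\<lambda>(r, \<theta>). scale_vec n r \<theta>)"

definition sym_mean :: "nat \<Rightarrow> nat \<Rightarrow> real \<Rightarrow> (nat \<Rightarrow> real) \<Rightarrow> real" where
  "sym_mean k n p x =
     ((\<Sum>I | I \<subseteq> {..<n} \<and> card I = k. \<Prod>i\<in>I. \<bar>x i\<bar> powr p) / real (n choose k))
       powr (1 / (real k * p))"

definition mean_ratio :: "nat \<Rightarrow> nat \<Rightarrow> nat \<Rightarrow> real \<Rightarrow> (nat \<Rightarrow> real) \<Rightarrow> real" where
  "mean_ratio k1 k2 n p x = sym_mean k2 n p x / sym_mean k1 n p x"

definition p_gaussian :: "real \<Rightarrow> real measure" where
  "p_gaussian p = density lborel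
     (\<lambda>x. ennreal (1 / (2 * p powr (1 / p) * Gamma (1 + 1 / p)) * exp (- (\<bar>x\<bar> powr p) / p)))"

definition m_const :: "real \<Rightarrow> real" where
  "m_const p = (\<integral>x. ln \<bar>x\<bar> \<partial>p_gaussian p)"

definition s_sq :: "real \<Rightarrow> real" where
  "s_sq p = prob_space.variance (p_gaussian p) (\<lambda>x. ln \<bar>x\<bar> - 1 / p * \<bar>x\<bar> powr p)"

definition good_rate_function :: "('a::euclidean_space \<Rightarrow> ennreal) \<Rightarrow> bool" where
  "good_rate_function I \<longleftrightarrow>
     (\<exists>x. I x \<noteq> \<infinity>) \<and> (\<forall>a::real. a \<ge> 0 \<longrightarrow> compact (I -` {0..ennreal a}))"

text \<open>Natural logarithm of a probability, with the convention \<open>log 0 = -\<infinity>\<close>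
  (whereas \<open>ln 0 = 0\<close> on the reals).\<close>

definition log_prob :: "real \<Rightarrow> ereal" where
  "log_prob q = (if q = 0 then -\<infinity> else ereal (ln q))"

text \<open>
  Large deviations principle for a sequence \<open>(\<xi> n)\<close>, \<open>n \<ge> n0\<close>, of random vectors, each on its
  own probability space \<open>M n\<close>. The infimum of \<open>I\<close> over the empty set is \<open>\<infinity>\<close>.
\<close>

definition satisfies_LDP ::
    "nat \<Rightarrow> (nat \<Rightarrow> 'b measure) \<Rightarrow> (nat \<Rightarrow> 'b \<Rightarrow> 'a::euclidean_space) \<Rightarrow>
     (nat \<Rightarrow> real) \<Rightarrow> ('a \<Rightarrow> ennreal) \<Rightarrow> bool" where
  "satisfies_LDP n0 M \<xi> s I \<longleftrightarrow>
     (\<forall>n\<ge>n0. prob_space (M n) \<and> \<xi> n \<in> borel_measurable (M n)) \<and>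
     filterlim s at_top sequentially \<and>
     good_rate_function I \<and>
     (\<forall>A\<in>sets borel.
        - enn2ereal (INF x\<in>interior A. I x)
          \<le> liminf (\<lambda>n. ereal (1 / s n) * log_prob (measure (M n) (\<xi> n -` A \<inter> space (M n)))) \<and>
        limsup (\<lambda>n. ereal (1 / s n) * log_prob (measure (M n) (\<xi> n -` A \<inter> space (M n))))
          \<le> - enn2ereal (INF x\<in>closure A. I x))"

end

theory Submission
  imports Defs "HOL-Real_Asymp.Real_Asymp"
begin

text \<open>
  The ratio is invariant under scaling, and the cone measure is the law of \<open>G / \<parallel>G\<parallel>\<^sub>p\<close> for a vector \<open>G\<close>
  of independent \<open>p\<close>-Gaussian variables, so in case (i) the ratio may be evaluated at \<open>G\<close>. There, up to
  an error that is superexponentially small at speed \<open>b\<^sub>n\<^sup>2\<close>, its logarithm minus \<open>m\<^sub>p\<close> is the mean of the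
  centred variables \<open>log |G\<^sub>i| - m\<^sub>p - (|G\<^sub>i|\<^sup>p - 1) / p\<close>; indeed the \<open>k\<close>-th elementary symmetric mean of the
  \<open>|G\<^sub>i|\<^sup>p\<close> differs from the \<open>k\<close>-th power of their mean by a factor controlled by their maximum. The
  moderate deviations of such means follow from the second order expansion of the moment generating
  function at \<open>0\<close>.

  In case (ii) it suffices that surface measure and cone measure are comparable up to a factor
  polynomial in \<open>n\<close>, since \<open>log n\<close> is negligible against \<open>b\<^sub>n\<^sup>2\<close>. Write the part of the sphere where the
  last coordinate dominates as a graph. Translations in the chart change Hausdorff measure on the
  graph at most by a polynomial factor, so, as in the proof of uniqueness of Haar measure, it is
  comparable to Lebesgue measure in the chart; and so is the cone measure, by a substitution on each
  line parallel to the last axis. The sphere is covered by \<open>2n\<close> isometric copies of this part.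
\<close>

section \<open>Lebesgue measure and substitution\<close>

text \<open>The n-th symmetric mean is the geometric mean, so only the k-th one has to be
  linearised; since E|X|^p = 1, its logarithm starts with the mean of (|x|^p - 1) / p. The
  linearisation error must stay small after multiplication by sqrt n / b_n. Its quadratic part is
  then of order b_n / sqrt n. The part due to the maximum is proportional to max |x_i|^p / (b_n sqrt
  n); the threshold eps b_n sqrt n works because the tail exp (- const b_n sqrt n) beats every exp
  (- C b_n^2) when b_n / sqrt n tends to 0.

  For the surface measure no density with respect to the cone measure is computed, and additivity
  and finiteness of Hausdorff measure on the sphere come with the hypothesis that the surface
  measure is the law of a random vector. What remains are inequalities between coverings. There a
  factor exponential in n would be fatal, since b_n^2 may grow barely faster than log n; this
  dictates the slabs in \<open>hausdorff_measure_graph_le\<close>. Any fixed power of n is harmless,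
  so no constant is optimised.\<close>

lemma product_sigma_finite_lborel: "product_sigma_finite (\<lambda>_::nat. lborel :: real measure)"
  by (simp add: product_sigma_finite_def sigma_finite_lborel)

text \<open>Induction over the coordinates, with the affine substitution on the line in each step.
  The uses are c = 1 and c = -1 (translation and reflection in
  \<open>quasi_invariant_comparison\<close>) and t = 0 (volumes of scaled cones).\<close>

lemma nn_integral_PiM_lborel_affine:
  fixes f :: "(nat \<Rightarrow> real) \<Rightarrow> ennreal"
  assumes "finite I" and "c \<noteq> 0" and "f \<in> borel_measurable (PiM I (\<lambda>_. lborel))"
  shows "(\<integral>\<^sup>+x. f x \<partial>PiM I (\<lambda>_. lborel))
    = ennreal (\<bar>c\<bar> ^ card I) * (\<integral>\<^sup>+x. f (\<lambda>i\<in>I. t i + c * x i) \<partial>PiM I (\<lambda>_. lborel))"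
  using assms(1,3)
proof (induction I arbitrary: f)
  case empty
  show ?case by (simp add: PiM_empty nn_integral_count_space_finite)
next
  case (insert i I)
  interpret product_sigma_finite "\<lambda>_::nat. lborel :: real measure"
    by (rule product_sigma_finite_lborel)
  note insert.prems[measurable]
  interpret lI: sigma_finite_measure "PiM I (\<lambda>_::nat. lborel :: real measure)"
    by (rule sigma_finite) fact
  have cc: "ennreal \<bar>c\<bar> * ennreal (\<bar>c\<bar> ^ card I) = ennreal (\<bar>c\<bar> ^ card (insert i I))"
    using insert.hyps by (simp add: ennreal_mult)
  let ?h = "\<lambda>x. \<integral>\<^sup>+y. f (x(i := t i + c * y)) \<partial>lborel"
  have h[measurable]: "?h \<in> borel_measurable (PiM I (\<lambda>_. lborel))"
    by measurable
  have "(\<integral>\<^sup>+x. f x \<partial>PiM (insert i I) (\<lambda>_. lborel))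
      = (\<integral>\<^sup>+x. \<integral>\<^sup>+y. f (x(i := y)) \<partial>lborel \<partial>PiM I (\<lambda>_. lborel))"
    using insert by (intro product_nn_integral_insert) auto
  also have "\<dots> = (\<integral>\<^sup>+x. ennreal \<bar>c\<bar> * ?h x \<partial>PiM I (\<lambda>_. lborel))"
  proof (intro nn_integral_cong)
    fix x :: "nat \<Rightarrow> real" assume x: "x \<in> space (PiM I (\<lambda>_. lborel))"
    have "(\<lambda>y. f (x(i := y))) \<in> borel_measurable lborel"
      using x by measurable
    then show "(\<integral>\<^sup>+y. f (x(i := y)) \<partial>lborel) = ennreal \<bar>c\<bar> * ?h x"
      using nn_integral_real_affine[of "\<lambda>y. f (x(i := y))" c "t i"] assms(2) by simp
  qed
  also have "\<dots> = ennreal \<bar>c\<bar> * (\<integral>\<^sup>+x. ?h x \<partial>PiM I (\<lambda>_. lborel))"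
    by (simp add: nn_integral_cmult)
  also have "\<dots> = ennreal \<bar>c\<bar> * (ennreal (\<bar>c\<bar> ^ card I) *
      (\<integral>\<^sup>+x. ?h (\<lambda>j\<in>I. t j + c * x j) \<partial>PiM I (\<lambda>_. lborel)))"
    by (subst insert.IH[OF h]) simp
  also have "(\<integral>\<^sup>+x. ?h (\<lambda>j\<in>I. t j + c * x j) \<partial>PiM I (\<lambda>_. lborel))
      = (\<integral>\<^sup>+x. \<integral>\<^sup>+y. f (\<lambda>j\<in>insert i I. t j + c * (x(i := y)) j) \<partial>lborel \<partial>PiM I (\<lambda>_. lborel))"
    by (intro nn_integral_cong arg_cong[where f=f]) (auto simp: fun_eq_iff insert.hyps)
  also have "\<dots> = (\<integral>\<^sup>+x. f (\<lambda>j\<in>insert i I. t j + c * x j) \<partial>PiM (insert i I) (\<lambda>_. lborel))"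
    using insert.hyps by (intro product_nn_integral_insert[symmetric]) auto
  finally show ?case
    unfolding mult.assoc[symmetric] cc .
qed

text \<open>
  Fubini for \<open>(x, t) \<mapsto> 1\<^sub>B\<^sub>1(x) 1\<^sub>B\<^sub>2(x + t)\<close>, as in the proof of uniqueness of Haar measure.
\<close>

lemma quasi_invariant_comparison:
  fixes D :: "(nat \<Rightarrow> real) set" and I :: "nat set"
  defines "V \<equiv> PiM I (\<lambda>_. lborel)"
  defines "sh \<equiv> \<lambda>t x. \<lambda>i\<in>I. t i + x i"
  assumes "finite I" and "finite_measure \<eta>" and sets_eta[measurable_cong]: "sets \<eta> = sets V"
    and quasi: "\<And>t B. B \<in> sets V \<Longrightarrow> B \<subseteq> D \<Longrightarrow> {x \<in> space V. sh t x \<in> B} \<subseteq> D \<Longrightarrow>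
        emeasure \<eta> {x \<in> space V. sh t x \<in> B} \<le> P * emeasure \<eta> B"
    and B1[measurable]: "B1 \<in> sets V" and "B1 \<subseteq> D" and B2[measurable]: "B2 \<in> sets V" and "B2 \<subseteq> D"
  shows "emeasure \<eta> B1 * emeasure V B2 \<le> P * (emeasure \<eta> B2 * emeasure V B1)"
proof -
  interpret product_sigma_finite "\<lambda>_::nat. lborel :: real measure"
    by (rule product_sigma_finite_lborel)
  interpret V: sigma_finite_measure V unfolding V_def by (rule sigma_finite) fact
  interpret eta: finite_measure \<eta> by fact
  interpret pair_sigma_finite \<eta> V ..
  have sV[measurable_cong]: "sets V = sets (PiM I (\<lambda>_. borel))"
    unfolding V_def by (intro sets_PiM_cong) auto
  have sp: "space V = (\<Pi>\<^sub>E i\<in>I. UNIV)" "space \<eta> = (\<Pi>\<^sub>E i\<in>I. UNIV)"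
    using sets_eq_imp_space_eq[OF sets_eta] by (auto simp: V_def space_PiM)
  have sh[measurable]: "(\<lambda>(x, t). sh t x) \<in> \<eta> \<Otimes>\<^sub>M V \<rightarrow>\<^sub>M V"
    unfolding sh_def V_def by measurable
  define mi where "mi = (\<lambda>t x :: nat \<Rightarrow> real. \<lambda>i\<in>I. x i - t i)"
  have mi[measurable]: "(\<lambda>(x, t). mi t x) \<in> \<eta> \<Otimes>\<^sub>M V \<rightarrow>\<^sub>M V"
    unfolding mi_def V_def by measurable
  have shsp: "sh t x \<in> space V" and misp: "mi t x \<in> space V" for t x
    by (auto simp: sh_def mi_def sp)
  have shm: "x \<in> space V \<Longrightarrow> mi t (sh t x) = x" "x \<in> space V \<Longrightarrow> sh t (mi t x) = x" for t x
    by (auto simp: sh_def mi_def fun_eq_iff sp PiE_def extensional_def)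
  have inv1: "(\<integral>\<^sup>+t. indicator B2 (sh t x) \<partial>V) = emeasure V B2" for x
    using nn_integral_PiM_lborel_affine[OF \<open>finite I\<close>, of 1 "indicator B2" x] B2
    by (simp add: V_def sh_def add.commute)
  have inv2: "(\<integral>\<^sup>+t. indicator B1 (mi t x) \<partial>V) = emeasure V B1" for x
    using nn_integral_PiM_lborel_affine[OF \<open>finite I\<close>, of "-1" "indicator B1" x] B1
    by (simp add: V_def mi_def)
  have "emeasure \<eta> B1 * emeasure V B2 = (\<integral>\<^sup>+x. indicator B1 x * emeasure V B2 \<partial>\<eta>)"
    by (simp add: nn_integral_multc)
  also have "\<dots> = (\<integral>\<^sup>+x. indicator B1 x * (\<integral>\<^sup>+t. indicator B2 (sh t x) \<partial>V) \<partial>\<eta>)"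
    by (simp add: inv1)
  also have "\<dots> = (\<integral>\<^sup>+x. \<integral>\<^sup>+t. indicator B1 x * indicator B2 (sh t x) \<partial>V \<partial>\<eta>)"
    by (intro nn_integral_cong nn_integral_cmult[symmetric]) measurable
  also have "\<dots> = (\<integral>\<^sup>+t. \<integral>\<^sup>+x. indicator B1 x * indicator B2 (sh t x) \<partial>\<eta> \<partial>V)"
    by (intro Fubini'[symmetric]) measurable
  also have "\<dots> \<le> (\<integral>\<^sup>+t. P * (\<integral>\<^sup>+y. indicator B2 y * indicator B1 (mi t y) \<partial>\<eta>) \<partial>V)"
  proof (intro nn_integral_mono)
    fix t assume t: "t \<in> space V"
    \<comment> \<open>\<open>C\<close> and its pullback under \<open>sh t\<close> lie in
      \<open>B2\<close> and \<open>B1\<close>, hence both in \<open>D\<close>; so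
      \<open>quasi\<close>, which speaks only of sets that stay in \<open>D\<close>, applies for
      every t.\<close>
    define C where "C = {y \<in> space V. y \<in> B2 \<and> mi t y \<in> B1}"
    have mit[measurable]: "mi t \<in> V \<rightarrow>\<^sub>M V" unfolding mi_def V_def by measurable
    have C[measurable]: "C \<in> sets V" unfolding C_def by measurable
    have eq: "{x \<in> space V. sh t x \<in> C} = {x \<in> space V. x \<in> B1 \<and> sh t x \<in> B2}"
      by (auto simp: C_def shm shsp)
    have sht[measurable]: "sh t \<in> V \<rightarrow>\<^sub>M V" unfolding sh_def V_def by measurable
    have Cs: "{x \<in> space V. sh t x \<in> C} \<in> sets V" by measurable
    have "(\<integral>\<^sup>+x. indicator B1 x * indicator B2 (sh t x) \<partial>\<eta>)
        = (\<integral>\<^sup>+x. indicator {x \<in> space V. sh t x \<in> C} x \<partial>\<eta>)"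
      unfolding eq by (intro nn_integral_cong) (auto simp: indicator_def sp)
    also have "\<dots> = emeasure \<eta> {x \<in> space V. sh t x \<in> C}"
      using Cs sets_eta by simp
    also have "\<dots> \<le> P * emeasure \<eta> C"
      using \<open>B1 \<subseteq> D\<close> \<open>B2 \<subseteq> D\<close> by (intro quasi) (auto simp: eq, auto simp: C_def)
    also have "emeasure \<eta> C = (\<integral>\<^sup>+y. indicator C y \<partial>\<eta>)"
      using C sets_eta by simp
    also have "\<dots> = (\<integral>\<^sup>+y. indicator B2 y * indicator B1 (mi t y) \<partial>\<eta>)"
      by (intro nn_integral_cong) (auto simp: indicator_def sp C_def)
    finally show "(\<integral>\<^sup>+x. indicator B1 x * indicator B2 (sh t x) \<partial>\<eta>)
        \<le> P * (\<integral>\<^sup>+y. indicator B2 y * indicator B1 (mi t y) \<partial>\<eta>)" .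
  qed
  also have "\<dots> = P * (\<integral>\<^sup>+t. \<integral>\<^sup>+y. indicator B2 y * indicator B1 (mi t y) \<partial>\<eta> \<partial>V)"
    by (intro nn_integral_cmult) measurable
  also have "(\<integral>\<^sup>+t. \<integral>\<^sup>+y. indicator B2 y * indicator B1 (mi t y) \<partial>\<eta> \<partial>V)
      = (\<integral>\<^sup>+y. \<integral>\<^sup>+t. indicator B2 y * indicator B1 (mi t y) \<partial>V \<partial>\<eta>)"
    by (intro Fubini') measurable
  also have "\<dots> = (\<integral>\<^sup>+y. indicator B2 y * (\<integral>\<^sup>+t. indicator B1 (mi t y) \<partial>V) \<partial>\<eta>)"
    by (intro nn_integral_cong nn_integral_cmult) measurable
  also have "\<dots> = emeasure \<eta> B2 * emeasure V B1"
    by (simp add: inv2 nn_integral_multc)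
  finally show ?thesis .
qed

text \<open>The half line is exhausted by the compact intervals [u n, v n]. The substitution rule
  holds on each of them, their images exhaust the ray above c, and monotone convergence passes to
  the limit on both sides.\<close>

lemma nn_integral_substitution_Ioi:
  fixes f :: "real \<Rightarrow> ennreal" and g :: "real \<Rightarrow> real"
  assumes [measurable]: "f \<in> borel_measurable borel"
    and deriv: "\<And>t. t > 0 \<Longrightarrow> (g has_real_derivative g' t) (at t)"
    and cont: "continuous_on {0<..} g'"
    and pos: "\<And>t. t > 0 \<Longrightarrow> g' t > 0"
    and lim0: "(g \<longlongrightarrow> c) (at_right 0)"
    and lim1: "filterlim g at_top at_top"
  shows "(\<integral>\<^sup>+t. f (g t) * ennreal (g' t) * indicator {0<..} t \<partial>lborel)
    = (\<integral>\<^sup>+r. f r * indicator {c<..} r \<partial>lborel)"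
proof -
  have mono: "g s < g t" if "0 < s" "s < t" for s t
    using that by (intro DERIV_pos_imp_increasing[OF that(2)]) (auto intro!: exI deriv pos)
  have gt: "c < g t" if "t > 0" for t
  proof -
    have "c \<le> g (t / 2)"
    proof (rule tendsto_upperbound[OF lim0])
      show "\<forall>\<^sub>F x in at_right 0. g x \<le> g (t / 2)"
        using that by (intro eventually_at_rightI[of 0 "t/2"] less_imp_le[OF mono]) simp_all
    qed simp
    also have "\<dots> < g t" using that by (intro mono) auto
    finally show ?thesis .
  qed
  \<comment> \<open>The shift by 2 makes \<open>u n < v n\<close> true already for n = 0.\<close>
  define u where "u n = (1 / (real n + 2))" for n
  define v where "v n = real n + 2" for n
  have uv: "0 < u n" "u n < v n" for n
  proof -
    show "0 < u n" by (simp add: u_def)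
    have "u n \<le> 1" by (simp add: u_def)
    then show "u n < v n" by (simp add: v_def)
  qed
  have udec: "u n \<le> u m" and vinc: "v m \<le> v n" if "m \<le> n" for m n
    using that by (auto simp: u_def v_def frac_le)
  have ulim: "u \<longlonglongrightarrow> 0" unfolding u_def by real_asymp
  have vlim: "filterlim v at_top sequentially" unfolding v_def by real_asymp
  have mono': "g s \<le> g t" if "0 < s" "s \<le> t" for s t
    using mono[of s t] that by (cases "s = t") auto
  have gborel: "(\<lambda>t. f (g t) * ennreal (g' t) * indicator {0<..} t) \<in> borel_measurable borel"
  proof -
    have 1: "(\<lambda>t. indicator {0<..} t *\<^sub>R g t) \<in> borel_measurable borel"
      using deriv
      by (intro borel_measurable_continuous_on_indicator DERIV_continuous_on[where D = g'])
        (auto intro: has_field_derivative_at_within)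
    have 2: "(\<lambda>t. indicator {0<..} t *\<^sub>R g' t) \<in> borel_measurable borel"
      using cont by (intro borel_measurable_continuous_on_indicator) auto
    \<comment> \<open>Nothing is known about \<open>g\<close> and \<open>g'\<close> off the half
      line. Setting them to 0 there makes them Borel, and the outer indicator hides the
      change.\<close>
    have eq: "(\<lambda>t. f (g t) * ennreal (g' t) * indicator {0<..} t) =
      (\<lambda>t. f (indicator {0<..} t *\<^sub>R g t) * ennreal (indicator {0<..} t *\<^sub>R g' t) * indicator {0<..} t)"
      by (auto simp: fun_eq_iff indicator_def)
    show ?thesis unfolding eq using 1 2 by measurable
  qed
  have supL: "(SUP n. indicator {u n..v n} t) = (indicator {0<..} t :: ennreal)" for t
  proof (cases "t > 0")
    case True
    have "\<forall>\<^sub>F n in sequentially. u n < t" "\<forall>\<^sub>F n in sequentially. v n \<ge> t"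
      using True order_tendstoD(2)[OF ulim] vlim by (auto simp: filterlim_at_top)
    then have "\<forall>\<^sub>F n in sequentially. u n < t \<and> t \<le> v n" by eventually_elim auto
    then obtain n where "u n < t \<and> t \<le> v n" by (auto simp: eventually_sequentially)
    then have "1 \<le> (SUP n. indicator {u n..v n} t :: ennreal)"
      by (intro SUP_upper2[of n]) (auto simp: indicator_def)
    moreover have "(SUP n. indicator {u n..v n} t :: ennreal) \<le> 1"
      by (intro SUP_least) (auto simp: indicator_def)
    ultimately show ?thesis using True by (auto simp: indicator_def)
  next
    case False
    then have "indicator {u n..v n} t = (0::ennreal)" for n using uv[of n] by (auto simp: indicator_def)
    then show ?thesis using False by simp
  qed
  have supR: "(SUP n. indicator {g (u n)..g (v n)} t) = (indicator {c<..} t :: ennreal)" for t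
  proof (cases "t > c")
    case True
    have "((\<lambda>n. g (u n)) \<longlongrightarrow> c) sequentially"
    proof (intro filterlim_compose[OF lim0])
      have "u n \<noteq> 0" for n using uv(1)[of n] by simp
      then show "filterlim u (at_right 0) sequentially"
        using uv(1) ulim by (auto simp: filterlim_at)
    qed
    then have "\<forall>\<^sub>F n in sequentially. g (u n) < t" using True order_tendstoD(2) by blast
    moreover have "\<forall>\<^sub>F n in sequentially. g (v n) \<ge> t"
      using filterlim_compose[OF lim1 vlim] by (auto simp: filterlim_at_top)
    ultimately have "\<forall>\<^sub>F n in sequentially. g (u n) < t \<and> t \<le> g (v n)" by eventually_elim auto
    then obtain n where "g (u n) < t \<and> t \<le> g (v n)" by (auto simp: eventually_sequentially)
    then have "1 \<le> (SUP n. indicator {g (u n)..g (v n)} t :: ennreal)"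
      by (intro SUP_upper2[of n]) (auto simp: indicator_def)
    moreover have "(SUP n. indicator {g (u n)..g (v n)} t :: ennreal) \<le> 1"
      by (intro SUP_least) (auto simp: indicator_def)
    ultimately show ?thesis using True by (auto simp: indicator_def)
  next
    case False
    then have "indicator {g (u n)..g (v n)} t = (0::ennreal)" for n
      using gt[of "u n"] uv[of n] by (auto simp: indicator_def)
    then show ?thesis using False by simp
  qed
  have "(\<integral>\<^sup>+t. f (g t) * ennreal (g' t) * indicator {0<..} t \<partial>lborel)
    = (\<integral>\<^sup>+t. (SUP n. f (g t) * ennreal (g' t) * indicator {0<..} t * indicator {u n..v n} t) \<partial>lborel)"
    by (intro nn_integral_cong, subst SUP_mult_left_ennreal[symmetric], subst supL)
       (auto simp: indicator_def)
  also have "\<dots> = (SUP n. \<integral>\<^sup>+t. f (g t) * ennreal (g' t) * indicator {0<..} t * indicator {u n..v n} t \<partial>lborel)"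
  proof (intro nn_integral_monotone_convergence_SUP)
    show "incseq (\<lambda>n t. f (g t) * ennreal (g' t) * indicator {0<..} t * indicator {u n..v n} t)"
    proof (intro incseq_SucI le_funI)
      fix n t
      have "indicator {u n..v n} t \<le> (indicator {u (Suc n)..v (Suc n)} t :: ennreal)"
        using udec[of n "Suc n"] vinc[of n "Suc n"] by (auto simp: indicator_def)
      then show "f (g t) * ennreal (g' t) * indicator {0<..} t * indicator {u n..v n} t
          \<le> f (g t) * ennreal (g' t) * indicator {0<..} t * indicator {u (Suc n)..v (Suc n)} t"
        by (intro mult_left_mono) auto
    qed
    show "(\<lambda>t. f (g t) * ennreal (g' t) * indicator {0<..} t * indicator {u n..v n} t)
        \<in> borel_measurable lborel" for n
      using borel_measurable_times_ennreal[OF gborel, of "indicator {u n..v n}"] by simp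
  qed
  also have "\<dots> = (SUP n. \<integral>\<^sup>+r. f r * indicator {g (u n)..g (v n)} r \<partial>lborel)"
  proof (intro SUP_cong refl)
    fix n
    have "(\<integral>\<^sup>+r. f r * indicator {g (u n)..g (v n)} r \<partial>lborel)
        = (\<integral>\<^sup>+t. f (g t) * ennreal (g' t) * indicator {u n..v n} t \<partial>lborel)"
      using uv[of n] by (intro nn_integral_substitution_aux)
        (auto intro!: deriv less_imp_le[OF pos] continuous_on_subset[OF cont])
    also have "\<dots> = (\<integral>\<^sup>+t. f (g t) * ennreal (g' t) * indicator {0<..} t * indicator {u n..v n} t \<partial>lborel)"
      using uv[of n] by (intro nn_integral_cong) (auto simp: indicator_def)
    finally show "(\<integral>\<^sup>+t. f (g t) * ennreal (g' t) * indicator {0<..} t * indicator {u n..v n} t \<partial>lborel)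
      = (\<integral>\<^sup>+r. f r * indicator {g (u n)..g (v n)} r \<partial>lborel)" by simp
  qed
  also have "\<dots> = (\<integral>\<^sup>+r. (SUP n. f r * indicator {g (u n)..g (v n)} r) \<partial>lborel)"
  proof (intro nn_integral_monotone_convergence_SUP[symmetric])
    show "incseq (\<lambda>n r. f r * indicator {g (u n)..g (v n)} r)"
    proof (intro incseq_SucI le_funI)
      fix n r
      have "g (u (Suc n)) \<le> g (u n)" "g (v n) \<le> g (v (Suc n))"
        using uv[of n] uv[of "Suc n"] udec[of n "Suc n"] vinc[of n "Suc n"] by (auto intro!: mono')
      then have "indicator {g (u n)..g (v n)} r \<le> (indicator {g (u (Suc n))..g (v (Suc n))} r :: ennreal)"
        by (auto simp: indicator_def)
      then show "f r * indicator {g (u n)..g (v n)} r \<le> f r * indicator {g (u (Suc n))..g (v (Suc n))} r"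
        by (intro mult_left_mono) auto
    qed
  qed measurable
  also have "\<dots> = (\<integral>\<^sup>+r. f r * indicator {c<..} r \<partial>lborel)"
    by (intro nn_integral_cong, subst SUP_mult_left_ennreal[symmetric], subst supR) auto
  finally show ?thesis .
qed

section \<open>Hausdorff measure of graphs\<close>

lemma set_diam_empty [simp]: "set_diam d {} = 0"
  by (simp add: set_diam_def bot_ennreal)

lemma set_diam_upper: "x \<in> U \<Longrightarrow> y \<in> U \<Longrightarrow> ennreal (d x y) \<le> set_diam d U"
  unfolding set_diam_def by (intro SUP_upper2[of x] SUP_upper2[of y]) auto

lemma set_diam_least: "(\<And>x y. x \<in> U \<Longrightarrow> y \<in> U \<Longrightarrow> ennreal (d x y) \<le> c) \<Longrightarrow> set_diam d U \<le> c"
  unfolding set_diam_def by (intro SUP_least) auto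

text \<open>Every covering of \<open>A\<close> yields a covering of the image with m sets for each
  old one. The bound on diameters only has to keep them small: its factor 2 turns \<delta> into
  \<delta> / 2 and disappears in the supremum over \<delta>. The cost is therefore m * K, without a
  factor 2 ^ s.\<close>

lemma hausdorff_measure_image_le:
  fixes d :: "'a \<Rightarrow> 'a \<Rightarrow> real" and d' :: "'b \<Rightarrow> 'b \<Rightarrow> real"
  assumes "s \<ge> 1" and "m > 0" and "K > 0"
    and split: "\<And>U. set_diam d U < \<top> \<Longrightarrow> \<exists>V :: nat \<Rightarrow> 'b set. f ` (U \<inter> A) \<subseteq> (\<Union>j<m. V j) \<and>
        (\<forall>j<m. set_diam d' (V j) \<le> 2 * set_diam d U
          \<and> set_diam d' (V j) ^ s \<le> ennreal K * set_diam d U ^ s)"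
  shows "hausdorff_measure d' s (f ` A) \<le> ennreal (real m * K) * hausdorff_measure d s A"
proof -
  define c where "c = real m * K"
  have c: "c > 0" using assms by (simp add: c_def)
  have zero: "(if X = {} then 0 else set_diam e X ^ s) = set_diam e X ^ s"
    for e :: "'c \<Rightarrow> 'c \<Rightarrow> real" and X using \<open>s \<ge> 1\<close> by (simp add: power_0_left)
  have pre: "hausdorff_premeasure d' s \<delta> (f ` A) \<le> ennreal c * hausdorff_premeasure d s (\<delta> / 2) A"
    if "\<delta> > 0" for \<delta>
  proof -
    \<comment> \<open>The constant is moved to the left because the infimum over coverings on the
      right is bounded from below cover by cover.\<close>
    have "ennreal (1 / c) * hausdorff_premeasure d' s \<delta> (f ` A) \<le> hausdorff_premeasure d s (\<delta> / 2) A"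
      unfolding hausdorff_premeasure_def[of d]
    proof (rule INF_greatest)
      fix U :: "nat \<Rightarrow> 'a set"
      assume "U \<in> {U. A \<subseteq> (\<Union>i. U i) \<and> (\<forall>i. set_diam d (U i) \<le> ennreal (\<delta> / 2))}"
      then have U: "A \<subseteq> (\<Union>i. U i)" "\<And>i. set_diam d (U i) \<le> ennreal (\<delta> / 2)" by auto
      have "set_diam d (U i) < \<top>" for i
        using U(2)[of i] by (auto intro: order_le_less_trans ennreal_less_top)
      then have "\<forall>i. \<exists>V :: nat \<Rightarrow> 'b set. f ` (U i \<inter> A) \<subseteq> (\<Union>j<m. V j) \<and>
        (\<forall>j<m. set_diam d' (V j) \<le> 2 * set_diam d (U i)
          \<and> set_diam d' (V j) ^ s \<le> ennreal K * set_diam d (U i) ^ s)"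
        using split by blast
      then obtain V where V: "\<And>i. f ` (U i \<inter> A) \<subseteq> (\<Union>j<m. V i j)"
        "\<And>i j. j < m \<Longrightarrow> set_diam d' (V i j) \<le> 2 * set_diam d (U i)"
        "\<And>i j. j < m \<Longrightarrow> set_diam d' (V i j) ^ s \<le> ennreal K * set_diam d (U i) ^ s"
        by metis
      \<comment> \<open>The double family is enumerated as one sequence, with empty sets in the
        places j \<ge> m.\<close>
      define W where "W q = (if snd (prod_decode q) < m
        then V (fst (prod_decode q)) (snd (prod_decode q)) else {})" for q
      have "f ` A \<subseteq> (\<Union>q. W q)"
      proof safe
        fix x assume "x \<in> A"
        then obtain i where "x \<in> U i" using U by auto
        then obtain j where j: "j < m" "f x \<in> V i j" using V(1)[of i] \<open>x \<in> A\<close> by auto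
        then show "f x \<in> (\<Union>q. W q)"
          by (intro UN_I[of "prod_encode (i, j)"]) (auto simp: W_def)
      qed
      moreover have "set_diam d' (W q) \<le> ennreal \<delta>" for q
      proof (cases "snd (prod_decode q) < m")
        case True
        have "set_diam d' (W q) \<le> 2 * set_diam d (U (fst (prod_decode q)))"
          using V(2) True by (auto simp: W_def)
        also have "\<dots> \<le> 2 * ennreal (\<delta> / 2)" using U by (intro mult_left_mono) auto
        also have "\<dots> = ennreal (2 * (\<delta> / 2))" by (subst ennreal_mult') auto
        finally show ?thesis by simp
      qed (simp add: W_def)
      ultimately have "hausdorff_premeasure d' s \<delta> (f ` A) \<le> (\<Sum>q. set_diam d' (W q) ^ s)"
        unfolding hausdorff_premeasure_def zero by (intro INF_lower) auto
      also have "\<dots> = (\<Sum>q. (\<lambda>(i, j). if j < m then set_diam d' (V i j) ^ s else 0) (prod_decode q))"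
        using \<open>s \<ge> 1\<close> by (intro suminf_cong) (auto simp: W_def split: prod.splits)
      also have "\<dots> = (\<Sum>i. \<Sum>j<m. set_diam d' (V i j) ^ s)"
      proof (rule suminf_ennreal_2dimen)
        fix i
        show "(\<Sum>j<m. set_diam d' (V i j) ^ s)
            = (\<Sum>j. (\<lambda>(i, j). if j < m then set_diam d' (V i j) ^ s else 0) (i, j))"
          by (subst suminf_finite[of "{..<m}"]) auto
      qed
      also have "\<dots> \<le> (\<Sum>i. ennreal c * set_diam d (U i) ^ s)"
      proof (intro suminf_le summableI)
        fix i
        have "(\<Sum>j<m. set_diam d' (V i j) ^ s) \<le> (\<Sum>j<m. ennreal K * set_diam d (U i) ^ s)"
          using V(3) by (intro sum_mono) auto
        also have "\<dots> = ennreal c * set_diam d (U i) ^ s"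
          using \<open>K > 0\<close> by (simp add: c_def ennreal_mult mult.assoc ennreal_of_nat_eq_real_of_nat)
        finally show "(\<Sum>j<m. set_diam d' (V i j) ^ s) \<le> ennreal c * set_diam d (U i) ^ s" .
      qed
      also have "\<dots> = ennreal c * (\<Sum>i. set_diam d (U i) ^ s)"
        by (rule ennreal_suminf_cmult)
      finally have "ennreal (1 / c) * hausdorff_premeasure d' s \<delta> (f ` A)
          \<le> ennreal (1 / c) * (ennreal c * (\<Sum>i. set_diam d (U i) ^ s))"
        by (intro mult_left_mono) auto
      also have "\<dots> = (\<Sum>i. set_diam d (U i) ^ s)"
        using c by (simp add: mult.assoc[symmetric] ennreal_mult[symmetric])
      finally show "ennreal (1 / c) * hausdorff_premeasure d' s \<delta> (f ` A)
          \<le> (\<Sum>i. if U i = {} then 0 else set_diam d (U i) ^ s)"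
        unfolding zero .
    qed
    then have "ennreal c * (ennreal (1 / c) * hausdorff_premeasure d' s \<delta> (f ` A))
        \<le> ennreal c * hausdorff_premeasure d s (\<delta> / 2) A"
      by (intro mult_left_mono) auto
    then show ?thesis
      using c by (simp add: mult.assoc[symmetric] ennreal_mult[symmetric])
  qed
  show ?thesis
    unfolding hausdorff_measure_def[of d'] c_def[symmetric]
  proof (rule SUP_least)
    fix \<delta> :: real assume \<delta>: "\<delta> \<in> {0<..}"
    have "hausdorff_premeasure d' s \<delta> (f ` A) \<le> ennreal c * hausdorff_premeasure d s (\<delta> / 2) A"
      using pre \<delta> by simp
    also have "\<dots> \<le> ennreal c * hausdorff_measure d s A"
      unfolding hausdorff_measure_def using \<delta> by (intro mult_left_mono SUP_upper) auto
    finally show "hausdorff_premeasure d' s \<delta> (f ` A) \<le> ennreal c * hausdorff_measure d s A" .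
  qed
qed

lemma hausdorff_measure_contraction:
  assumes "s \<ge> 1" and contr: "\<And>x y. x \<in> A \<Longrightarrow> y \<in> A \<Longrightarrow> d' (f x) (f y) \<le> d x y"
  shows "hausdorff_measure d' s (f ` A) \<le> hausdorff_measure d s A"
proof -
  have "hausdorff_measure d' s (f ` A) \<le> ennreal (real 1 * 1) * hausdorff_measure d s A"
  proof (rule hausdorff_measure_image_le[OF \<open>s \<ge> 1\<close>])
    fix U
    have "set_diam d' (f ` (U \<inter> A)) \<le> set_diam d U"
      using contr by (intro set_diam_least) (auto intro!: order_trans[OF _ set_diam_upper[of _ U]] ennreal_leI)
    moreover have "x \<le> 2 * x" for x :: ennreal
      by (metis add_increasing2 mult_2 order_refl zero_le)
    ultimately show "\<exists>V :: nat \<Rightarrow> _ set. f ` (U \<inter> A) \<subseteq> (\<Union>j<1. V j) \<and>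
        (\<forall>j<1. set_diam d' (V j) \<le> 2 * set_diam d U \<and> set_diam d' (V j) ^ s \<le> ennreal 1 * set_diam d U ^ s)"
      by (intro exI[of _ "\<lambda>_. f ` (U \<inter> A)"]) (auto intro: power_mono order_trans)
  qed auto
  then show ?thesis by simp
qed

lemma euclidean_dist_sq: "(euclidean_dist n x y)\<^sup>2 = (\<Sum>i<n. (x i - y i)\<^sup>2)"
  by (simp add: euclidean_dist_def L2_set_def sum_nonneg)

lemma euclidean_dist_nonneg: "euclidean_dist n x y \<ge> 0"
  by (simp add: euclidean_dist_def)

lemma hausdorff_measure_subset:
  "s \<ge> 1 \<Longrightarrow> A \<subseteq> B \<Longrightarrow> hausdorff_measure d s A \<le> hausdorff_measure d s B"
  unfolding hausdorff_measure_def hausdorff_premeasure_def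
  by (intro SUP_mono' INF_superset_mono) auto

text \<open>
  A set of diameter \<open>u\<close> is split into slabs on which \<open>g\<close> oscillates by at most \<open>u / n\<close>. Their
  number is polynomial in \<open>n\<close>, and lifting a slab to the graph only costs the factor
  \<open>(1 + 1 / n)\<^sup>n\<close>, whereas the bi-Lipschitz bound for the whole graph would cost \<open>(1 + L)\<^sup>n\<close>.
\<close>

lemma hausdorff_measure_graph_le:
  assumes "d \<ge> 1" and "L \<ge> 0" and flat: "\<And>y. y \<in> A \<Longrightarrow> y d = 0"
    and lip: "\<And>y z. y \<in> A \<Longrightarrow> z \<in> A \<Longrightarrow> \<bar>g y - g z\<bar> \<le> L * euclidean_dist (Suc d) y z"
  defines "h \<equiv> \<lambda>y :: nat \<Rightarrow> real. y(d := g y)"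
  shows "hausdorff_measure (euclidean_dist (Suc d)) d (h ` A)
    \<le> ennreal (6 * (L * (real d + 1) + 2)) * hausdorff_measure (euclidean_dist (Suc d)) d A"
proof -
  define e where "e = euclidean_dist (Suc d)"
  define n where "n = real d + 1"
  \<comment> \<open>Slabs have width u / n, and \<open>g\<close> oscillates by at most L * u = (L *
    n) * (u / n) around its value at a base point. Hence J slabs on either side suffice, and 2 * J
    slabs at cost 3 each give the constant 6 * (L * n + 2).\<close>
  define J where "J = nat \<lceil>L * n\<rceil> + 1"
  have n: "n \<ge> 2" using assms by (simp add: n_def)
  have Jlo: "real J \<ge> L * n + 1" and Jhi: "real J \<le> L * n + 2"
    using \<open>L \<ge> 0\<close> n unfolding J_def by (auto, linarith+)
  have hd: "(e (h y) (h z))\<^sup>2 = (e y z)\<^sup>2 + (g y - g z)\<^sup>2" if "y \<in> A" "z \<in> A" for y z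
    using flat[OF that(1)] flat[OF that(2)] by (simp add: e_def euclidean_dist_sq h_def)
  have e0: "e y z \<ge> 0" for y z by (simp add: e_def euclidean_dist_nonneg)
  have exp3: "(1 + 1 / n) ^ d \<le> 3"
  proof -
    have "(1 + 1 / n) ^ d \<le> exp (1 / n) ^ d" using n by (intro power_mono exp_ge_add_one_self) auto
    also have "\<dots> = exp (real d / n)" by (simp add: exp_of_nat_mult[symmetric])
    also have "\<dots> \<le> exp 1" by (simp add: n_def)
    also have "\<dots> \<le> 3" by (rule exp_le)
    finally show ?thesis .
  qed
  have "hausdorff_measure e d (h ` A) \<le> ennreal (real (2 * J) * 3) * hausdorff_measure e d A"
  proof (rule hausdorff_measure_image_le[OF \<open>d \<ge> 1\<close>])
    show "0 < 2 * J" by (simp add: J_def)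
    fix U assume fin: "set_diam e U < \<top>"
    define u where "u = enn2real (set_diam e U)"
    have u: "set_diam e U = ennreal u" "u \<ge> 0" using fin by (auto simp: u_def)
    have eu: "e y z \<le> u" if "y \<in> U" "z \<in> U" for y z
      using set_diam_upper[of y U z e] that u by (simp add: ennreal_le_iff)
    have bound: "set_diam e V \<le> 2 * set_diam e U \<and> set_diam e V ^ d \<le> ennreal 3 * set_diam e U ^ d"
      if V: "\<And>x y. x \<in> V \<Longrightarrow> y \<in> V \<Longrightarrow> e x y \<le> u * (1 + 1 / n)" for V
    proof -
      have 1: "set_diam e V \<le> ennreal (u * (1 + 1 / n))"
        by (intro set_diam_least ennreal_leI V)
      have "u * (1 + 1 / n) \<le> u * 2" using u n by (intro mult_left_mono) auto
      then have "ennreal (u * (1 + 1 / n)) \<le> ennreal (2 * u)" by (intro ennreal_leI) auto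
      also have "\<dots> = 2 * set_diam e U" using u by (simp add: ennreal_mult)
      finally have 2: "set_diam e V \<le> 2 * set_diam e U" using 1 by (rule order_trans[rotated])
      have "set_diam e V ^ d \<le> ennreal (u * (1 + 1 / n)) ^ d" using 1 by (intro power_mono) auto
      also have "\<dots> = ennreal (u ^ d * (1 + 1 / n) ^ d)"
        using u n by (simp add: ennreal_power power_mult_distrib)
      also have "\<dots> \<le> ennreal (u ^ d * 3)" using u exp3 by (intro ennreal_leI mult_left_mono) auto
      also have "\<dots> = ennreal 3 * set_diam e U ^ d"
        using u by (subst mult.commute) (simp add: ennreal_mult ennreal_power)
      finally show ?thesis using 2 by simp
    qed
    show "\<exists>V. h ` (U \<inter> A) \<subseteq> (\<Union>j<2 * J. V j) \<and>
        (\<forall>j<2 * J. set_diam e (V j) \<le> 2 * set_diam e U \<and> set_diam e (V j) ^ d \<le> ennreal 3 * set_diam e U ^ d)"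
    proof (cases "u = 0 \<or> U \<inter> A = {}")
      \<comment> \<open>For u = 0 the slab width would be 0. In that case the Lipschitz bound makes
        any two image points have distance 0, and the whole image serves as each of the
        sets.\<close>
      case True
      have "e x y \<le> u * (1 + 1 / n)" if "x \<in> h ` (U \<inter> A)" "y \<in> h ` (U \<inter> A)" for x y
      proof -
        from that obtain a b where ab: "a \<in> U \<inter> A" "b \<in> U \<inter> A" "x = h a" "y = h b" by auto
        then have u0: "u = 0" using True by auto
        then have "e a b = 0" using eu[of a b] e0[of a b] ab by auto
        moreover from this have "g a = g b" using lip[of a b] ab by (auto simp: e_def)
        ultimately have "(e x y)\<^sup>2 = 0" using hd[of a b] ab by simp
        then show ?thesis using u0 by simp
      qed
      moreover have "0 \<in> {..<2 * J}" using \<open>0 < 2 * J\<close> by simp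
      then have "{..<2 * J} \<noteq> {}" by blast
      ultimately show ?thesis
        using bound by (intro exI[of _ "\<lambda>_. h ` (U \<inter> A)"]) auto
    next
      case False
      then obtain y0 where y0: "y0 \<in> U" "y0 \<in> A" by auto
      define w where "w = u / n"
      have w: "w > 0" using False u n by (auto simp: w_def)
      define V where "V j = h ` {y \<in> U \<inter> A. \<lfloor>(g y - g y0) / w\<rfloor> = int j - int J}" for j :: nat
      have "h ` (U \<inter> A) \<subseteq> (\<Union>j<2 * J. V j)"
      proof safe
        fix y assume y: "y \<in> U" "y \<in> A"
        have "\<bar>g y - g y0\<bar> \<le> L * e y y0" using lip[OF y(2) y0(2)] by (simp add: e_def)
        also have "\<dots> \<le> L * u" using eu y y0 \<open>L \<ge> 0\<close> by (intro mult_left_mono) auto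
        also have "L * u = L * n * w" using n by (simp add: w_def)
        finally have "\<bar>(g y - g y0) / w\<bar> \<le> L * n"
          using w by (simp add: pos_divide_le_eq)
        then have "\<bar>(g y - g y0) / w\<bar> + 1 \<le> real J" using Jlo by simp
        then have q: "\<lfloor>(g y - g y0) / w\<rfloor> + int J \<ge> 0" "\<lfloor>(g y - g y0) / w\<rfloor> < int J"
          by (linarith)+
        then have "h y \<in> V (nat (\<lfloor>(g y - g y0) / w\<rfloor> + int J))" using y by (auto simp: V_def)
        then show "h y \<in> (\<Union>j<2 * J. V j)" using q
          by (intro UN_I[of "nat (\<lfloor>(g y - g y0) / w\<rfloor> + int J)"]) auto
      qed
      moreover have "e x y \<le> u * (1 + 1 / n)" if "x \<in> V j" "y \<in> V j" for x y j
      proof -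
        from that obtain a b where ab: "a \<in> U \<inter> A" "b \<in> U \<inter> A" "x = h a" "y = h b"
          "\<lfloor>(g a - g y0) / w\<rfloor> = \<lfloor>(g b - g y0) / w\<rfloor>" by (auto simp: V_def)
        then have "\<bar>(g a - g y0) / w - (g b - g y0) / w\<bar> \<le> 1" by linarith
        then have "\<bar>g a - g b\<bar> / w \<le> 1" using w by (simp add: diff_divide_distrib[symmetric])
        then have gw: "\<bar>g a - g b\<bar> \<le> w" using w by simp
        have "(e x y)\<^sup>2 \<le> u\<^sup>2 + w\<^sup>2"
          using hd[of a b] ab power_mono[OF eu[of a b] e0, of 2] power_mono[OF gw, of 2] by auto
        also have "\<dots> \<le> (u + w)\<^sup>2" using u w by (simp add: power2_sum)
        finally have "e x y \<le> u + w" by (rule power2_le_imp_le) (use u w in simp)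
        then show ?thesis by (simp add: w_def algebra_simps)
      qed
      ultimately show ?thesis using bound by (intro exI[of _ V]) auto
    qed
  qed simp
  also have "\<dots> \<le> ennreal (6 * (L * n + 2)) * hausdorff_measure e d A"
    using Jhi by (intro mult_right_mono ennreal_leI) auto
  finally show ?thesis by (simp add: e_def n_def)
qed

section \<open>The \<open>p\<close>-Gaussian distribution\<close>

lemma nn_integral_lborel_even:
  fixes f :: "real \<Rightarrow> ennreal"
  assumes [measurable]: "f \<in> borel_measurable borel" and even: "\<And>x. f (- x) = f x"
  shows "(\<integral>\<^sup>+x. f x \<partial>lborel) = 2 * (\<integral>\<^sup>+x. f x * indicator {0<..} x \<partial>lborel)"
proof -
  have "(\<integral>\<^sup>+x. f x \<partial>lborel)
      = (\<integral>\<^sup>+x. f x * indicator {0<..} x + f x * indicator {..<0} x \<partial>lborel)"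
  proof (rule nn_integral_cong_AE)
    have "AE x in lborel. x \<noteq> (0::real)" by (rule AE_lborel_singleton)
    then show "AE x in lborel. f x = f x * indicator {0<..} x + f x * indicator {..<0} x"
      by eventually_elim (auto simp: indicator_def)
  qed
  also have "\<dots> = (\<integral>\<^sup>+x. f x * indicator {0<..} x \<partial>lborel) + (\<integral>\<^sup>+x. f x * indicator {..<0} x \<partial>lborel)"
    by (intro nn_integral_add) auto
  also have "(\<integral>\<^sup>+x. f x * indicator {..<0} x \<partial>lborel)
      = (\<integral>\<^sup>+x. f (0 + (-1) * x) * indicator {..<0} (0 + (-1) * x) \<partial>lborel)"
    using nn_integral_real_affine[of "\<lambda>x. f x * indicator {..<0} x" "-1" 0] by simp
  also have "\<dots> = (\<integral>\<^sup>+x. f x * indicator {0<..} x \<partial>lborel)"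
    by (intro nn_integral_cong) (auto simp: even indicator_def)
  finally show ?thesis by (simp add: mult_2)
qed

context
  fixes p :: real
  assumes p: "p \<ge> 1"
begin

lemma sets_p_gaussian [measurable_cong]: "sets (p_gaussian p) = sets borel"
  by (simp add: p_gaussian_def)

lemma space_p_gaussian [simp]: "space (p_gaussian p) = UNIV"
  by (simp add: p_gaussian_def)

text \<open>This says that |X|^p / p has the Gamma distribution with shape 1 / p and scale 1: fold
  the symmetric density onto the positive half line and substitute u = x^p / p. All moments below
  become Gamma integrals in this way.\<close>

lemma p_gaussian_powr_law:
  fixes f :: "real \<Rightarrow> ennreal"
  assumes [measurable]: "f \<in> borel_measurable borel"
  shows "(\<integral>\<^sup>+x. f (\<bar>x\<bar> powr p / p) \<partial>p_gaussian p)
    = (\<integral>\<^sup>+u. f u * ennreal (u powr (1 / p - 1) * exp (- u) / Gamma (1 / p)) * indicator {0<..} u \<partial>lborel)"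
proof -
  define c where "c = 1 / (2 * p powr (1 / p) * Gamma (1 + 1 / p))"
  have G: "Gamma (1 / p) > 0" using p by (intro Gamma_real_pos) auto
  have G1: "Gamma (1 + 1 / p) = Gamma (1 / p) / p"
  proof -
    have "1 / p \<notin> \<int>\<^sub>\<le>\<^sub>0" using p nonpos_Ints_nonpos[of "1 / p"] by (auto simp: divide_le_0_iff)
    then show ?thesis using Gamma_plus1[of "1 / p"] by (simp add: add.commute)
  qed
  have c: "c > 0" using G p by (simp add: c_def G1)
  let ?F = "\<lambda>u. f u * ennreal (u powr (1 / p - 1) * exp (- u) / Gamma (1 / p))"
  have "(\<integral>\<^sup>+x. f (\<bar>x\<bar> powr p / p) \<partial>p_gaussian p)
      = (\<integral>\<^sup>+x. ennreal (c * exp (- (\<bar>x\<bar> powr p) / p)) * f (\<bar>x\<bar> powr p / p) \<partial>lborel)"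
    unfolding p_gaussian_def c_def[symmetric] by (subst nn_integral_density) auto
  also have "\<dots> = 2 * (\<integral>\<^sup>+x. ennreal (c * exp (- (\<bar>x\<bar> powr p) / p)) * f (\<bar>x\<bar> powr p / p) * indicator {0<..} x \<partial>lborel)"
    by (rule nn_integral_lborel_even) auto
  also have "\<dots> = (\<integral>\<^sup>+x. 2 * (ennreal (c * exp (- (\<bar>x\<bar> powr p) / p)) * f (\<bar>x\<bar> powr p / p) * indicator {0<..} x) \<partial>lborel)"
    by (intro nn_integral_cmult[symmetric]) auto
  also have "\<dots> = (\<integral>\<^sup>+x. ?F (x powr p / p) * ennreal (x powr (p - 1)) * indicator {0<..} x \<partial>lborel)"
  proof (intro nn_integral_cong)
    fix x :: real
    show "2 * (ennreal (c * exp (- (\<bar>x\<bar> powr p) / p)) * f (\<bar>x\<bar> powr p / p) * indicator {0<..} x)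
      = ?F (x powr p / p) * ennreal (x powr (p - 1)) * indicator {0<..} x"
    proof (cases "x > 0")
      case True
      \<comment> \<open>The Jacobian x^(p-1) cancels the power of x in the Gamma density exactly;
        what is left is part of the normalising constant.\<close>
      have "(x powr p / p) powr (1 / p - 1) * x powr (p - 1) = p powr (1 - 1 / p)"
      proof -
        have "(x powr p / p) powr (1 / p - 1) = x powr (p * (1 / p - 1)) / p powr (1 / p - 1)"
          using True p by (simp add: powr_divide powr_powr)
        also have "p * (1 / p - 1) = 1 - p" using p by (simp add: field_simps)
        also have "x powr (1 - p) / p powr (1 / p - 1) * x powr (p - 1) = inverse (p powr (1 / p - 1))"
          using True by (simp add: powr_add[symmetric] divide_inverse mult.commute mult.left_commute)
        also have "\<dots> = p powr (1 - 1 / p)" by (simp add: powr_minus[symmetric])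
        finally show ?thesis by simp
      qed
      then have "(x powr p / p) powr (1 / p - 1) * exp (- (x powr p / p)) / Gamma (1 / p) * x powr (p - 1)
          = p powr (1 - 1 / p) * exp (- (x powr p / p)) / Gamma (1 / p)"
        by (simp add: mult.commute mult.left_commute)
      also have "\<dots> = 2 * (c * exp (- (x powr p) / p))"
      proof -
        have "2 * c = p powr (1 - 1 / p) / Gamma (1 / p)"
          using p by (simp add: c_def G1 powr_diff)
        from arg_cong[OF this, of "\<lambda>t. t * exp (- (x powr p / p))"] show ?thesis by simp
      qed
      finally have *: "2 * (c * exp (- (x powr p) / p))
        = (x powr p / p) powr (1 / p - 1) * exp (- (x powr p / p)) / Gamma (1 / p) * x powr (p - 1)" ..
      have "2 * ennreal (c * exp (- (x powr p) / p)) = ennreal (2 * (c * exp (- (x powr p) / p)))"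
        using c by (simp add: ennreal_mult)
      also have "\<dots> = ennreal ((x powr p / p) powr (1 / p - 1) * exp (- (x powr p / p)) / Gamma (1 / p))
          * ennreal (x powr (p - 1))"
        unfolding * using G by (intro ennreal_mult) auto
      finally have **: "2 * ennreal (c * exp (- (x powr p) / p)) = \<dots>" .
      from arg_cong[OF **, of "\<lambda>z. z * f (x powr p / p)"] show ?thesis
        using True by (simp add: mult_ac)
    qed simp
  qed
  also have "\<dots> = (\<integral>\<^sup>+u. ?F u * indicator {0<..} u \<partial>lborel)"
  proof (rule nn_integral_substitution_Ioi)
    show "((\<lambda>x. x powr p / p) has_real_derivative t powr (p - 1)) (at t)" if "t > 0" for t
      using that p by (auto intro!: derivative_eq_intros simp: powr_diff)
    show "continuous_on {0<..} (\<lambda>t. t powr (p - 1))" by (auto intro!: continuous_intros)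
    show "((\<lambda>x. x powr p / p) \<longlongrightarrow> 0) (at_right 0)" using p by real_asymp
    show "filterlim (\<lambda>x. x powr p / p) at_top at_top" using p by real_asymp
  qed auto
  finally show ?thesis .
qed

lemma prob_space_p_gaussian: "prob_space (p_gaussian p)"
proof
  have G: "Gamma (1 / p) > 0" using p by (intro Gamma_real_pos) auto
  have "emeasure (p_gaussian p) (space (p_gaussian p)) = (\<integral>\<^sup>+x. (\<lambda>_. 1) (\<bar>x\<bar> powr p / p) \<partial>p_gaussian p)"
    by simp
  also have "\<dots> = (\<integral>\<^sup>+u. 1 * ennreal (u powr (1 / p - 1) * exp (- u) / Gamma (1 / p)) * indicator {0<..} u \<partial>lborel)"
    by (rule p_gaussian_powr_law) auto
  also have "\<dots> = (\<integral>\<^sup>+u. ennreal (1 / Gamma (1 / p)) * ennreal (indicator {0..} u * u powr (1 / p - 1) / exp u) \<partial>lborel)"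
    using G by (intro nn_integral_cong) (auto simp: indicator_def ennreal_mult[symmetric] exp_minus field_simps)
  also have "\<dots> = ennreal (1 / Gamma (1 / p)) * ennreal (Gamma (1 / p))"
    using p by (simp add: nn_integral_cmult Gamma_conv_nn_integral_real)
  also have "\<dots> = 1" using G by (simp add: ennreal_mult[symmetric])
  finally show "emeasure (p_gaussian p) (space (p_gaussian p)) = 1" .
qed

text \<open>Negative exponents down to -1 / p are included on purpose: they control ln |X| near
  0.\<close>

lemma p_gaussian_moment:
  assumes "s > - (1 / p)"
  shows "(\<integral>\<^sup>+x. ennreal ((\<bar>x\<bar> powr p / p) powr s) \<partial>p_gaussian p) = ennreal (Gamma (1 / p + s) / Gamma (1 / p))"
proof -
  have G: "Gamma (1 / p) > 0" using p by (intro Gamma_real_pos) auto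
  have "(\<integral>\<^sup>+x. ennreal ((\<bar>x\<bar> powr p / p) powr s) \<partial>p_gaussian p)
    = (\<integral>\<^sup>+u. ennreal (u powr s) * ennreal (u powr (1 / p - 1) * exp (- u) / Gamma (1 / p)) * indicator {0<..} u \<partial>lborel)"
    by (rule p_gaussian_powr_law) auto
  also have "\<dots> = (\<integral>\<^sup>+u. ennreal (1 / Gamma (1 / p)) * ennreal (indicator {0..} u * u powr ((1 / p + s) - 1) / exp u) \<partial>lborel)"
  proof (intro nn_integral_cong)
    fix u :: real
    have "u powr s * (u powr (1 / p - 1) * exp (- u) / Gamma (1 / p)) = 1 / Gamma (1 / p) * (u powr ((1 / p + s) - 1) / exp u)"
    proof -
      have "u powr ((1 / p + s) - 1) = u powr s * u powr (1 / p - 1)"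
        by (simp add: powr_add[symmetric] algebra_simps)
      then show ?thesis by (simp add: exp_minus divide_inverse)
    qed
    then show "ennreal (u powr s) * ennreal (u powr (1 / p - 1) * exp (- u) / Gamma (1 / p)) * indicator {0<..} u
      = ennreal (1 / Gamma (1 / p)) * ennreal (indicator {0..} u * u powr ((1 / p + s) - 1) / exp u)"
      using G by (auto simp: indicator_def ennreal_mult[symmetric])
  qed
  also have "\<dots> = ennreal (1 / Gamma (1 / p)) * ennreal (Gamma (1 / p + s))"
    using assms Gamma_conv_nn_integral_real[of "1 / p + s"] by (simp add: nn_integral_cmult)
  also have "\<dots> = ennreal (Gamma (1 / p + s) / Gamma (1 / p))"
    using G assms by (subst ennreal_mult[symmetric]) (auto intro!: less_imp_le[OF Gamma_real_pos])
  finally show ?thesis .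
qed

text \<open>Multiplying by exp (\<theta> u) turns the factor exp (- u) into exp (- (1 - \<theta>)
  u); rescaling by q = 1 - \<theta> leads back to the Gamma integral.\<close>

lemma p_gaussian_exp_moment:
  assumes "\<theta> < 1"
  shows "(\<integral>\<^sup>+x. ennreal (exp (\<theta> * (\<bar>x\<bar> powr p / p))) \<partial>p_gaussian p) < \<infinity>"
proof -
  define q where "q = 1 - \<theta>"
  have q: "q > 0" using assms by (simp add: q_def)
  have G: "Gamma (1 / p) > 0" using p by (intro Gamma_real_pos) auto
  let ?K = "q powr (1 - 1 / p) / Gamma (1 / p)"
  have "(\<integral>\<^sup>+x. ennreal (exp (\<theta> * (\<bar>x\<bar> powr p / p))) \<partial>p_gaussian p)
    = (\<integral>\<^sup>+u. ennreal (exp (\<theta> * u)) * ennreal (u powr (1 / p - 1) * exp (- u) / Gamma (1 / p)) * indicator {0<..} u \<partial>lborel)"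
    by (rule p_gaussian_powr_law) auto
  also have "\<dots> = (\<integral>\<^sup>+u. ennreal ?K * ennreal (indicator {0..} (0 + q * u) * (0 + q * u) powr (1 / p - 1) / exp (0 + q * u)) \<partial>lborel)"
  proof (intro nn_integral_cong)
    fix u :: real
    show "ennreal (exp (\<theta> * u)) * ennreal (u powr (1 / p - 1) * exp (- u) / Gamma (1 / p)) * indicator {0<..} u
      = ennreal ?K * ennreal (indicator {0..} (0 + q * u) * (0 + q * u) powr (1 / p - 1) / exp (0 + q * u))"
    proof (cases "u > 0")
      case True
      have "exp (\<theta> * u) * (u powr (1 / p - 1) * exp (- u) / Gamma (1 / p))
          = ?K * ((q * u) powr (1 / p - 1) / exp (q * u))"
      proof -
        have "q powr (1 - 1 / p) * (q * u) powr (1 / p - 1) = u powr (1 / p - 1)"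
          using q True by (simp add: powr_mult mult.assoc[symmetric] powr_add[symmetric])
        moreover have "exp (\<theta> * u) * exp (- u) = 1 / exp (q * u)"
          by (simp add: q_def exp_add[symmetric] exp_minus[symmetric] divide_inverse algebra_simps)
        moreover have "exp (\<theta> * u) * (u powr (1 / p - 1) * exp (- u) / Gamma (1 / p))
            = (exp (\<theta> * u) * exp (- u)) * (u powr (1 / p - 1) / Gamma (1 / p))" by simp
        ultimately show ?thesis by (simp add: mult_ac)
      qed
      then show ?thesis using True q G by (simp add: ennreal_mult[symmetric])
    next
      case False
      then show ?thesis using q by (cases "u = 0") (auto simp: indicator_def zero_le_mult_iff)
    qed
  qed
  also have "\<dots> = ennreal ?K * (\<integral>\<^sup>+u. ennreal (indicator {0..} (0 + q * u) * (0 + q * u) powr (1 / p - 1) / exp (0 + q * u)) \<partial>lborel)"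
    by (intro nn_integral_cmult) auto
  also have "\<dots> < \<infinity>"
  proof -
    have "ennreal (Gamma (1 / p)) = ennreal \<bar>q\<bar> * (\<integral>\<^sup>+u. ennreal (indicator {0..} (0 + q * u) * (0 + q * u) powr (1 / p - 1) / exp (0 + q * u)) \<partial>lborel)"
    proof -
      have "ennreal (Gamma (1 / p)) = (\<integral>\<^sup>+u. ennreal (indicator {0..} u * u powr (1 / p - 1) / exp u) \<partial>lborel)"
        using p by (intro Gamma_conv_nn_integral_real) auto
      also have "\<dots> = ennreal \<bar>q\<bar> * (\<integral>\<^sup>+u. ennreal (indicator {0..} (0 + q * u) * (0 + q * u) powr (1 / p - 1) / exp (0 + q * u)) \<partial>lborel)"
        using q by (intro nn_integral_real_affine) auto
      finally show ?thesis .
    qed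
    then have "ennreal \<bar>q\<bar> * (\<integral>\<^sup>+u. ennreal (indicator {0..} (0 + q * u) * (0 + q * u) powr (1 / p - 1) / exp (0 + q * u)) \<partial>lborel) < \<infinity>"
      by (metis ennreal_less_top infinity_ennreal_def)
    then have "(\<integral>\<^sup>+u. ennreal (indicator {0..} (0 + q * u) * (0 + q * u) powr (1 / p - 1) / exp (0 + q * u)) \<partial>lborel) < \<infinity>"
      using q by (auto simp: ennreal_mult_less_top)
    then show ?thesis by (simp add: ennreal_mult_less_top)
  qed
  finally show ?thesis .
qed

lemma p_gaussian_integrable_exp_powr: "integrable (p_gaussian p) (\<lambda>x. exp (\<bar>x\<bar> powr p / (2 * p)))"
  using p_gaussian_exp_moment[of "1 / 2"]
  by (intro integrableI_bounded) (auto simp: mult.commute)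

text \<open>For x \<noteq> 0, exp (|ln |x|| / 2) is at most 1 + |x|^(1/2) + |x|^(-1/2), and both
  moments are finite; at x = 0 the summand 1 suffices because \<open>ln 0 = 0\<close>.\<close>

lemma p_gaussian_integrable_exp_ln: "integrable (p_gaussian p) (\<lambda>x. exp (\<bar>ln \<bar>x\<bar>\<bar> / 2))"
proof -
  interpret prob_space "p_gaussian p" by (rule prob_space_p_gaussian)
  have int: "integrable (p_gaussian p) (\<lambda>x. (\<bar>x\<bar> powr p / p) powr s)" if "s > - (1 / p)" for s
    using p_gaussian_moment[OF that] by (intro integrableI_bounded) auto
  \<comment> \<open>With this exponent (|x|^p)^h = |x|^(1/2), and both h and - h lie above the
    critical value -1 / p.\<close>
  define h where "h = 1 / (2 * p)"
  have h: "h > - (1 / p)" "- h > - (1 / p)" using p by (auto simp: h_def field_simps)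
  show ?thesis
  proof (rule Bochner_Integration.integrable_bound)
    show "integrable (p_gaussian p) (\<lambda>x. 1 + p powr h * (\<bar>x\<bar> powr p / p) powr h + p powr (- h) * (\<bar>x\<bar> powr p / p) powr (- h))"
      using int[OF h(1)] int[OF h(2)] by auto
    show "AE x in p_gaussian p. norm (exp (\<bar>ln \<bar>x\<bar>\<bar> / 2))
        \<le> norm (1 + p powr h * (\<bar>x\<bar> powr p / p) powr h + p powr (- h) * (\<bar>x\<bar> powr p / p) powr (- h))"
    proof (rule AE_I2)
      fix x :: real
      show "norm (exp (\<bar>ln \<bar>x\<bar>\<bar> / 2))
        \<le> norm (1 + p powr h * (\<bar>x\<bar> powr p / p) powr h + p powr (- h) * (\<bar>x\<bar> powr p / p) powr (- h))"
      proof (cases "x = 0")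
        case False
        have *: "p powr s * (\<bar>x\<bar> powr p / p) powr s = exp (p * s * ln \<bar>x\<bar>)" for s
        proof -
          have "p powr s * (\<bar>x\<bar> powr p / p) powr s = (\<bar>x\<bar> powr p) powr s"
            using p by (simp add: powr_divide)
          also have "\<dots> = exp (p * s * ln \<bar>x\<bar>)" using False by (simp add: powr_powr powr_def)
          finally show ?thesis .
        qed
        have "p * h = 1 / 2" using p by (simp add: h_def)
        then have e: "exp (p * h * ln \<bar>x\<bar>) = exp (ln \<bar>x\<bar> / 2)" "exp (p * (- h) * ln \<bar>x\<bar>) = exp (- ln \<bar>x\<bar> / 2)"
          by simp_all
        have "exp (\<bar>ln \<bar>x\<bar>\<bar> / 2) \<le> 1 + exp (ln \<bar>x\<bar> / 2) + exp (- ln \<bar>x\<bar> / 2)"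
          by (cases "ln \<bar>x\<bar> \<ge> 0") (simp_all add: add_increasing add_increasing2)
        then show ?thesis unfolding * e by simp
      qed simp
    qed
  qed measurable
qed

lemma p_gaussian_AE_nonzero: "AE x in p_gaussian p. x \<noteq> 0"
proof -
  have "AE x in lborel. x \<noteq> (0::real)" by (rule AE_lborel_singleton)
  then show ?thesis unfolding p_gaussian_def by (subst AE_density) auto
qed

text \<open>The factor 1 / p in the exponent of the density normalises this moment to 1, by the
  functional equation of Gamma at 1 / p. It is the 1 subtracted in \<open>lin_stat\<close>.\<close>

lemma p_gaussian_integral_powr: "integrable (p_gaussian p) (\<lambda>x. \<bar>x\<bar> powr p)" "(\<integral>x. \<bar>x\<bar> powr p \<partial>p_gaussian p) = 1"
proof -
  have G: "Gamma (1 / p) > 0" using p by (intro Gamma_real_pos) auto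
  have "1 / p \<notin> \<int>\<^sub>\<le>\<^sub>0" using p nonpos_Ints_nonpos[of "1 / p"] by (auto simp: divide_le_0_iff)
  then have G1: "Gamma (1 / p + 1) = Gamma (1 / p) / p" using Gamma_plus1[of "1 / p"] by simp
  have "(\<integral>\<^sup>+x. ennreal (\<bar>x\<bar> powr p) \<partial>p_gaussian p)
      = (\<integral>\<^sup>+x. ennreal p * ennreal ((\<bar>x\<bar> powr p / p) powr 1) \<partial>p_gaussian p)"
    using p by (intro nn_integral_cong) (auto simp: ennreal_mult[symmetric])
  also have "\<dots> = ennreal p * ennreal (Gamma (1 / p + 1) / Gamma (1 / p))"
    using p by (subst nn_integral_cmult, measurable, subst p_gaussian_moment) (auto intro: less_le_trans[of _ 0])
  also have "\<dots> = 1"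
  proof -
    have "Gamma (1 / p) \<noteq> 0" using G by linarith
    then show ?thesis using p by (simp add: G1 ennreal_mult[symmetric])
  qed
  finally have *: "(\<integral>\<^sup>+x. ennreal (\<bar>x\<bar> powr p) \<partial>p_gaussian p) = ennreal 1" by simp
  show "integrable (p_gaussian p) (\<lambda>x. \<bar>x\<bar> powr p)"
    using * by (intro integrableI_bounded) auto
  show "(\<integral>x. \<bar>x\<bar> powr p \<partial>p_gaussian p) = 1"
    using * by (intro integral_eq_nn_integral[THEN trans]) auto
qed

end

text \<open>The contribution of one coordinate to the linearised log ratio: ln |x| comes from the
  geometric mean, and (|x|^p - 1) / p from the logarithm of the p-th power mean, expanded where the
  mean of |x|^p equals its expectation 1.\<close>

definition lin_stat :: "real \<Rightarrow> real \<Rightarrow> real" where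
  "lin_stat p x = ln \<bar>x\<bar> - m_const p - (\<bar>x\<bar> powr p - 1) / p"

lemma measurable_lin_stat [measurable]: "lin_stat p \<in> borel_measurable borel"
  unfolding lin_stat_def by measurable

context
  fixes p :: real
  assumes p: "p \<ge> 1"
begin

interpretation prob_space "p_gaussian p" by (rule prob_space_p_gaussian[OF p])

lemma p_gaussian_integrable_ln: "integrable (p_gaussian p) (\<lambda>x. ln \<bar>x\<bar>)"
proof (rule Bochner_Integration.integrable_bound)
  show "integrable (p_gaussian p) (\<lambda>x. 2 * exp (\<bar>ln \<bar>x\<bar>\<bar> / 2))"
    using p_gaussian_integrable_exp_ln[OF p] by simp
  show "AE x in p_gaussian p. norm (ln \<bar>x\<bar>) \<le> norm (2 * exp (\<bar>ln \<bar>x\<bar>\<bar> / 2))"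
  proof (rule AE_I2)
    fix x :: real
    show "norm (ln \<bar>x\<bar>) \<le> norm (2 * exp (\<bar>ln \<bar>x\<bar>\<bar> / 2))"
    proof -
      have "\<bar>ln \<bar>x\<bar>\<bar> \<le> 2 * exp (\<bar>ln \<bar>x\<bar>\<bar> / 2)"
        using exp_ge_add_one_self[of "\<bar>ln \<bar>x\<bar>\<bar> / 2"] by linarith
      then show ?thesis by simp
    qed
  qed
qed (simp add: sets_p_gaussian[OF p] cong: measurable_cong_sets)

lemma lin_stat_integral_zero: "integrable (p_gaussian p) (lin_stat p)" "(\<integral>x. lin_stat p x \<partial>p_gaussian p) = 0"
  using p_gaussian_integrable_ln p_gaussian_integral_powr[OF p] prob_space
  by (auto simp: lin_stat_def[abs_def] m_const_def[symmetric] diff_divide_distrib)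

lemma s_sq_lin_stat: "s_sq p = (\<integral>x. (lin_stat p x)\<^sup>2 \<partial>p_gaussian p)"
proof -
  have E: "(\<integral>x. ln \<bar>x\<bar> - 1 / p * \<bar>x\<bar> powr p \<partial>p_gaussian p) = m_const p - 1 / p"
    using p_gaussian_integrable_ln p_gaussian_integral_powr[OF p] by (simp add: m_const_def)
  have "ln \<bar>x\<bar> - 1 / p * \<bar>x\<bar> powr p - (m_const p - 1 / p) = lin_stat p x" for x
    by (simp add: lin_stat_def diff_divide_distrib)
  then show ?thesis unfolding s_sq_def E by simp
qed

lemma lin_stat_exp_moment: "integrable (p_gaussian p) (\<lambda>x. exp (1 / 4 * \<bar>lin_stat p x\<bar>))"
proof (rule Bochner_Integration.integrable_bound)
  let ?C = "exp (1 / 4 * (\<bar>m_const p\<bar> + 1))"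
  show "integrable (p_gaussian p) (\<lambda>x. ?C * (exp (\<bar>ln \<bar>x\<bar>\<bar> / 2) + exp (\<bar>x\<bar> powr p / (2 * p))))"
    using p_gaussian_integrable_exp_ln[OF p] p_gaussian_integrable_exp_powr[OF p] by simp
  show "AE x in p_gaussian p. norm (exp (1 / 4 * \<bar>lin_stat p x\<bar>))
      \<le> norm (?C * (exp (\<bar>ln \<bar>x\<bar>\<bar> / 2) + exp (\<bar>x\<bar> powr p / (2 * p))))"
  proof (rule AE_I2)
    fix x :: real
    define A where "A = \<bar>ln \<bar>x\<bar>\<bar>"
    define B where "B = \<bar>x\<bar> powr p / p"
    have B: "B \<ge> 0" using p by (simp add: B_def)
    have "1 / p \<le> 1" using p by simp
    then have "\<bar>lin_stat p x\<bar> \<le> A + \<bar>m_const p\<bar> + 1 + B"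
    proof -
      have "lin_stat p x = ln \<bar>x\<bar> - m_const p - B + 1 / p"
        by (simp add: lin_stat_def B_def diff_divide_distrib)
      moreover have "0 \<le> 1 / p" "1 / p \<le> 1" using p by auto
      ultimately show ?thesis using B unfolding A_def by linarith
    qed
    then have "1 / 4 * \<bar>lin_stat p x\<bar> \<le> 1 / 4 * (A + \<bar>m_const p\<bar> + 1 + B)"
      by (intro mult_left_mono) auto
    also have "\<dots> = 1 / 4 * (\<bar>m_const p\<bar> + 1) + 1 / 4 * (A + B)" by (simp add: algebra_simps)
    finally have "1 / 4 * \<bar>lin_stat p x\<bar> \<le> 1 / 4 * (\<bar>m_const p\<bar> + 1) + 1 / 4 * (A + B)" .
    then have "exp (1 / 4 * \<bar>lin_stat p x\<bar>) \<le> exp (1 / 4 * (\<bar>m_const p\<bar> + 1) + 1 / 4 * (A + B))"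
      by (simp only: exp_le_cancel_iff)
    also have "\<dots> = ?C * exp (1 / 4 * (A + B))" by (rule exp_add)
    also have "\<dots> \<le> ?C * (exp (A / 2) + exp (B / 2))"
    proof (intro mult_left_mono)
      \<comment> \<open>Since (A + B) / 4 \<le> max (A / 2) (B / 2), the logarithmic and the power
        part can be integrated separately although both depend on the same x. This is the reason for
        the rate 1 / 4.\<close>
      have "exp (1 / 4 * (A + B)) \<le> exp (max (A / 2) (B / 2))" by (simp add: max_def)
      also have "\<dots> \<le> exp (A / 2) + exp (B / 2)" by (simp add: max_def add_increasing add_increasing2)
      finally show "exp (1 / 4 * (A + B)) \<le> exp (A / 2) + exp (B / 2)" .
    qed simp
    finally show "norm (exp (1 / 4 * \<bar>lin_stat p x\<bar>))
      \<le> norm (?C * (exp (\<bar>ln \<bar>x\<bar>\<bar> / 2) + exp (\<bar>x\<bar> powr p / (2 * p))))"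
      by (simp add: A_def B_def mult.commute)
  qed
qed (simp add: sets_p_gaussian[OF p] cong: measurable_cong_sets)

lemma powr_exp_moment: "integrable (p_gaussian p) (\<lambda>x. exp (1 / (2 * p) * \<bar>\<bar>x\<bar> powr p - 1\<bar>))"
proof (rule Bochner_Integration.integrable_bound)
  let ?C = "exp (1 / (2 * p))"
  show "integrable (p_gaussian p) (\<lambda>x. ?C * exp (\<bar>x\<bar> powr p / (2 * p)))"
    using p_gaussian_integrable_exp_powr[OF p] by simp
  show "AE x in p_gaussian p. norm (exp (1 / (2 * p) * \<bar>\<bar>x\<bar> powr p - 1\<bar>)) \<le> norm (?C * exp (\<bar>x\<bar> powr p / (2 * p)))"
  proof (rule AE_I2)
    fix x :: real
    have "\<bar>\<bar>x\<bar> powr p - 1\<bar> \<le> 1 + \<bar>x\<bar> powr p" by (simp add: abs_le_iff)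
    then have "1 / (2 * p) * \<bar>\<bar>x\<bar> powr p - 1\<bar> \<le> 1 / (2 * p) * (1 + \<bar>x\<bar> powr p)"
      using p by (intro mult_left_mono) auto
    then have "exp (1 / (2 * p) * \<bar>\<bar>x\<bar> powr p - 1\<bar>) \<le> exp (1 / (2 * p) + \<bar>x\<bar> powr p / (2 * p))"
      by (simp add: add_divide_distrib)
    then show "norm (exp (1 / (2 * p) * \<bar>\<bar>x\<bar> powr p - 1\<bar>)) \<le> norm (?C * exp (\<bar>x\<bar> powr p / (2 * p)))"
      by (simp add: exp_add)
  qed
qed (simp add: sets_p_gaussian[OF p] cong: measurable_cong_sets)

lemma lin_stat_square_integrable: "integrable (p_gaussian p) (\<lambda>x. (lin_stat p x)\<^sup>2)"
proof (rule Bochner_Integration.integrable_bound)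
  show "integrable (p_gaussian p) (\<lambda>x. 64 * exp (1 / 4 * \<bar>lin_stat p x\<bar>))"
    using lin_stat_exp_moment by simp
  show "AE x in p_gaussian p. norm ((lin_stat p x)\<^sup>2) \<le> norm (64 * exp (1 / 4 * \<bar>lin_stat p x\<bar>))"
  proof (rule AE_I2)
    fix x :: real
    let ?t = "\<bar>lin_stat p x\<bar> / 8"
    have "?t \<le> exp ?t" using exp_ge_add_one_self[of ?t] by linarith
    then have "?t\<^sup>2 \<le> (exp ?t)\<^sup>2" by (intro power_mono) auto
    also have "\<dots> = exp (1 / 4 * \<bar>lin_stat p x\<bar>)" by (simp add: exp_double[symmetric])
    finally show "norm ((lin_stat p x)\<^sup>2) \<le> norm (64 * exp (1 / 4 * \<bar>lin_stat p x\<bar>))"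
      by (simp add: power_divide)
  qed
qed (simp add: sets_p_gaussian[OF p] cong: measurable_cong_sets)

text \<open>The rate function divides by this variance. Near 0 the logarithm drives
  \<open>lin_stat\<close> below -1 while the density stays bounded away from 0, so the second moment
  has a positive lower bound c * r.\<close>

lemma s_sq_pos: "s_sq p > 0"
proof -
  \<comment> \<open>For x < r the term ln x outweighs - m and the summand 1 / p \<le> 1 by at least
    1. The constant c below is a lower bound for the density on (0, r), where x^p / p \<le>
    1.\<close>
  define r where "r = exp (- \<bar>m_const p\<bar> - 2)"
  define c where "c = 1 / (2 * p powr (1 / p) * Gamma (1 + 1 / p)) * exp (- 1)"
  have r: "r > 0" "r \<le> 1" by (auto simp: r_def)
  have "Gamma (1 + 1 / p) > 0" using p by (intro Gamma_real_pos add_pos_pos) auto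
  then have c: "c > 0" using p by (simp add: c_def)
  have "ennreal (c * r) = (\<integral>\<^sup>+x. ennreal c * indicator {0<..<r} x \<partial>lborel)"
    using r c by (simp add: nn_integral_cmult ennreal_mult)
  also have "\<dots> \<le> (\<integral>\<^sup>+x. ennreal (1 / (2 * p powr (1 / p) * Gamma (1 + 1 / p)) * exp (- (\<bar>x\<bar> powr p) / p))
      * ennreal ((lin_stat p x)\<^sup>2) \<partial>lborel)"
  proof (intro nn_integral_mono)
    fix x :: real
    show "ennreal c * indicator {0<..<r} x \<le> ennreal (1 / (2 * p powr (1 / p) * Gamma (1 + 1 / p)) * exp (- (\<bar>x\<bar> powr p) / p))
      * ennreal ((lin_stat p x)\<^sup>2)"
    proof (cases "x \<in> {0<..<r}")
      case True
      have "ln x \<le> ln r" using True by simp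
      then have "ln x \<le> - \<bar>m_const p\<bar> - 2" by (simp add: r_def)
      moreover have "1 / p \<le> 1" "x powr p / p \<ge> 0" using p by auto
      ultimately have "lin_stat p x \<le> - 1" using True by (simp add: lin_stat_def diff_divide_distrib)
      then have "1 \<le> (- lin_stat p x)\<^sup>2" by (intro one_le_power) auto
      then have 1: "1 \<le> ennreal ((lin_stat p x)\<^sup>2)" by simp
      have "x powr p \<le> 1" using True r p by (intro powr_le1) auto
      then have "x powr p / p \<le> 1" using p by (simp add: divide_le_eq)
      then have "c \<le> 1 / (2 * p powr (1 / p) * Gamma (1 + 1 / p)) * exp (- (\<bar>x\<bar> powr p) / p)"
        using True p \<open>Gamma (1 + 1 / p) > 0\<close> unfolding c_def by (intro mult_left_mono) auto
      then have "ennreal c * 1 \<le> ennreal (1 / (2 * p powr (1 / p) * Gamma (1 + 1 / p)) * exp (- (\<bar>x\<bar> powr p) / p))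
        * ennreal ((lin_stat p x)\<^sup>2)"
        using 1 by (intro mult_mono ennreal_leI) auto
      then show ?thesis using True by simp
    qed simp
  qed
  also have "\<dots> = (\<integral>\<^sup>+x. ennreal ((lin_stat p x)\<^sup>2) \<partial>p_gaussian p)"
    unfolding p_gaussian_def by (subst nn_integral_density) auto
  also have "\<dots> = ennreal (s_sq p)"
    unfolding s_sq_lin_stat using lin_stat_square_integrable by (intro nn_integral_eq_integral) auto
  finally have "c * r \<le> s_sq p"
    using c r by (subst (asm) ennreal_le_iff) (auto simp: s_sq_lin_stat)
  then show ?thesis using c r by (meson less_le_trans mult_pos_pos)
qed

end

section \<open>Moderate deviations from moment generating functions\<close>

lemma good_rate_function_quadratic:
  assumes "v > 0"
  shows "good_rate_function (\<lambda>t::real. ennreal (t\<^sup>2 / (2 * v)))"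
  unfolding good_rate_function_def
proof (intro conjI allI impI)
  show "\<exists>x::real. ennreal (x\<^sup>2 / (2 * v)) \<noteq> \<infinity>" by simp
  fix a :: real assume a: "a \<ge> 0"
  have "(\<lambda>t::real. ennreal (t\<^sup>2 / (2 * v))) -` {0..ennreal a} = {- sqrt (2 * v * a)..sqrt (2 * v * a)}"
  proof -
    have "ennreal (t\<^sup>2 / (2 * v)) \<le> ennreal a \<longleftrightarrow> \<bar>t\<bar> \<le> sqrt (2 * v * a)" for t :: real
    proof -
      have "ennreal (t\<^sup>2 / (2 * v)) \<le> ennreal a \<longleftrightarrow> t\<^sup>2 \<le> 2 * v * a"
        using a assms by (simp add: ennreal_le_iff pos_divide_le_eq mult.commute mult.left_commute)
      also have "\<dots> \<longleftrightarrow> \<bar>t\<bar> \<le> sqrt (2 * v * a)"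
        by (metis real_sqrt_abs real_sqrt_le_iff)
      finally show ?thesis .
    qed
    then show ?thesis by (auto simp: abs_le_iff)
  qed
  then show "compact ((\<lambda>t::real. ennreal (t\<^sup>2 / (2 * v))) -` {0..ennreal a})" by simp
qed

lemma ereal_le_uminus_swap: "x \<le> - y \<Longrightarrow> y \<le> - x" for x y :: ereal
  by (cases x; cases y) auto

lemma ereal_uminus_le_swap: "- x \<le> y \<Longrightarrow> - y \<le> x" for x y :: ereal
  by (cases x; cases y) auto

text \<open>The rate function is even and increasing in |t|. A set whose closure has rate above c'
  therefore avoids an interval around 0, so that two-sided tails give the upper bound for all Borel
  sets; the lower bound only needs small intervals around interior points.\<close>

lemma satisfies_LDP_quadratic:
  fixes \<xi> :: "nat \<Rightarrow> 'b \<Rightarrow> real"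
  assumes prob: "\<And>n. n \<ge> k \<Longrightarrow> prob_space (M n)"
    and meas: "\<And>n. n \<ge> k \<Longrightarrow> \<xi> n \<in> borel_measurable (M n)"
    and a: "filterlim a at_top sequentially" and v: "v > 0"
    and upper: "\<And>t \<eta>. t > 0 \<Longrightarrow> \<eta> > 0 \<Longrightarrow> \<forall>\<^sub>F n in sequentially.
        measure (M n) {\<omega> \<in> space (M n). \<bar>\<xi> n \<omega>\<bar> \<ge> t} \<le> exp (- a n * (t\<^sup>2 / (2 * v) - \<eta>))"
    and lower: "\<And>x \<epsilon> \<eta>. \<epsilon> > 0 \<Longrightarrow> \<eta> > 0 \<Longrightarrow> \<forall>\<^sub>F n in sequentially.
        measure (M n) {\<omega> \<in> space (M n). \<bar>\<xi> n \<omega> - x\<bar> < \<epsilon>} \<ge> exp (- a n * (x\<^sup>2 / (2 * v) + \<eta>))"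
  shows "satisfies_LDP k M \<xi> a (\<lambda>t::real. ennreal (t\<^sup>2 / (2 * v)))"
proof -
  have eventually_speed_gt: "\<forall>\<^sub>F n in sequentially. a n > 0"
    using a by (auto simp: filterlim_at_top_dense)
  have ev_k: "\<forall>\<^sub>F n in sequentially. n \<ge> k" by (rule eventually_ge_at_top)
  define I where "I t = ennreal (t\<^sup>2 / (2 * v))" for t :: real
  define Q where "Q A n = measure (M n) (\<xi> n -` A \<inter> space (M n))" for A n
  show ?thesis
    unfolding satisfies_LDP_def I_def[symmetric] Q_def[symmetric]
  proof (intro conjI ballI)
    show "\<forall>n\<ge>k. prob_space (M n) \<and> \<xi> n \<in> borel_measurable (M n)" using prob meas by auto
    show "filterlim a at_top sequentially" by fact
    show "good_rate_function I" unfolding I_def by (rule good_rate_function_quadratic) fact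
    fix A :: "real set" assume A[measurable]: "A \<in> sets borel"
    define J where "J = (INF x\<in>closure A. I x)"
    define l where "l = limsup (\<lambda>n. ereal (1 / a n) * log_prob (Q A n))"
    \<comment> \<open>The infimum may be infinite, so it is approached from below by arbitrary y.
      For y \<le> 0 the claim only says that probabilities are at most 1.\<close>
    have "enn2ereal J \<le> - l"
    proof (rule dense_le)
      fix y assume y: "y < enn2ereal J"
      show "y \<le> - l"
      proof (cases "y \<le> 0")
        case True
        have "l \<le> 0" unfolding l_def
        proof (rule Limsup_bounded)
          show "\<forall>\<^sub>F n in sequentially. ereal (1 / a n) * log_prob (Q A n) \<le> 0"
            using eventually_speed_gt ev_k
          proof eventually_elim
            case (elim n)
            interpret prob_space "M n" using prob elim by auto
            show ?case using elim prob_le_1[of "\<xi> n -` A \<inter> space (M n)"]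
              by (auto simp: log_prob_def Q_def zero_less_measure_iff mult_nonneg_nonpos divide_nonpos_pos)
          qed
        qed
        then have "0 \<le> - l" by (simp add: ereal_0_le_uminus_iff)
        then show ?thesis using True by (rule order_trans[rotated])
      next
        case False
        obtain y' where y': "y < y'" "y' < enn2ereal J" using dense[OF y] by auto
        from False y' obtain c where c: "y = ereal c" "c > 0" by (cases y) auto
        from y' c obtain c' where c': "y' = ereal c'" "c < c'" by (cases y') auto
        \<comment> \<open>At \<open>t\<close> the rate equals c'; the gap c' - c plays the part of
          \<eta> in \<open>upper\<close>.\<close>
        define t where "t = sqrt (2 * v * c')"
        have t: "t > 0" "t\<^sup>2 / (2 * v) = c'" using c c' v by (auto simp: t_def)
        have sub: "A \<subseteq> {x. \<bar>x\<bar> \<ge> t}"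
        proof safe
          fix x assume "x \<in> A"
          then have "J \<le> I x" unfolding J_def by (intro INF_lower) (auto intro: closure_subset[THEN subsetD])
          then have "enn2ereal J \<le> enn2ereal (I x)" by (simp add: less_eq_ennreal.rep_eq)
          then have "enn2ereal J \<le> ereal (x\<^sup>2 / (2 * v))" using v by (simp add: I_def)
          then have "ereal c' < ereal (x\<^sup>2 / (2 * v))" using y'(2) c'(1) less_le_trans by blast
          then have "t\<^sup>2 \<le> x\<^sup>2" using t v by (simp add: t_def pos_less_divide_eq algebra_simps)
          then show "t \<le> \<bar>x\<bar>" using t by (metis abs_le_square_iff abs_of_pos)
        qed
        have "l \<le> ereal (- c)" unfolding l_def
        proof (rule Limsup_bounded)
          show "\<forall>\<^sub>F n in sequentially. ereal (1 / a n) * log_prob (Q A n) \<le> ereal (- c)"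
            using eventually_speed_gt ev_k upper[OF t(1) diff_gt_0_iff_gt[THEN iffD2, OF c'(2)]]
          proof (eventually_elim, goal_cases)
            case (1 n)
            interpret prob_space "M n" using prob 1 by auto
            note meas[OF 1(2), measurable]
            have "Q A n \<le> prob {\<omega> \<in> space (M n). \<bar>\<xi> n \<omega>\<bar> \<ge> t}"
              unfolding Q_def using sub by (intro finite_measure_mono) auto
            also have "\<dots> \<le> exp (- a n * c)" using 1(3) t(2) by simp
            finally have le: "Q A n \<le> exp (- a n * c)" .
            show ?case
            proof (cases "Q A n = 0")
              case False
              then have pos: "Q A n > 0" by (simp add: Q_def zero_less_measure_iff)
              have "ln (Q A n) \<le> - a n * c" using ln_mono[OF le pos] by simp
              then have "1 / a n * ln (Q A n) \<le> - c"
                using 1(1) by (simp add: pos_divide_le_eq mult.commute)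
              then show ?thesis using False by (simp add: log_prob_def)
            qed (use 1 in \<open>simp add: log_prob_def\<close>)
          qed
        qed
        then show ?thesis using c ereal_le_uminus_swap[of l y] by simp
      qed
    qed
    then show "limsup (\<lambda>n. ereal (1 / a n) * log_prob (Q A n)) \<le> - enn2ereal (INF x\<in>closure A. I x)"
      unfolding l_def J_def by (rule ereal_le_uminus_swap)

    define m where "m = liminf (\<lambda>n. ereal (1 / a n) * log_prob (Q A n))"
    have "- ereal (x\<^sup>2 / (2 * v)) \<le> m" if x: "x \<in> interior A" for x
    proof (rule dense_le)
      fix y assume y: "y < - ereal (x\<^sup>2 / (2 * v))"
      show "y \<le> m"
      proof (cases y)
        case (real c)
        obtain \<epsilon> where e: "\<epsilon> > 0" "ball x \<epsilon> \<subseteq> A" using x by (auto simp: mem_interior)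
        have cx: "- c - x\<^sup>2 / (2 * v) > 0" using y real by simp
        show ?thesis unfolding m_def
        proof (rule Liminf_bounded)
          show "\<forall>\<^sub>F n in sequentially. y \<le> ereal (1 / a n) * log_prob (Q A n)"
            using eventually_speed_gt ev_k lower[OF e(1) cx, of x]
          proof eventually_elim
            case (elim n)
            interpret prob_space "M n" using prob elim by auto
            note meas[OF elim(2), measurable]
            have "exp (a n * c) \<le> prob {\<omega> \<in> space (M n). \<bar>\<xi> n \<omega> - x\<bar> < \<epsilon>}" using elim(3) by simp
            also have "\<dots> \<le> Q A n"
              unfolding Q_def using e
              by (intro finite_measure_mono) (auto simp: dist_real_def abs_minus_commute subset_iff)
            finally have le: "exp (a n * c) \<le> Q A n" .
            then have "Q A n > 0" by (meson exp_gt_zero less_le_trans)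
            have "a n * c \<le> ln (Q A n)" using ln_mono[OF le] by simp
            then have "c \<le> 1 / a n * ln (Q A n)"
              using elim(1) by (simp add: pos_le_divide_eq mult.commute)
            then show ?case using \<open>Q A n > 0\<close> real by (simp add: log_prob_def)
          qed
        qed
      qed (use y in auto)
    qed
    then have "- m \<le> ereal (x\<^sup>2 / (2 * v))" if "x \<in> interior A" for x
      using ereal_uminus_le_swap that by blast
    then have *: "e2ennreal (- m) \<le> I x" if "x \<in> interior A" for x
      using that e2ennreal_mono[of "- m" "ereal (x\<^sup>2 / (2 * v))"] by (simp add: I_def)
    \<comment> \<open>\<open>e2ennreal\<close> truncates negative values to 0, hence an inequality
      in place of an equation.\<close>
    have "- m \<le> enn2ereal (e2ennreal (- m))"
      by (cases "- m \<ge> 0") (auto simp: enn2ereal_e2ennreal intro: order_trans[OF _ enn2ereal_nonneg])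
    also have "\<dots> \<le> enn2ereal (INF x\<in>interior A. I x)"
      using * by (simp add: less_eq_ennreal.rep_eq[symmetric] INF_greatest)
    finally show "- enn2ereal (INF x\<in>interior A. I x) \<le> liminf (\<lambda>n. ereal (1 / a n) * log_prob (Q A n))"
      unfolding m_def by (rule ereal_uminus_le_swap)
  qed
qed

section \<open>Deviation bounds from a quadratic limit of the log moment generating
  functions\<close>

definition mod_upper :: "(nat \<Rightarrow> 'b measure) \<Rightarrow> (nat \<Rightarrow> 'b \<Rightarrow> real) \<Rightarrow> (nat \<Rightarrow> real) \<Rightarrow> real \<Rightarrow> bool" where
  "mod_upper M \<xi> a v \<longleftrightarrow> (\<forall>t \<eta>. t > 0 \<longrightarrow> \<eta> > 0 \<longrightarrow> (\<forall>\<^sub>F n in sequentially.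
     measure (M n) {\<omega> \<in> space (M n). \<bar>\<xi> n \<omega>\<bar> \<ge> t} \<le> exp (- a n * (t\<^sup>2 / (2 * v) - \<eta>))))"

definition mod_lower :: "(nat \<Rightarrow> 'b measure) \<Rightarrow> (nat \<Rightarrow> 'b \<Rightarrow> real) \<Rightarrow> (nat \<Rightarrow> real) \<Rightarrow> real \<Rightarrow> bool" where
  "mod_lower M \<xi> a v \<longleftrightarrow> (\<forall>x \<epsilon> \<eta>. \<epsilon> > 0 \<longrightarrow> \<eta> > 0 \<longrightarrow> (\<forall>\<^sub>F n in sequentially.
     measure (M n) {\<omega> \<in> space (M n). \<bar>\<xi> n \<omega> - x\<bar> < \<epsilon>} \<ge> exp (- a n * (x\<^sup>2 / (2 * v) + \<eta>))))"

definition superexp_small :: "(nat \<Rightarrow> real) \<Rightarrow> (nat \<Rightarrow> real) \<Rightarrow> bool" where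
  "superexp_small a q \<longleftrightarrow> (\<forall>C. \<forall>\<^sub>F n in sequentially. q n \<le> exp (- C * a n))"

lemma chernoff_bound:
  fixes Z :: "'b \<Rightarrow> real"
  assumes "prob_space M" and [measurable]: "Z \<in> borel_measurable M"
    and int: "integrable M (\<lambda>\<omega>. exp (c * Z \<omega>))" and "c \<ge> 0"
  shows "measure M {\<omega> \<in> space M. Z \<omega> \<ge> t} \<le> exp (- c * t) * (\<integral>\<omega>. exp (c * Z \<omega>) \<partial>M)"
proof -
  interpret prob_space M by fact
  have "measure M {\<omega> \<in> space M. Z \<omega> \<ge> t} = (\<integral>\<omega>. indicator {\<omega> \<in> space M. Z \<omega> \<ge> t} \<omega> \<partial>M)"
    by simp
  also have "\<dots> \<le> (\<integral>\<omega>. exp (- c * t) * exp (c * Z \<omega>) \<partial>M)"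
  proof (rule integral_mono)
    fix \<omega>
    have "0 \<le> c * (Z \<omega> - t)" if "Z \<omega> \<ge> t" using that \<open>c \<ge> 0\<close> by simp
    then show "indicator {\<omega> \<in> space M. Z \<omega> \<ge> t} \<omega> \<le> exp (- c * t) * exp (c * Z \<omega>)"
      by (auto simp: indicator_def exp_add[symmetric] algebra_simps)
  qed (use int in \<open>auto intro!: integrable_real_indicator simp: emeasure_eq_measure\<close>)
  finally show ?thesis using int by simp
qed

text \<open>The hypothesis of the Gaertner-Ellis theorem for a Gaussian limit: ln E[exp (c a Z)] / a
  tends to c^2 v / 2 for every real c.\<close>

locale quadratic_mgf =
  fixes M :: "nat \<Rightarrow> 'b measure" and Z :: "nat \<Rightarrow> 'b \<Rightarrow> real" and a :: "nat \<Rightarrow> real" and v :: real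
  assumes prob: "\<And>n. prob_space (M n)" and meas[measurable]: "\<And>n. Z n \<in> borel_measurable (M n)"
    and a: "filterlim a at_top sequentially"
    and mgf: "\<And>c \<eta>. \<eta> > 0 \<Longrightarrow> \<forall>\<^sub>F n in sequentially.
      integrable (M n) (\<lambda>\<omega>. exp (c * a n * Z n \<omega>)) \<and>
      exp (a n * (c\<^sup>2 * v / 2 - \<eta>)) \<le> (\<integral>\<omega>. exp (c * a n * Z n \<omega>) \<partial>M n) \<and>
      (\<integral>\<omega>. exp (c * a n * Z n \<omega>) \<partial>M n) \<le> exp (a n * (c\<^sup>2 * v / 2 + \<eta>))"
begin

lemma eventually_speed_gt: "\<forall>\<^sub>F n in sequentially. a n > K"
  using a by (auto simp: filterlim_at_top_dense)

text \<open>Chernoff bounds at c and at -c. The factor 2 of the union bound is paid with half of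
  \<eta>, as soon as a n * (\<eta> / 2) \<ge> ln 2. The parameter c stays free: t / v is optimal for
  the upper bound, c = 1 is enough for tightness.\<close>

lemma two_sided_chernoff:
  assumes "c \<ge> 0" and "\<eta> > 0"
  shows "\<forall>\<^sub>F n in sequentially. measure (M n) {\<omega> \<in> space (M n). \<bar>Z n \<omega>\<bar> \<ge> t}
    \<le> exp (- a n * (c * t - c\<^sup>2 * v / 2 - \<eta>))"
  using mgf[OF half_gt_zero[OF \<open>\<eta> > 0\<close>], of c] mgf[OF half_gt_zero[OF \<open>\<eta> > 0\<close>], of "-c"]
    eventually_speed_gt[of 0] eventually_speed_gt[of "2 * ln 2 / \<eta>"]
proof (eventually_elim, goal_cases)
  case (1 n)
  interpret prob_space "M n" by (rule prob)
  have bnd: "exp (- (c * a n) * t) * E \<le> exp (- a n * (c * t - c\<^sup>2 * v / 2 - \<eta> / 2))"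
    if "E \<le> exp (a n * (c\<^sup>2 * v / 2 + \<eta> / 2))" for E
  proof -
    have "exp (- (c * a n) * t) * E \<le> exp (- (c * a n) * t) * exp (a n * (c\<^sup>2 * v / 2 + \<eta> / 2))"
      using that by (intro mult_left_mono) auto
    then show ?thesis by (simp add: exp_add[symmetric] algebra_simps)
  qed
  have p1: "prob {\<omega> \<in> space (M n). Z n \<omega> \<ge> t} \<le> exp (- a n * (c * t - c\<^sup>2 * v / 2 - \<eta> / 2))"
    using chernoff_bound[OF prob meas, of n "c * a n" t] bnd 1 \<open>c \<ge> 0\<close> by (meson less_imp_le mult_nonneg_nonneg order_trans)
  have "prob {\<omega> \<in> space (M n). - Z n \<omega> \<ge> t} \<le> exp (- (c * a n) * t) * (\<integral>\<omega>. exp (c * a n * (- Z n \<omega>)) \<partial>M n)"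
    using 1 \<open>c \<ge> 0\<close> by (intro chernoff_bound) (auto intro: prob)
  also have "\<dots> \<le> exp (- a n * (c * t - c\<^sup>2 * v / 2 - \<eta> / 2))"
    using 1(2) by (intro bnd) auto
  finally have p2: "prob {\<omega> \<in> space (M n). - Z n \<omega> \<ge> t} \<le> \<dots>" .
  have "prob {\<omega> \<in> space (M n). \<bar>Z n \<omega>\<bar> \<ge> t}
      \<le> prob ({\<omega> \<in> space (M n). Z n \<omega> \<ge> t} \<union> {\<omega> \<in> space (M n). - Z n \<omega> \<ge> t})"
    by (intro finite_measure_mono) auto
  also have "\<dots> \<le> prob {\<omega> \<in> space (M n). Z n \<omega> \<ge> t} + prob {\<omega> \<in> space (M n). - Z n \<omega> \<ge> t}"
    by (intro measure_Un_le) auto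
  also have "\<dots> \<le> 2 * exp (- a n * (c * t - c\<^sup>2 * v / 2 - \<eta> / 2))" using p1 p2 by simp
  also have "\<dots> \<le> exp (a n * (\<eta> / 2)) * exp (- a n * (c * t - c\<^sup>2 * v / 2 - \<eta> / 2))"
  proof (intro mult_right_mono)
    have "ln 2 \<le> a n * (\<eta> / 2)" using 1(4) \<open>\<eta> > 0\<close> by (simp add: field_simps)
    then have "exp (ln 2) \<le> exp (a n * (\<eta> / 2))" by (simp only: exp_le_cancel_iff)
    then show "2 \<le> exp (a n * (\<eta> / 2))" by simp
  qed auto
  also have "\<dots> = exp (- a n * (c * t - c\<^sup>2 * v / 2 - \<eta>))"
    by (simp add: exp_add[symmetric] algebra_simps)
  finally show ?case .
qed

lemma upper: assumes "v > 0" shows "mod_upper M Z a v"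
  unfolding mod_upper_def
proof (intro allI impI)
  fix t \<eta> :: real assume "t > 0" "\<eta> > 0"
  \<comment> \<open>The choice c = t / v maximises c t - c^2 v / 2.\<close>
  moreover have "t / v * t - (t / v)\<^sup>2 * v / 2 - \<eta> = t\<^sup>2 / (2 * v) - \<eta>"
    using \<open>v > 0\<close> by (simp add: field_simps power2_eq_square)
  ultimately show "\<forall>\<^sub>F n in sequentially. measure (M n) {\<omega> \<in> space (M n). t \<le> \<bar>Z n \<omega>\<bar>}
      \<le> exp (- a n * (t\<^sup>2 / (2 * v) - \<eta>))"
    using two_sided_chernoff[of "t / v" \<eta> t] \<open>v > 0\<close> by simp
qed

lemma exp_tight: "\<exists>K>0. \<forall>\<^sub>F n in sequentially. measure (M n) {\<omega> \<in> space (M n). \<bar>Z n \<omega>\<bar> \<ge> K} \<le> exp (- C * a n)"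
proof -
  \<comment> \<open>With c = 1 the exponent is K - v / 2 - 1, which this K makes at least C.\<close>
  define K where "K = \<bar>C\<bar> + \<bar>v\<bar> + 1"
  have "\<forall>\<^sub>F n in sequentially. measure (M n) {\<omega> \<in> space (M n). \<bar>Z n \<omega>\<bar> \<ge> K}
    \<le> exp (- a n * (1 * K - 1\<^sup>2 * v / 2 - 1))"
    by (rule two_sided_chernoff) auto
  then have "\<forall>\<^sub>F n in sequentially. measure (M n) {\<omega> \<in> space (M n). \<bar>Z n \<omega>\<bar> \<ge> K} \<le> exp (- C * a n)"
    using eventually_speed_gt[of 0]
  proof eventually_elim
    case (elim n)
    have "C * a n \<le> (1 * K - 1\<^sup>2 * v / 2 - 1) * a n"
      using elim(2) by (intro mult_right_mono) (auto simp: K_def abs_if)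
    then show ?case using elim(1) by (elim order_trans) (simp add: algebra_simps)
  qed
  moreover have "K > 0" by (simp add: K_def)
  ultimately show ?thesis by blast
qed

text \<open>
  Exponential tilting without changing the measure: with \<open>c = x / v\<close>, the part of
  \<open>E[exp(c a Z)]\<close> outside \<open>(x - \<delta>, x + \<delta>)\<close> is exponentially negligible.
\<close>

lemma lower: assumes "v > 0" shows "mod_lower M Z a v"
  unfolding mod_lower_def
proof (intro allI impI)
  fix x \<epsilon> \<eta> :: real assume "\<epsilon> > 0" "\<eta> > 0"
  \<comment> \<open>The second bound gives |x| \<delta> / v \<le> \<eta> / 2: on the window of
    radius \<delta> the tilting factor exp (c a Z) varies from its value at x by at most exp (a
    \<eta> / 2).\<close>
  define \<delta> where "\<delta> = min \<epsilon> (\<eta> * v / (2 * (\<bar>x\<bar> + 1)))"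
  have d: "\<delta> > 0" "\<delta> \<le> \<epsilon>" using \<open>\<epsilon> > 0\<close> \<open>\<eta> > 0\<close> \<open>v > 0\<close> by (auto simp: \<delta>_def)
  have d2: "\<bar>x\<bar> * \<delta> / v \<le> \<eta> / 2"
  proof -
    have "\<bar>x\<bar> * \<delta> \<le> (\<bar>x\<bar> + 1) * \<delta>" using d by (intro mult_right_mono) auto
    also have "\<dots> \<le> (\<bar>x\<bar> + 1) * (\<eta> * v / (2 * (\<bar>x\<bar> + 1)))"
      by (intro mult_left_mono) (auto simp: \<delta>_def)
    also have "\<dots> = \<eta> * v / 2" by (simp add: field_simps add_pos_nonneg)
    finally show ?thesis using \<open>v > 0\<close> by (simp add: field_simps)
  qed
  \<comment> \<open>h is the error allowed in the moment generating functions. It enters both the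
    lower bound for E c and the upper bounds for the outer parts; h \<le> \<delta>^2 / (8 v) leaves
    a gap \<delta>^2 / (2 v) - 2 h of at least \<delta>^2 / (4 v) in the exponent.\<close>
  define h where "h = min (\<eta> / 4) (\<delta>\<^sup>2 / (8 * v))"
  have h: "h > 0" "h \<le> \<eta> / 4" "h \<le> \<delta>\<^sup>2 / (8 * v)"
    using \<open>\<eta> > 0\<close> d \<open>v > 0\<close> by (auto simp: h_def)
  define c where "c = x / v"
  \<comment> \<open>The parts beyond x + \<delta> and x - \<delta> are bounded through the tilts c +
    q and c - q. This q minimises the exponents in \<open>e1\<close> and \<open>e2\<close>, which
    then fall short of x^2 / (2 v) by \<delta>^2 / (2 v).\<close>
  define q where "q = \<delta> / v"
  have q: "q > 0" using d \<open>v > 0\<close> by (simp add: q_def)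
  have e1: "- q * (x + \<delta>) + (c + q)\<^sup>2 * v / 2 = x\<^sup>2 / (2 * v) - \<delta>\<^sup>2 / (2 * v)"
    and e2: "q * (x - \<delta>) + (c - q)\<^sup>2 * v / 2 = x\<^sup>2 / (2 * v) - \<delta>\<^sup>2 / (2 * v)"
    and e3: "c\<^sup>2 * v / 2 = x\<^sup>2 / (2 * v)"
    using \<open>v > 0\<close> by (simp_all add: c_def q_def field_simps power2_eq_square)
  show "\<forall>\<^sub>F n in sequentially. exp (- a n * (x\<^sup>2 / (2 * v) + \<eta>))
      \<le> measure (M n) {\<omega> \<in> space (M n). \<bar>Z n \<omega> - x\<bar> < \<epsilon>}"
    using mgf[OF h(1), of c] mgf[OF h(1), of "c + q"] mgf[OF h(1), of "c - q"]
      eventually_speed_gt[of 0] eventually_speed_gt[of "ln 4 / (\<delta>\<^sup>2 / (4 * v))"] eventually_speed_gt[of "ln 2 / h"]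
  proof eventually_elim
    case (elim n)
    interpret prob_space "M n" by (rule prob)
    let ?S = "{\<omega> \<in> space (M n). \<bar>Z n \<omega> - x\<bar> < \<delta>}"
    define E where "E c = (\<integral>\<omega>. exp (c * a n * Z n \<omega>) \<partial>M n)" for c
    have an: "a n > 0" by fact
    have int: "integrable (M n) (\<lambda>\<omega>. exp (c * a n * Z n \<omega>))"
      "integrable (M n) (\<lambda>\<omega>. exp ((c + q) * a n * Z n \<omega>))"
      "integrable (M n) (\<lambda>\<omega>. exp ((c - q) * a n * Z n \<omega>))" using elim by auto
    have iS: "integrable (M n) (indicat_real ?S)"
      by (intro integrable_real_indicator) (auto simp: emeasure_eq_measure)
    have "E c \<le> (\<integral>\<omega>. exp (a n * (c * x + \<bar>c\<bar> * \<delta>)) * indicator ?S \<omega>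
        + exp (- a n * q * (x + \<delta>)) * exp ((c + q) * a n * Z n \<omega>)
        + exp (a n * q * (x - \<delta>)) * exp ((c - q) * a n * Z n \<omega>) \<partial>M n)"
      unfolding E_def
    proof (rule integral_mono)
      fix \<omega> assume w: "\<omega> \<in> space (M n)"
      let ?z = "Z n \<omega>"
      consider "\<bar>?z - x\<bar> < \<delta>" | "?z \<ge> x + \<delta>" | "?z \<le> x - \<delta>" by linarith
      then show "exp (c * a n * ?z) \<le> exp (a n * (c * x + \<bar>c\<bar> * \<delta>)) * indicator ?S \<omega>
        + exp (- a n * q * (x + \<delta>)) * exp ((c + q) * a n * ?z)
        + exp (a n * q * (x - \<delta>)) * exp ((c - q) * a n * ?z)"
      proof cases
        case 1
        have "c * (?z - x) \<le> \<bar>c\<bar> * \<bar>?z - x\<bar>" by (metis abs_ge_self abs_mult)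
        also have "\<dots> \<le> \<bar>c\<bar> * \<delta>" using 1 by (intro mult_left_mono) auto
        finally have "a n * (c * ?z) \<le> a n * (c * x + \<bar>c\<bar> * \<delta>)"
          using an by (intro mult_left_mono) (auto simp: algebra_simps)
        then have "exp (c * a n * ?z) \<le> exp (a n * (c * x + \<bar>c\<bar> * \<delta>)) * indicator ?S \<omega>"
          using 1 w by (simp add: algebra_simps)
        then show ?thesis by (simp add: add_increasing2)
      next
        case 2
        have "0 \<le> a n * q * (?z - (x + \<delta>))" using 2 an q by auto
        then have "exp (c * a n * ?z) \<le> exp (- a n * q * (x + \<delta>)) * exp ((c + q) * a n * ?z)"
          by (simp add: exp_add[symmetric] algebra_simps)
        then show ?thesis by (simp add: add_increasing2 add_increasing)
      next
        case 3
        have "0 \<le> a n * q * ((x - \<delta>) - ?z)" using 3 an q by auto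
        then have "exp (c * a n * ?z) \<le> exp (a n * q * (x - \<delta>)) * exp ((c - q) * a n * ?z)"
          by (simp add: exp_add[symmetric] algebra_simps)
        then show ?thesis by (simp add: add_increasing2 add_increasing)
      qed
    qed (use int in \<open>auto intro!: integrable_real_indicator simp: emeasure_eq_measure\<close>)
    also have "\<dots> = exp (a n * (c * x + \<bar>c\<bar> * \<delta>)) * prob ?S
        + exp (- a n * q * (x + \<delta>)) * E (c + q) + exp (a n * q * (x - \<delta>)) * E (c - q)"
      using int iS by (simp add: E_def)
    also have "\<dots> \<le> exp (a n * (c * x + \<bar>c\<bar> * \<delta>)) * prob ?S
        + exp (- a n * q * (x + \<delta>)) * exp (a n * ((c + q)\<^sup>2 * v / 2 + h))
        + exp (a n * q * (x - \<delta>)) * exp (a n * ((c - q)\<^sup>2 * v / 2 + h))"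
      using elim by (intro add_mono mult_left_mono) (auto simp: E_def)
    also have "exp (- a n * q * (x + \<delta>)) * exp (a n * ((c + q)\<^sup>2 * v / 2 + h))
        = exp (a n * ((- q * (x + \<delta>) + (c + q)\<^sup>2 * v / 2) + h))"
      by (simp add: exp_add[symmetric] algebra_simps)
    also have "exp (a n * q * (x - \<delta>)) * exp (a n * ((c - q)\<^sup>2 * v / 2 + h))
        = exp (a n * ((q * (x - \<delta>) + (c - q)\<^sup>2 * v / 2) + h))"
      by (simp add: exp_add[symmetric] algebra_simps)
    finally have "E c \<le> exp (a n * (c * x + \<bar>c\<bar> * \<delta>)) * prob ?S
        + 2 * exp (a n * (x\<^sup>2 / (2 * v) - \<delta>\<^sup>2 / (2 * v) + h))"
      unfolding e1 e2 by simp
    moreover have "exp (a n * (x\<^sup>2 / (2 * v) - h)) \<le> E c" using elim(1) by (simp add: E_def e3)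
    moreover have "2 * exp (a n * (x\<^sup>2 / (2 * v) - \<delta>\<^sup>2 / (2 * v) + h)) \<le> 1 / 2 * exp (a n * (x\<^sup>2 / (2 * v) - h))"
    proof -
      have "ln 4 \<le> a n * (\<delta>\<^sup>2 / (4 * v))" using elim(5) d \<open>v > 0\<close> by (simp add: field_simps)
      also have "\<dots> \<le> a n * (\<delta>\<^sup>2 / (2 * v) - 2 * h)"
        using an h(3) \<open>v > 0\<close> by (intro mult_left_mono) (auto simp: field_simps)
      finally have "ln 4 + a n * (x\<^sup>2 / (2 * v) - \<delta>\<^sup>2 / (2 * v) + h) \<le> a n * (x\<^sup>2 / (2 * v) - h)"
        by (simp add: algebra_simps)
      then have "exp (ln 4 + a n * (x\<^sup>2 / (2 * v) - \<delta>\<^sup>2 / (2 * v) + h)) \<le> exp (a n * (x\<^sup>2 / (2 * v) - h))"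
        by (simp only: exp_le_cancel_iff)
      then show ?thesis by (simp add: exp_add)
    qed
    ultimately have "1 / 2 * exp (a n * (x\<^sup>2 / (2 * v) - h)) \<le> exp (a n * (c * x + \<bar>c\<bar> * \<delta>)) * prob ?S"
      by simp
    then have "exp (- (a n * (c * x + \<bar>c\<bar> * \<delta>))) * (1 / 2 * exp (a n * (x\<^sup>2 / (2 * v) - h)))
        \<le> exp (- (a n * (c * x + \<bar>c\<bar> * \<delta>))) * (exp (a n * (c * x + \<bar>c\<bar> * \<delta>)) * prob ?S)"
      by (intro mult_left_mono) auto
    also have "\<dots> = prob ?S" by (simp add: exp_minus)
    also have "\<dots> \<le> prob {\<omega> \<in> space (M n). \<bar>Z n \<omega> - x\<bar> < \<epsilon>}"
      using d by (intro finite_measure_mono) auto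
    finally have "exp (- (a n * (c * x + \<bar>c\<bar> * \<delta>))) * (1 / 2 * exp (a n * (x\<^sup>2 / (2 * v) - h)))
        \<le> prob {\<omega> \<in> space (M n). \<bar>Z n \<omega> - x\<bar> < \<epsilon>}" .
    moreover have shift: "exp (- B) * (1 / 2 * exp A) = 1 / 2 * exp (A - B)" for A B :: real
      using exp_add[of "- B" A] by simp
    ultimately have fin: "1 / 2 * exp (a n * (x\<^sup>2 / (2 * v) - h) - a n * (c * x + \<bar>c\<bar> * \<delta>))
        \<le> prob {\<omega> \<in> space (M n). \<bar>Z n \<omega> - x\<bar> < \<epsilon>}"
      by (simp only: shift)
    have "exp (- a n * (x\<^sup>2 / (2 * v) + \<eta>))
        \<le> exp (- (a n * h)) * exp (a n * (x\<^sup>2 / (2 * v) - h) - a n * (c * x + \<bar>c\<bar> * \<delta>))"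
    proof -
      have "\<bar>c\<bar> * \<delta> \<le> \<eta> / 2" using d2 \<open>v > 0\<close> by (simp add: c_def)
      moreover have "c * x = 2 * (x\<^sup>2 / (2 * v))" by (simp add: c_def power2_eq_square)
      ultimately have "- (x\<^sup>2 / (2 * v) + \<eta>) \<le> - h + (x\<^sup>2 / (2 * v) - h) - (c * x + \<bar>c\<bar> * \<delta>)"
        using h(2) by linarith
      then have "a n * - (x\<^sup>2 / (2 * v) + \<eta>) \<le> a n * (- h + (x\<^sup>2 / (2 * v) - h) - (c * x + \<bar>c\<bar> * \<delta>))"
        using an by (intro mult_left_mono) auto
      then show ?thesis by (simp add: exp_add[symmetric] algebra_simps)
    qed
    also have "\<dots> \<le> 1 / 2 * exp (a n * (x\<^sup>2 / (2 * v) - h) - a n * (c * x + \<bar>c\<bar> * \<delta>))"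
    proof (intro mult_right_mono)
      have "ln 2 \<le> a n * h" using elim(6) h by (simp add: field_simps)
      then have "exp (- (a n * h)) \<le> exp (- ln 2)" by (simp only: exp_le_cancel_iff neg_le_iff_le)
      then show "exp (- (a n * h)) \<le> 1 / 2" by (simp add: exp_minus)
    qed auto
    also note fin
    finally show ?case .
  qed
qed

end

section \<open>Stability under superexponentially small perturbations\<close>

lemma mod_upper_exp_equivalent:
  assumes prob: "\<And>n. prob_space (M n)"
    and meas: "\<And>n. Z n \<in> borel_measurable (M n)" "\<And>n. Y n \<in> borel_measurable (M n)"
    and a: "filterlim a at_top sequentially" and "v > 0" and Z: "mod_upper M Z a v"
    and eq: "\<And>\<epsilon>. \<epsilon> > 0 \<Longrightarrow> superexp_small a (\<lambda>n. measure (M n) {\<omega> \<in> space (M n). \<bar>Z n \<omega> - Y n \<omega>\<bar> > \<epsilon>})"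
  shows "mod_upper M Y a v"
  unfolding mod_upper_def
proof (intro allI impI)
  fix t \<eta> :: real assume t: "t > 0" and eta: "\<eta> > 0"
  \<comment> \<open>If |Y| \<ge> t, then |Z| \<ge> t - \<epsilon> or |Z - Y| > \<epsilon>. The bound
    on t * \<epsilon> limits the loss in the quadratic rate to \<eta> / 2; the rest of \<eta> pays
    for the error in the bound on Z and for adding two probabilities.\<close>
  define \<epsilon> where "\<epsilon> = min (t / 2) (\<eta> * v / (2 * t))"
  have e: "\<epsilon> > 0" "\<epsilon> \<le> t / 2" "\<epsilon> \<le> \<eta> * v / (2 * t)" using t eta \<open>v > 0\<close> by (auto simp: \<epsilon>_def)
  have sq: "(t - \<epsilon>)\<^sup>2 / (2 * v) \<ge> t\<^sup>2 / (2 * v) - \<eta> / 2"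
  proof -
    have "t * \<epsilon> \<le> \<eta> * v / 2" using e(3) t by (simp add: field_simps)
    moreover have "(t - \<epsilon>)\<^sup>2 = t\<^sup>2 - 2 * (t * \<epsilon>) + \<epsilon>\<^sup>2" by (simp add: power2_diff)
    ultimately have "t\<^sup>2 - \<eta> * v \<le> (t - \<epsilon>)\<^sup>2" using zero_le_power2[of \<epsilon>] by linarith
    then have "(t\<^sup>2 - \<eta> * v) / (2 * v) \<le> (t - \<epsilon>)\<^sup>2 / (2 * v)"
      using \<open>v > 0\<close> by (intro divide_right_mono) auto
    then show ?thesis using \<open>v > 0\<close> by (simp add: diff_divide_distrib)
  qed
  have "\<forall>\<^sub>F n in sequentially. measure (M n) {\<omega> \<in> space (M n). \<bar>Z n \<omega>\<bar> \<ge> t - \<epsilon>}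
      \<le> exp (- a n * ((t - \<epsilon>)\<^sup>2 / (2 * v) - \<eta> / 4))"
    using Z e t eta by (auto simp: mod_upper_def)
  moreover have "\<forall>\<^sub>F n in sequentially. measure (M n) {\<omega> \<in> space (M n). \<bar>Z n \<omega> - Y n \<omega>\<bar> > \<epsilon>}
      \<le> exp (- (t\<^sup>2 / (2 * v)) * a n)"
    using eq[OF e(1), unfolded superexp_small_def] by blast
  moreover have "\<forall>\<^sub>F n in sequentially. a n \<ge> max 0 (ln 2 / (\<eta> / 4))"
    using a unfolding filterlim_at_top by blast
  ultimately show "\<forall>\<^sub>F n in sequentially. measure (M n) {\<omega> \<in> space (M n). t \<le> \<bar>Y n \<omega>\<bar>}
      \<le> exp (- a n * (t\<^sup>2 / (2 * v) - \<eta>))"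
  proof eventually_elim
    case (elim n)
    interpret prob_space "M n" by (rule prob)
    note meas[measurable]
    have an: "0 \<le> a n" using elim(3) by (rule order_trans[OF max.cobounded1])
    have "prob {\<omega> \<in> space (M n). t \<le> \<bar>Y n \<omega>\<bar>}
      \<le> prob ({\<omega> \<in> space (M n). \<bar>Z n \<omega>\<bar> \<ge> t - \<epsilon>} \<union> {\<omega> \<in> space (M n). \<bar>Z n \<omega> - Y n \<omega>\<bar> > \<epsilon>})"
      by (intro finite_measure_mono) auto
    also have "\<dots> \<le> prob {\<omega> \<in> space (M n). \<bar>Z n \<omega>\<bar> \<ge> t - \<epsilon>} + prob {\<omega> \<in> space (M n). \<bar>Z n \<omega> - Y n \<omega>\<bar> > \<epsilon>}"
      by (intro measure_Un_le) auto
    also have "\<dots> \<le> exp (- a n * (t\<^sup>2 / (2 * v) - \<eta> * 3 / 4)) + exp (- a n * (t\<^sup>2 / (2 * v) - \<eta> * 3 / 4))"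
    proof (intro add_mono)
      have "a n * (t\<^sup>2 / (2 * v) - \<eta> * 3 / 4) \<le> a n * ((t - \<epsilon>)\<^sup>2 / (2 * v) - \<eta> / 4)"
        using sq an by (intro mult_left_mono) auto
      then show "prob {\<omega> \<in> space (M n). \<bar>Z n \<omega>\<bar> \<ge> t - \<epsilon>} \<le> exp (- a n * (t\<^sup>2 / (2 * v) - \<eta> * 3 / 4))"
        using elim(1) by (elim order_trans) simp
      have "a n * (t\<^sup>2 / (2 * v) - \<eta> * 3 / 4) \<le> a n * (t\<^sup>2 / (2 * v))"
        using eta an by (intro mult_left_mono) auto
      then show "prob {\<omega> \<in> space (M n). \<bar>Z n \<omega> - Y n \<omega>\<bar> > \<epsilon>} \<le> exp (- a n * (t\<^sup>2 / (2 * v) - \<eta> * 3 / 4))"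
        using elim(2) by (elim order_trans) (simp add: mult.commute)
    qed
    also have "\<dots> = exp (ln 2) * exp (- a n * (t\<^sup>2 / (2 * v) - \<eta> * 3 / 4))" by simp
    also have "\<dots> \<le> exp (a n * (\<eta> / 4)) * exp (- a n * (t\<^sup>2 / (2 * v) - \<eta> * 3 / 4))"
    proof (intro mult_right_mono)
      have "ln 2 \<le> a n * (\<eta> / 4)" using elim(3) eta by (simp add: field_simps)
      then show "exp (ln 2) \<le> exp (a n * (\<eta> / 4))" by (simp only: exp_le_cancel_iff)
    qed auto
    also have "\<dots> = exp (- a n * (t\<^sup>2 / (2 * v) - \<eta>))" by (simp add: exp_add[symmetric] algebra_simps)
    finally show ?case .
  qed
qed

lemma mod_lower_exp_equivalent:
  assumes prob: "\<And>n. prob_space (M n)"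
    and meas: "\<And>n. Z n \<in> borel_measurable (M n)" "\<And>n. Y n \<in> borel_measurable (M n)"
    and a: "filterlim a at_top sequentially" and "v > 0" and Z: "mod_lower M Z a v"
    and eq: "\<And>\<epsilon>. \<epsilon> > 0 \<Longrightarrow> superexp_small a (\<lambda>n. measure (M n) {\<omega> \<in> space (M n). \<bar>Z n \<omega> - Y n \<omega>\<bar> > \<epsilon>})"
  shows "mod_lower M Y a v"
  unfolding mod_lower_def
proof (intro allI impI)
  fix x \<epsilon> \<eta> :: real assume e: "\<epsilon> > 0" and eta: "\<eta> > 0"
  define c where "c = x\<^sup>2 / (2 * v)"
  have "\<forall>\<^sub>F n in sequentially. measure (M n) {\<omega> \<in> space (M n). \<bar>Z n \<omega> - x\<bar> < \<epsilon> / 2}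
      \<ge> exp (- a n * (c + \<eta> / 2))"
    using Z[unfolded mod_lower_def, rule_format, of "\<epsilon> / 2" "\<eta> / 2" x] e eta by (simp add: c_def)
  \<comment> \<open>The rate c + \<eta> is such that, once a n * (\<eta> / 2) \<ge> ln 2, the
    perturbation takes away at most half of exp (- a n (c + \<eta> / 2)), and the remaining half is
    still at least exp (- a n (c + \<eta>)).\<close>
  moreover have "\<forall>\<^sub>F n in sequentially. measure (M n) {\<omega> \<in> space (M n). \<bar>Z n \<omega> - Y n \<omega>\<bar> > \<epsilon> / 4}
      \<le> exp (- (c + \<eta>) * a n)"
    using eq[of "\<epsilon> / 4", unfolded superexp_small_def, rule_format, of "c + \<eta>"] e by simp
  moreover have "\<forall>\<^sub>F n in sequentially. a n \<ge> ln 2 / (\<eta> / 2)" using a by (simp add: filterlim_at_top)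
  ultimately show "\<forall>\<^sub>F n in sequentially. exp (- a n * (x\<^sup>2 / (2 * v) + \<eta>))
      \<le> measure (M n) {\<omega> \<in> space (M n). \<bar>Y n \<omega> - x\<bar> < \<epsilon>}"
  proof eventually_elim
    case (elim n)
    interpret prob_space "M n" by (rule prob)
    note meas[measurable]
    have "prob {\<omega> \<in> space (M n). \<bar>Z n \<omega> - x\<bar> < \<epsilon> / 2}
      \<le> prob ({\<omega> \<in> space (M n). \<bar>Y n \<omega> - x\<bar> < \<epsilon>} \<union> {\<omega> \<in> space (M n). \<bar>Z n \<omega> - Y n \<omega>\<bar> > \<epsilon> / 4})"
    proof (intro finite_measure_mono subsetI)
      fix \<omega> assume "\<omega> \<in> {\<omega> \<in> space (M n). \<bar>Z n \<omega> - x\<bar> < \<epsilon> / 2}"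
      moreover have "\<bar>Y n \<omega> - x\<bar> \<le> \<bar>Z n \<omega> - x\<bar> + \<bar>Z n \<omega> - Y n \<omega>\<bar>" by linarith
      ultimately show "\<omega> \<in> {\<omega> \<in> space (M n). \<bar>Y n \<omega> - x\<bar> < \<epsilon>}
          \<union> {\<omega> \<in> space (M n). \<bar>Z n \<omega> - Y n \<omega>\<bar> > \<epsilon> / 4}"
        using e by auto
    qed auto
    also have "\<dots> \<le> prob {\<omega> \<in> space (M n). \<bar>Y n \<omega> - x\<bar> < \<epsilon>} + prob {\<omega> \<in> space (M n). \<bar>Z n \<omega> - Y n \<omega>\<bar> > \<epsilon> / 4}"
      by (intro measure_Un_le) auto
    finally have "exp (- a n * (c + \<eta> / 2)) - exp (- (c + \<eta>) * a n) \<le> prob {\<omega> \<in> space (M n). \<bar>Y n \<omega> - x\<bar> < \<epsilon>}"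
      using elim by linarith
    moreover have "2 * exp (- (c + \<eta>) * a n) \<le> exp (- a n * (c + \<eta> / 2))"
    proof -
      have "ln 2 \<le> a n * (\<eta> / 2)" using elim(3) eta by (simp add: field_simps)
      then have "ln 2 + - (c + \<eta>) * a n \<le> - a n * (c + \<eta> / 2)" by (simp add: algebra_simps)
      then have "exp (ln 2 + - (c + \<eta>) * a n) \<le> exp (- a n * (c + \<eta> / 2))" by (simp only: exp_le_cancel_iff)
      then show ?thesis by (simp add: exp_add)
    qed
    ultimately have "exp (- (c + \<eta>) * a n) \<le> prob {\<omega> \<in> space (M n). \<bar>Y n \<omega> - x\<bar> < \<epsilon>}" by linarith
    then show ?case by (simp add: c_def algebra_simps)
  qed
qed

section \<open>Second order expansions and sums of independent variables\<close>

lemma exp_second_order: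
  fixes s :: real
  shows "\<bar>exp s - 1 - s - s\<^sup>2 / 2\<bar> \<le> \<bar>s\<bar> ^ 3 * exp \<bar>s\<bar>"
proof -
  obtain t where t: "\<bar>t\<bar> \<le> \<bar>s\<bar>" "exp s = (\<Sum>m<3. s ^ m / fact m) + exp t / fact 3 * s ^ 3"
    using Maclaurin_exp_le[of s 3] by auto
  have "exp s - 1 - s - s\<^sup>2 / 2 = exp t / 6 * s ^ 3"
    using t(2) by (simp add: eval_nat_numeral)
  then have "\<bar>exp s - 1 - s - s\<^sup>2 / 2\<bar> = exp t / 6 * \<bar>s\<bar> ^ 3"
    by (simp only: abs_mult power_abs) simp
  also have "\<dots> \<le> exp \<bar>s\<bar> * \<bar>s\<bar> ^ 3"
  proof (intro mult_right_mono)
    have "exp t \<le> exp \<bar>s\<bar>" using t(1) by simp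
    then show "exp t / 6 \<le> exp \<bar>s\<bar>" using exp_gt_zero[of t] by linarith
  qed auto
  finally show ?thesis by (simp add: mult.commute)
qed

lemma cube_le_exp:
  fixes y \<theta> :: real
  assumes "\<theta> > 0"
  shows "\<bar>y\<bar> ^ 3 \<le> 216 / \<theta> ^ 3 * exp (\<theta> / 2 * \<bar>y\<bar>)"
proof -
  \<comment> \<open>From t \<le> exp t follows t^3 \<le> exp (3 t); dividing by 6 makes 3 t =
    \<theta> |y| / 2, and 216 = 6^3.\<close>
  let ?t = "\<theta> * \<bar>y\<bar> / 6"
  have "?t \<le> exp ?t" using exp_ge_add_one_self[of ?t] by linarith
  then have "?t ^ 3 \<le> exp ?t ^ 3" using assms by (intro power_mono) auto
  also have "\<dots> = exp (\<theta> / 2 * \<bar>y\<bar>)" by (simp add: exp_of_nat_mult[symmetric])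
  finally show ?thesis using assms by (simp add: field_simps power_mult_distrib)
qed

text \<open>Half of the exponent \<theta>0 pays for |Y|^3 by \<open>cube_le_exp\<close>, the other
  half for the exponential in the Taylor remainder; hence the restriction |\<theta>| \<le> \<theta>0
  / 2. The linear term vanishes with the mean.\<close>

lemma mgf_second_order:
  fixes Y :: "'a \<Rightarrow> real"
  assumes "prob_space M" and [measurable]: "Y \<in> borel_measurable M" and "\<theta>0 > 0"
    and exp_int: "integrable M (\<lambda>x. exp (\<theta>0 * \<bar>Y x\<bar>))" and mean: "(\<integral>x. Y x \<partial>M) = 0"
  defines "C \<equiv> 216 / \<theta>0 ^ 3 * (\<integral>x. exp (\<theta>0 * \<bar>Y x\<bar>) \<partial>M)"
  assumes "\<bar>\<theta>\<bar> \<le> \<theta>0 / 2"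
  shows "integrable M (\<lambda>x. exp (\<theta> * Y x))"
    and "\<bar>(\<integral>x. exp (\<theta> * Y x) \<partial>M) - 1 - \<theta>\<^sup>2 * (\<integral>x. (Y x)\<^sup>2 \<partial>M) / 2\<bar> \<le> C * \<bar>\<theta>\<bar> ^ 3"
proof -
  interpret prob_space M by fact
  have ineq: "\<bar>\<theta> * Y x\<bar> \<le> \<theta>0 / 2 * \<bar>Y x\<bar>" for x
    unfolding abs_mult using \<open>\<bar>\<theta>\<bar> \<le> \<theta>0 / 2\<close> by (rule mult_right_mono) simp
  have half: "exp (\<theta>0 / 2 * \<bar>Y x\<bar>) \<le> exp (\<theta>0 * \<bar>Y x\<bar>)" for x using \<open>\<theta>0 > 0\<close> by simp
  have bnd: "\<bar>exp (\<theta> * Y x) - 1 - \<theta> * Y x - (\<theta> * Y x)\<^sup>2 / 2\<bar>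
      \<le> \<bar>\<theta>\<bar> ^ 3 * (216 / \<theta>0 ^ 3) * exp (\<theta>0 * \<bar>Y x\<bar>)" for x
  proof -
    have "\<bar>exp (\<theta> * Y x) - 1 - \<theta> * Y x - (\<theta> * Y x)\<^sup>2 / 2\<bar> \<le> \<bar>\<theta> * Y x\<bar> ^ 3 * exp \<bar>\<theta> * Y x\<bar>"
      by (rule exp_second_order)
    also have "\<dots> \<le> \<bar>\<theta> * Y x\<bar> ^ 3 * exp (\<theta>0 / 2 * \<bar>Y x\<bar>)"
      using ineq by (intro mult_left_mono) auto
    also have "\<dots> = \<bar>\<theta>\<bar> ^ 3 * \<bar>Y x\<bar> ^ 3 * exp (\<theta>0 / 2 * \<bar>Y x\<bar>)" by (simp add: abs_mult power_mult_distrib)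
    also have "\<dots> \<le> \<bar>\<theta>\<bar> ^ 3 * (216 / \<theta>0 ^ 3 * exp (\<theta>0 / 2 * \<bar>Y x\<bar>)) * exp (\<theta>0 / 2 * \<bar>Y x\<bar>)"
      using cube_le_exp[OF \<open>\<theta>0 > 0\<close>] by (intro mult_right_mono mult_left_mono) auto
    also have "\<dots> = \<bar>\<theta>\<bar> ^ 3 * (216 / \<theta>0 ^ 3) * (exp (\<theta>0 / 2 * \<bar>Y x\<bar>) * exp (\<theta>0 / 2 * \<bar>Y x\<bar>))"
      by simp
    also have "exp (\<theta>0 / 2 * \<bar>Y x\<bar>) * exp (\<theta>0 / 2 * \<bar>Y x\<bar>) = exp (\<theta>0 * \<bar>Y x\<bar>)"
      by (simp add: exp_add[symmetric])
    finally show ?thesis .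
  qed
  show i1: "integrable M (\<lambda>x. exp (\<theta> * Y x))"
  proof (rule Bochner_Integration.integrable_bound[OF exp_int])
    have "exp (\<theta> * Y x) \<le> exp (\<theta>0 * \<bar>Y x\<bar>)" for x
    proof -
      have "\<theta> * Y x \<le> \<theta>0 / 2 * \<bar>Y x\<bar>" using ineq[of x] by linarith
      then show ?thesis using half[of x] by (meson exp_le_cancel_iff order_trans)
    qed
    then show "AE x in M. norm (exp (\<theta> * Y x)) \<le> norm (exp (\<theta>0 * \<bar>Y x\<bar>))" by simp
  qed measurable
  have i2: "integrable M Y"
  proof (rule Bochner_Integration.integrable_bound)
    show "integrable M (\<lambda>x. 1 / \<theta>0 * exp (\<theta>0 * \<bar>Y x\<bar>))" using exp_int by simp
    have "\<bar>Y x\<bar> \<le> 1 / \<theta>0 * exp (\<theta>0 * \<bar>Y x\<bar>)" for x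
    proof -
      have "\<theta>0 * \<bar>Y x\<bar> \<le> exp (\<theta>0 * \<bar>Y x\<bar>)" using exp_ge_add_one_self[of "\<theta>0 * \<bar>Y x\<bar>"] by linarith
      then show ?thesis using \<open>\<theta>0 > 0\<close> by (simp add: field_simps)
    qed
    then show "AE x in M. norm (Y x) \<le> norm (1 / \<theta>0 * exp (\<theta>0 * \<bar>Y x\<bar>))"
      using \<open>\<theta>0 > 0\<close> by simp
  qed measurable
  have i3: "integrable M (\<lambda>x. (Y x)\<^sup>2)"
  proof (rule Bochner_Integration.integrable_bound)
    show "integrable M (\<lambda>x. 1 + 216 / \<theta>0 ^ 3 * exp (\<theta>0 * \<bar>Y x\<bar>))" using exp_int by simp
    have "(Y x)\<^sup>2 \<le> 1 + 216 / \<theta>0 ^ 3 * exp (\<theta>0 * \<bar>Y x\<bar>)" for x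
    proof -
      have "(Y x)\<^sup>2 \<le> 1 + \<bar>Y x\<bar> ^ 3"
      proof (cases "\<bar>Y x\<bar> \<le> 1")
        case True
        then have "\<bar>Y x\<bar>\<^sup>2 \<le> 1" by (intro power_le_one) auto
        then show ?thesis by (simp add: add_increasing2)
      next
        case False
        then have "\<bar>Y x\<bar>\<^sup>2 \<le> \<bar>Y x\<bar> ^ 3" by (intro power_increasing) auto
        then show ?thesis by simp
      qed
      also have "\<dots> \<le> 1 + 216 / \<theta>0 ^ 3 * exp (\<theta>0 / 2 * \<bar>Y x\<bar>)" using cube_le_exp[OF \<open>\<theta>0 > 0\<close>] by simp
      also have "\<dots> \<le> 1 + 216 / \<theta>0 ^ 3 * exp (\<theta>0 * \<bar>Y x\<bar>)"
        using half \<open>\<theta>0 > 0\<close> by (intro add_left_mono mult_left_mono) auto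
      finally show ?thesis .
    qed
    then show "AE x in M. norm ((Y x)\<^sup>2) \<le> norm (1 + 216 / \<theta>0 ^ 3 * exp (\<theta>0 * \<bar>Y x\<bar>))"
      by (auto intro: order_trans[OF _ abs_ge_self])
  qed measurable
  have i4: "integrable M (\<lambda>x. exp (\<theta> * Y x) - 1 - \<theta> * Y x - (\<theta> * Y x)\<^sup>2 / 2)"
    using i1 i2 i3 by (simp add: power_mult_distrib)
  have eq: "(\<integral>x. exp (\<theta> * Y x) \<partial>M) - 1 - \<theta>\<^sup>2 * (\<integral>x. (Y x)\<^sup>2 \<partial>M) / 2
      = (\<integral>x. exp (\<theta> * Y x) - 1 - \<theta> * Y x - (\<theta> * Y x)\<^sup>2 / 2 \<partial>M)"
    using i1 i2 i3 mean by (simp add: power_mult_distrib prob_space)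
  have "\<bar>\<integral>x. exp (\<theta> * Y x) - 1 - \<theta> * Y x - (\<theta> * Y x)\<^sup>2 / 2 \<partial>M\<bar>
      \<le> (\<integral>x. \<bar>exp (\<theta> * Y x) - 1 - \<theta> * Y x - (\<theta> * Y x)\<^sup>2 / 2\<bar> \<partial>M)"
    by (rule integral_abs_bound)
  also have "\<dots> \<le> (\<integral>x. \<bar>\<theta>\<bar> ^ 3 * (216 / \<theta>0 ^ 3) * exp (\<theta>0 * \<bar>Y x\<bar>) \<partial>M)"
    using bnd i4 exp_int by (intro integral_mono) auto
  also have "\<dots> = C * \<bar>\<theta>\<bar> ^ 3" by (simp add: C_def)
  finally show "\<bar>(\<integral>x. exp (\<theta> * Y x) \<partial>M) - 1 - \<theta>\<^sup>2 * (\<integral>x. (Y x)\<^sup>2 \<partial>M) / 2\<bar> \<le> C * \<bar>\<theta>\<bar> ^ 3"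
    unfolding eq .
qed

text \<open>The hypotheses collect what smallness of \<theta> has to mean. One \<eta> / 2 covers the
  cubic remainder of \<phi>, the other the error 2 (\<phi> - 1)^2 of replacing ln \<phi> by \<phi> -
  1, which is available because |\<phi> - 1| \<le> 1 / 2.\<close>

lemma ln_second_order:
  fixes \<phi> :: real
  assumes "\<bar>\<phi> - 1 - \<theta>\<^sup>2 * v / 2\<bar> \<le> C * \<bar>\<theta>\<bar> ^ 3" and "v \<ge> 0" and "C \<ge> 0" and "\<bar>\<theta>\<bar> \<le> 1"
    and "C * \<bar>\<theta>\<bar> \<le> \<eta> / 2" and "(v + C) * \<theta>\<^sup>2 \<le> 1 / 2" and "2 * (v + C)\<^sup>2 * \<theta>\<^sup>2 \<le> \<eta> / 2"
  shows "\<phi> > 0" and "\<bar>ln \<phi> - \<theta>\<^sup>2 * v / 2\<bar> \<le> \<eta> * \<theta>\<^sup>2"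
proof -
  have cube: "\<bar>\<theta>\<bar> ^ 3 = \<theta>\<^sup>2 * \<bar>\<theta>\<bar>" by (simp add: power3_eq_cube power2_eq_square)
  have r1: "C * \<bar>\<theta>\<bar> ^ 3 \<le> C * \<theta>\<^sup>2"
    unfolding cube using assms by (intro mult_left_mono mult_left_le) auto
  have "C * \<bar>\<theta>\<bar> ^ 3 = (C * \<bar>\<theta>\<bar>) * \<theta>\<^sup>2" unfolding cube by simp
  also have "\<dots> \<le> \<eta> / 2 * \<theta>\<^sup>2" using assms by (intro mult_right_mono) auto
  finally have r2: "C * \<bar>\<theta>\<bar> ^ 3 \<le> \<eta> / 2 * \<theta>\<^sup>2" .
  have "\<theta>\<^sup>2 * v / 2 \<le> \<theta>\<^sup>2 * v" "\<theta>\<^sup>2 * v / 2 \<ge> 0" using assms by auto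
  then have u: "\<bar>\<phi> - 1\<bar> \<le> (v + C) * \<theta>\<^sup>2" using assms(1) r1 unfolding abs_le_iff by (auto simp: algebra_simps)
  then have u2: "\<bar>\<phi> - 1\<bar> \<le> 1 / 2" using assms by linarith
  then show "\<phi> > 0" by linarith
  have "\<bar>ln (1 + (\<phi> - 1)) - (\<phi> - 1)\<bar> \<le> 2 * (\<phi> - 1)\<^sup>2"
    by (rule abs_ln_one_plus_x_minus_x_bound) (use u2 in simp)
  also have "2 * (\<phi> - 1)\<^sup>2 \<le> 2 * ((v + C) * \<theta>\<^sup>2)\<^sup>2"
    using power_mono[OF u, of 2] by simp
  also have "\<dots> = (2 * (v + C)\<^sup>2 * \<theta>\<^sup>2) * \<theta>\<^sup>2" by (simp add: power2_eq_square)
  also have "\<dots> \<le> \<eta> / 2 * \<theta>\<^sup>2" using assms by (intro mult_right_mono) auto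
  finally have "\<bar>ln \<phi> - (\<phi> - 1)\<bar> \<le> \<eta> / 2 * \<theta>\<^sup>2" by simp
  moreover have "\<eta> / 2 * \<theta>\<^sup>2 = \<eta> * \<theta>\<^sup>2 / 2" by simp
  ultimately show "\<bar>ln \<phi> - \<theta>\<^sup>2 * v / 2\<bar> \<le> \<eta> * \<theta>\<^sup>2" using assms(1) r2 by linarith
qed

text \<open>At speed b_n^2 the exponent is \<theta> n times the sum of the Y (x i), where \<theta> n
  = c b_n / sqrt n tends to 0. By independence the logarithm of the expectation is n ln
  \<phi>(\<theta> n), and n (\<theta> n)^2 = c^2 b_n^2 turns the second order expansion into c^2
  b_n^2 v / 2 + o(b_n^2).\<close>

lemma quadratic_mgf_iid_sum:
  fixes Y :: "real \<Rightarrow> real" and \<gamma> :: "real measure" and b :: "nat \<Rightarrow> real"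
  assumes "prob_space \<gamma>" and [measurable_cong]: "sets \<gamma> = sets borel" and [measurable]: "Y \<in> borel_measurable borel"
    and "\<theta>0 > 0" and exp_int: "integrable \<gamma> (\<lambda>x. exp (\<theta>0 * \<bar>Y x\<bar>))" and mean: "(\<integral>x. Y x \<partial>\<gamma>) = 0"
    and bpos: "\<And>n. n \<ge> 1 \<Longrightarrow> b n > 0" and b0: "(\<lambda>n. b n / sqrt (real n)) \<longlonglongrightarrow> 0"
    and binf: "filterlim b at_top sequentially"
  shows "quadratic_mgf (\<lambda>n. PiM {..<n} (\<lambda>_. \<gamma>)) (\<lambda>n x. (\<Sum>i<n. Y (x i)) / (b n * sqrt (real n)))
    (\<lambda>n. (b n)\<^sup>2) (\<integral>x. (Y x)\<^sup>2 \<partial>\<gamma>)"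
proof (rule quadratic_mgf.intro)
  interpret g: prob_space \<gamma> by fact
  interpret product_prob_space "\<lambda>_::nat. \<gamma>" "{..<n}" for n by unfold_locales
  define v where "v = (\<integral>x. (Y x)\<^sup>2 \<partial>\<gamma>)"
  define C where "C = 216 / \<theta>0 ^ 3 * (\<integral>x. exp (\<theta>0 * \<bar>Y x\<bar>) \<partial>\<gamma>)"
  have v: "v \<ge> 0" and C: "C \<ge> 0" using \<open>\<theta>0 > 0\<close> by (auto simp: v_def C_def)
  show "prob_space (PiM {..<n} (\<lambda>_. \<gamma>))" for n by (intro prob_space_PiM \<open>prob_space \<gamma>\<close>)
  show "(\<lambda>x. (\<Sum>i<n. Y (x i)) / (b n * sqrt (real n))) \<in> borel_measurable (PiM {..<n} (\<lambda>_. \<gamma>))" for n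
    by measurable
  show "filterlim (\<lambda>n. (b n)\<^sup>2) at_top sequentially"
    using filterlim_at_top_mult_at_top[OF binf binf] by (simp add: power2_eq_square)
  fix c \<eta>' :: real assume eta': "\<eta>' > 0"
  \<comment> \<open>The expansion has error \<eta> (\<theta> n)^2 per summand, in total \<eta> c^2
    b_n^2. Dividing by c^2 + 1 instead of c^2 includes c = 0.\<close>
  define \<eta> where "\<eta> = \<eta>' / (c\<^sup>2 + 1)"
  have c1: "c\<^sup>2 + 1 > 0" by (simp add: add_nonneg_pos)
  have eta: "\<eta> > 0" "\<eta> * c\<^sup>2 \<le> \<eta>'"
    using eta' c1 by (auto simp: \<eta>_def field_simps)
  define \<theta> where "\<theta> n = c * (b n / sqrt (real n))" for n
  have t0: "\<theta> \<longlonglongrightarrow> 0" unfolding \<theta>_def using tendsto_mult_right_zero[OF b0] by simp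
  have ev: "\<forall>\<^sub>F n in sequentially. f (\<theta> n) \<le> K" if "f 0 = 0" "K > 0" "isCont f 0" for f :: "real \<Rightarrow> real" and K
  proof -
    have "(\<lambda>n. f (\<theta> n)) \<longlonglongrightarrow> 0" using isCont_tendsto_compose[OF that(3) t0] that(1) by simp
    from order_tendstoD(2)[OF this that(2)] show ?thesis by eventually_elim simp
  qed
  have "\<forall>\<^sub>F n in sequentially. \<bar>\<theta> n\<bar> \<le> \<theta>0 / 2" "\<forall>\<^sub>F n in sequentially. \<bar>\<theta> n\<bar> \<le> 1"
    "\<forall>\<^sub>F n in sequentially. C * \<bar>\<theta> n\<bar> \<le> \<eta> / 2" "\<forall>\<^sub>F n in sequentially. (v + C) * (\<theta> n)\<^sup>2 \<le> 1 / 2"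
    "\<forall>\<^sub>F n in sequentially. 2 * (v + C)\<^sup>2 * (\<theta> n)\<^sup>2 \<le> \<eta> / 2"
    using \<open>\<theta>0 > 0\<close> eta by (intro ev; auto intro!: continuous_intros)+
  then show "\<forall>\<^sub>F n in sequentially.
      integrable (PiM {..<n} (\<lambda>_. \<gamma>)) (\<lambda>x. exp (c * (b n)\<^sup>2 * ((\<Sum>i<n. Y (x i)) / (b n * sqrt (real n))))) \<and>
      exp ((b n)\<^sup>2 * (c\<^sup>2 * (\<integral>x. (Y x)\<^sup>2 \<partial>\<gamma>) / 2 - \<eta>'))
      \<le> (\<integral>x. exp (c * (b n)\<^sup>2 * ((\<Sum>i<n. Y (x i)) / (b n * sqrt (real n)))) \<partial>PiM {..<n} (\<lambda>_. \<gamma>)) \<and>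
      (\<integral>x. exp (c * (b n)\<^sup>2 * ((\<Sum>i<n. Y (x i)) / (b n * sqrt (real n)))) \<partial>PiM {..<n} (\<lambda>_. \<gamma>))
      \<le> exp ((b n)\<^sup>2 * (c\<^sup>2 * (\<integral>x. (Y x)\<^sup>2 \<partial>\<gamma>) / 2 + \<eta>'))"
    unfolding v_def[symmetric] using eventually_ge_at_top[of 1]
  proof eventually_elim
    case (elim n)
    have n: "n \<ge> 1" and bn: "b n > 0" using elim bpos by auto
    have Y': "Y \<in> borel_measurable \<gamma>" by measurable
    define \<phi> where "\<phi> = (\<integral>x. exp (\<theta> n * Y x) \<partial>\<gamma>)"
    have i: "integrable \<gamma> (\<lambda>x. exp (\<theta> n * Y x))"
      and p: "\<bar>\<phi> - 1 - (\<theta> n)\<^sup>2 * v / 2\<bar> \<le> C * \<bar>\<theta> n\<bar> ^ 3"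
      unfolding \<phi>_def v_def C_def
      by (rule mgf_second_order[OF \<open>prob_space \<gamma>\<close> Y' \<open>\<theta>0 > 0\<close> exp_int mean elim(1)])+
    note l = ln_second_order[OF p v C elim(2,3,4,5)]
    have eq: "exp (c * (b n)\<^sup>2 * ((\<Sum>i<n. Y (x i)) / (b n * sqrt (real n)))) = (\<Prod>i<n. exp (\<theta> n * Y (x i)))" for x
    proof -
      have "c * (b n)\<^sup>2 * ((\<Sum>i<n. Y (x i)) / (b n * sqrt (real n))) = \<theta> n * (\<Sum>i<n. Y (x i))"
        using bn by (simp add: \<theta>_def power2_eq_square)
      then show ?thesis by (simp add: sum_distrib_left exp_sum)
    qed
    have int: "integrable (PiM {..<n} (\<lambda>_. \<gamma>)) (\<lambda>x. \<Prod>i<n. exp (\<theta> n * Y (x i)))"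
      using i by (intro product_integrable_prod) auto
    have "(\<integral>x. (\<Prod>i<n. exp (\<theta> n * Y (x i))) \<partial>PiM {..<n} (\<lambda>_. \<gamma>)) = (\<Prod>i<n. \<phi>)"
      unfolding \<phi>_def using i by (intro product_integral_prod) auto
    also have "\<dots> = exp (real n * ln \<phi>)" using l(1) by (simp add: exp_of_nat_mult)
    finally have val: "(\<integral>x. (\<Prod>i<n. exp (\<theta> n * Y (x i))) \<partial>PiM {..<n} (\<lambda>_. \<gamma>)) = exp (real n * ln \<phi>)" .
    have nt: "real n * (\<theta> n)\<^sup>2 = c\<^sup>2 * (b n)\<^sup>2"
      using n by (simp add: \<theta>_def power_mult_distrib power_divide)
    have "\<bar>real n * ln \<phi> - (b n)\<^sup>2 * (c\<^sup>2 * v / 2)\<bar> = real n * \<bar>ln \<phi> - (\<theta> n)\<^sup>2 * v / 2\<bar>"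
    proof -
      have "real n * ln \<phi> - (b n)\<^sup>2 * (c\<^sup>2 * v / 2) = real n * ln \<phi> - (real n * (\<theta> n)\<^sup>2) * v / 2"
        unfolding nt by simp
      also have "\<dots> = real n * (ln \<phi> - (\<theta> n)\<^sup>2 * v / 2)" by (simp add: algebra_simps)
      finally show ?thesis by (simp add: abs_mult)
    qed
    also have "\<dots> \<le> real n * (\<eta> * (\<theta> n)\<^sup>2)" using l(2) by (intro mult_left_mono) auto
    also have "\<dots> = (\<eta> * c\<^sup>2) * (b n)\<^sup>2" using nt by (simp add: mult.left_commute mult.assoc)
    also have "\<dots> \<le> \<eta>' * (b n)\<^sup>2" using eta by (intro mult_right_mono) auto
    finally have "\<bar>real n * ln \<phi> - (b n)\<^sup>2 * (c\<^sup>2 * v / 2)\<bar> \<le> \<eta>' * (b n)\<^sup>2" .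
    then have "(b n)\<^sup>2 * (c\<^sup>2 * v / 2 - \<eta>') \<le> real n * ln \<phi>" "real n * ln \<phi> \<le> (b n)\<^sup>2 * (c\<^sup>2 * v / 2 + \<eta>')"
      by (auto simp: abs_le_iff algebra_simps)
    then show ?case unfolding eq using int val by simp
  qed
qed

section \<open>The ratio of symmetric means of a \<open>p\<close>-Gaussian vector\<close>

definition elem_sym :: "'a set \<Rightarrow> nat \<Rightarrow> ('a \<Rightarrow> real) \<Rightarrow> real" where
  "elem_sym S k y = (\<Sum>I | I \<subseteq> S \<and> card I = k. \<Prod>i\<in>I. y i)"

text \<open>In the product of the sum of y with a k-fold product over I, an index outside I produces
  a (k+1)-subset, each of which arises k + 1 times; an index inside I produces a repeated factor,
  collected in the last sum.\<close>

lemma elem_sym_Suc: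
  assumes "finite S"
  shows "(\<Sum>i\<in>S. y i) * elem_sym S k y
    = real (Suc k) * elem_sym S (Suc k) y + (\<Sum>I | I \<subseteq> S \<and> card I = k. (\<Sum>i\<in>I. y i) * (\<Prod>i\<in>I. y i))"
proof -
  have fin: "finite {I. I \<subseteq> S \<and> card I = k}" for k using assms by simp
  have finI: "I \<subseteq> S \<Longrightarrow> finite I" for I using assms finite_subset by blast
  have "(\<Sum>i\<in>S. y i) * elem_sym S k y = (\<Sum>I | I \<subseteq> S \<and> card I = k. (\<Sum>i\<in>S. y i) * (\<Prod>i\<in>I. y i))"
    by (simp add: elem_sym_def sum_distrib_left)
  also have "\<dots> = (\<Sum>I | I \<subseteq> S \<and> card I = k. (\<Sum>i\<in>S - I. y i * (\<Prod>i\<in>I. y i)) + (\<Sum>i\<in>I. y i) * (\<Prod>i\<in>I. y i))"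
  proof (intro sum.cong refl)
    fix I assume "I \<in> {I. I \<subseteq> S \<and> card I = k}"
    then have "(\<Sum>i\<in>S. y i) = (\<Sum>i\<in>S - I. y i) + (\<Sum>i\<in>I. y i)"
      using assms by (intro sum.subset_diff) auto
    then show "(\<Sum>i\<in>S. y i) * (\<Prod>i\<in>I. y i) = (\<Sum>i\<in>S - I. y i * (\<Prod>i\<in>I. y i)) + (\<Sum>i\<in>I. y i) * (\<Prod>i\<in>I. y i)"
      by (simp add: sum_distrib_right distrib_right)
  qed
  also have "\<dots> = (\<Sum>I | I \<subseteq> S \<and> card I = k. \<Sum>i\<in>S - I. y i * (\<Prod>i\<in>I. y i))
      + (\<Sum>I | I \<subseteq> S \<and> card I = k. (\<Sum>i\<in>I. y i) * (\<Prod>i\<in>I. y i))"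
    by (rule sum.distrib)
  also have "(\<Sum>I | I \<subseteq> S \<and> card I = k. \<Sum>i\<in>S - I. y i * (\<Prod>i\<in>I. y i))
      = (\<Sum>(I, i)\<in>(SIGMA I:{I. I \<subseteq> S \<and> card I = k}. S - I). y i * (\<Prod>i\<in>I. y i))"
    using fin assms by (intro sum.Sigma) auto
  \<comment> \<open>A k-set with a point outside it is the same as a (k+1)-set with a distinguished
    point inside it.\<close>
  also have "\<dots> = (\<Sum>(J, i)\<in>(SIGMA J:{J. J \<subseteq> S \<and> card J = Suc k}. J). \<Prod>i\<in>J. y i)"
    by (rule sum.reindex_bij_witness[of _ "\<lambda>(J, i). (J - {i}, i)" "\<lambda>(I, i). (insert i I, i)"])
       (auto simp: finI card_insert_if insert_absorb)
  also have "\<dots> = (\<Sum>J | J \<subseteq> S \<and> card J = Suc k. \<Sum>i\<in>J. \<Prod>i\<in>J. y i)"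
    using fin finI by (intro sum.Sigma[symmetric]) auto
  also have "\<dots> = real (Suc k) * elem_sym S (Suc k) y"
    by (simp add: elem_sym_def sum_distrib_left)
  finally show ?thesis .
qed

lemma elem_sym_nonneg: "(\<And>i. i \<in> S \<Longrightarrow> y i \<ge> 0) \<Longrightarrow> elem_sym S k y \<ge> 0"
  unfolding elem_sym_def by (intro sum_nonneg prod_nonneg) auto

lemma elem_sym_0: "finite S \<Longrightarrow> elem_sym S 0 y = 1"
proof -
  assume "finite S"
  then have "{I. I \<subseteq> S \<and> card I = 0} = {{}}" by (auto dest: finite_subset)
  then show ?thesis by (simp add: elem_sym_def)
qed

text \<open>Iterate \<open>elem_sym_Suc\<close> and drop the sum with repeated factors, which is
  nonnegative.\<close>

lemma elem_sym_upper:
  assumes "finite S" and "\<And>i. i \<in> S \<Longrightarrow> y i \<ge> 0"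
  shows "fact k * elem_sym S k y \<le> (\<Sum>i\<in>S. y i) ^ k"
proof (induction k)
  case (Suc k)
  have "real (Suc k) * elem_sym S (Suc k) y \<le> (\<Sum>i\<in>S. y i) * elem_sym S k y"
    unfolding elem_sym_Suc[OF assms(1)] using assms
    by (auto intro!: sum_nonneg mult_nonneg_nonneg prod_nonneg)
  then have "fact k * (real (Suc k) * elem_sym S (Suc k) y) \<le> fact k * ((\<Sum>i\<in>S. y i) * elem_sym S k y)"
    by (intro mult_left_mono) auto
  also have "\<dots> \<le> (\<Sum>i\<in>S. y i) * (\<Sum>i\<in>S. y i) ^ k"
    using mult_left_mono[OF Suc, of "\<Sum>i\<in>S. y i"] assms by (simp add: sum_nonneg mult.left_commute)
  finally show ?case by (simp add: mult_ac)
qed (simp add: elem_sym_0 assms)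

text \<open>If every y i is at most \<tau>, the repeated factors contribute at most j \<tau> times
  the j-th elementary symmetric polynomial. Weakening j to the fixed k in each step makes the bound
  a pure power.\<close>

lemma elem_sym_lower:
  assumes "finite S" and "\<And>i. i \<in> S \<Longrightarrow> 0 \<le> y i" and "\<And>i. i \<in> S \<Longrightarrow> y i \<le> \<tau>" and "\<tau> \<ge> 0"
    and "real k * \<tau> \<le> (\<Sum>i\<in>S. y i)" and "j \<le> k"
  shows "((\<Sum>i\<in>S. y i) - real k * \<tau>) ^ j \<le> fact j * elem_sym S j y"
  using \<open>j \<le> k\<close>
proof (induction j)
  case (Suc j)
  define s where "s = (\<Sum>i\<in>S. y i)"
  have "(\<Sum>I | I \<subseteq> S \<and> card I = j. (\<Sum>i\<in>I. y i) * (\<Prod>i\<in>I. y i)) \<le> real j * \<tau> * elem_sym S j y"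
    unfolding elem_sym_def sum_distrib_left
  proof (intro sum_mono mult_right_mono)
    fix I assume I: "I \<in> {I. I \<subseteq> S \<and> card I = j}"
    have "(\<Sum>i\<in>I. y i) \<le> of_nat (card I) * \<tau>" using I assms(3) by (intro sum_bounded_above) auto
    then show "(\<Sum>i\<in>I. y i) \<le> real j * \<tau>" using I by simp
    show "0 \<le> (\<Prod>i\<in>I. y i)" using I assms(2) by (auto intro!: prod_nonneg)
  qed
  then have "(s - real j * \<tau>) * elem_sym S j y \<le> real (Suc j) * elem_sym S (Suc j) y"
    using elem_sym_Suc[OF assms(1), of y j] by (simp add: s_def algebra_simps)
  moreover have "(s - real k * \<tau>) * elem_sym S j y \<le> (s - real j * \<tau>) * elem_sym S j y"
    using Suc.prems \<open>\<tau> \<ge> 0\<close> assms(2) by (intro mult_right_mono elem_sym_nonneg) (auto intro!: mult_right_mono)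
  ultimately have "fact j * ((s - real k * \<tau>) * elem_sym S j y) \<le> fact j * (real (Suc j) * elem_sym S (Suc j) y)"
    by (intro mult_left_mono) auto
  moreover have "(s - real k * \<tau>) ^ Suc j \<le> (s - real k * \<tau>) * (fact j * elem_sym S j y)"
    using Suc assms(5) by (simp, intro mult_left_mono) (auto simp: s_def)
  moreover have "(s - real k * \<tau>) * (fact j * elem_sym S j y) = fact j * ((s - real k * \<tau>) * elem_sym S j y)"
    by simp
  moreover have "fact j * (real (Suc j) * elem_sym S (Suc j) y) = fact (Suc j) * elem_sym S (Suc j) y"
    by simp
  ultimately show ?case unfolding s_def by linarith
qed (simp add: elem_sym_0 assms)

lemma elem_sym_const: "finite S \<Longrightarrow> elem_sym S k (\<lambda>_. 1) = real (card S choose k)"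
  by (simp add: elem_sym_def n_subsets)

lemma ln_one_minus_ge: "- ln (1 - u) \<le> 2 * u" if "0 \<le> u" "u \<le> 1 / 2" for u :: real
proof -
  have "- u - 2 * u\<^sup>2 \<le> ln (1 - u)" using that by (rule ln_one_minus_pos_lower_bound)
  moreover have "u * u \<le> u * (1 / 2)" using that by (intro mult_left_mono) auto
  ultimately show ?thesis by (simp add: power2_eq_square)
qed

text \<open>Numerator and binomial coefficient, both multiplied by k!, are enclosed between k-th
  powers, so the logarithms leave only ln (1 - k \<tau> / (n A)) and ln (1 - k / n). The conditions
  on A, \<tau> and n keep both fractions at most 1 / 2, where - ln (1 - u) \<le> 2 u.\<close>

lemma elem_sym_log_bound:
  fixes y :: "nat \<Rightarrow> real"
  assumes "k \<ge> 1" and "2 * k \<le> n" and y: "\<And>i. i < n \<Longrightarrow> 0 < y i" "\<And>i. i < n \<Longrightarrow> y i \<le> \<tau>" and "\<tau> \<ge> 0"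
    and A: "A = (\<Sum>i<n. y i) / real n" "A \<ge> 1 / 2" and tau: "4 * real k * \<tau> \<le> real n"
  defines "E \<equiv> elem_sym {..<n} k y / real (n choose k)"
  shows "E > 0" and "\<bar>real k * ln A - ln E\<bar> \<le> 2 * (real k)\<^sup>2 / real n * (1 + 2 * \<tau>)"
proof -
  have n: "real n > 0" using assms by simp
  have sum: "(\<Sum>i<n. y i) = real n * A" using n A by simp
  have nA: "real n * A > 0" using n A(2) by simp
  have t1: "real k * \<tau> / (real n * A) \<le> 1 / 2" "real k * \<tau> \<le> real n * A / 2"
  proof -
    have "real n * (1 / 2) \<le> real n * A" using A by (intro mult_left_mono) auto
    then show "real k * \<tau> \<le> real n * A / 2" using tau by simp
    then show "real k * \<tau> / (real n * A) \<le> 1 / 2" using nA by (simp only: pos_divide_le_eq)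
  qed
  have up: "fact k * elem_sym {..<n} k y \<le> (real n * A) ^ k"
    using elem_sym_upper[of "{..<n}" y k] y by (simp add: sum less_imp_le)
  have lo: "(real n * A - real k * \<tau>) ^ k \<le> fact k * elem_sym {..<n} k y"
    using elem_sym_lower[of "{..<n}" y \<tau> k k] y \<open>\<tau> \<ge> 0\<close> t1 nA by (simp add: sum less_imp_le)
  \<comment> \<open>The same two bounds with all y i = 1 enclose k! (n choose k) between (n - k)^k
    and n^k.\<close>
  have cu: "fact k * real (n choose k) \<le> real n ^ k"
    using elem_sym_upper[of "{..<n}" "\<lambda>_. 1" k] by (simp add: elem_sym_const)
  have cl: "(real n - real k) ^ k \<le> fact k * real (n choose k)"
    using elem_sym_lower[of "{..<n}" "\<lambda>_. 1" 1 k k] assms(2) by (simp add: elem_sym_const)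
  have nk: "real n - real k > 0" using assms by simp
  have c0: "real (n choose k) > 0" using assms by simp
  have l0: "real n * A - real k * \<tau> > 0" using t1 nA by linarith
  have e0: "elem_sym {..<n} k y > 0"
  proof -
    have "0 < (real n * A - real k * \<tau>) ^ k" using l0 by simp
    then have "0 < fact k * elem_sym {..<n} k y" using lo by linarith
    then show ?thesis by (simp add: zero_less_mult_iff)
  qed
  then show "E > 0" using c0 by (simp add: E_def)
  have E: "E = (fact k * elem_sym {..<n} k y) / (fact k * real (n choose k))" by (simp add: E_def)
  have lnE: "ln E = ln (fact k * elem_sym {..<n} k y) - ln (fact k * real (n choose k))"
    unfolding E using e0 c0 by (intro ln_divide_pos) auto
  have u1: "ln (fact k * elem_sym {..<n} k y) \<le> real k * ln (real n * A)"
    using ln_mono[OF up] e0 nA by (simp add: ln_realpow)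
  have u2: "real k * ln (real n * A - real k * \<tau>) \<le> ln (fact k * elem_sym {..<n} k y)"
    using ln_mono[OF lo] l0 by (simp add: ln_realpow)
  have u3: "ln (fact k * real (n choose k)) \<le> real k * ln (real n)"
    using ln_mono[OF cu] c0 n by (simp add: ln_realpow)
  have u4: "real k * ln (real n - real k) \<le> ln (fact k * real (n choose k))"
    using ln_mono[OF cl] nk by (simp add: ln_realpow)
  have v1: "ln (real n * A) = ln (real n) + ln A" using n A(2) by (intro ln_mult_pos) auto
  have v2: "ln (real n * A - real k * \<tau>) = ln (real n) + ln A + ln (1 - real k * \<tau> / (real n * A))"
  proof -
    have "real n * A - real k * \<tau> = (real n * A) * (1 - real k * \<tau> / (real n * A))"
      using nA by (simp only: right_diff_distrib times_divide_eq_right mult_1_right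
          nonzero_mult_div_cancel_left[OF less_imp_neq[OF nA, symmetric]])
    moreover have "1 - real k * \<tau> / (real n * A) > 0" using t1 by linarith
    ultimately show ?thesis using nA v1 by (metis ln_mult_pos)
  qed
  have v3: "ln (real n - real k) = ln (real n) + ln (1 - real k / real n)"
  proof -
    have "real n - real k = real n * (1 - real k / real n)" using n by (simp add: right_diff_distrib)
    moreover have "1 - real k / real n > 0" using n assms by simp
    ultimately show ?thesis using n by (metis ln_mult_pos)
  qed
  have w1: "- ln (1 - real k * \<tau> / (real n * A)) \<le> 4 * real k * \<tau> / real n"
  proof -
    have "- ln (1 - real k * \<tau> / (real n * A)) \<le> 2 * (real k * \<tau> / (real n * A))"
      using t1 nA \<open>\<tau> \<ge> 0\<close> by (intro ln_one_minus_ge) auto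
    also have "\<dots> \<le> 2 * (real k * \<tau> / (real n * (1 / 2)))"
      using n A \<open>\<tau> \<ge> 0\<close> by (intro mult_left_mono divide_left_mono) auto
    finally show ?thesis by simp
  qed
  have w2: "- ln (1 - real k / real n) \<le> 2 * real k / real n"
    using ln_one_minus_ge[of "real k / real n"] n assms by (simp add: field_simps)
  have "real k * ln A - ln E \<le> real k * (- ln (1 - real k * \<tau> / (real n * A)))"
    using u2 u3 unfolding lnE v2 by (simp add: algebra_simps)
  also have "\<dots> \<le> real k * (4 * real k * \<tau> / real n)" using w1 by (intro mult_left_mono) auto
  also have "\<dots> \<le> 2 * (real k)\<^sup>2 / real n * (1 + 2 * \<tau>)"
    using n by (simp add: power2_eq_square divide_right_mono field_simps)
  finally have 1: "real k * ln A - ln E \<le> 2 * (real k)\<^sup>2 / real n * (1 + 2 * \<tau>)" .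
  have "ln E - real k * ln A \<le> real k * (- ln (1 - real k / real n))"
    using u1 u4 unfolding lnE v1 v3 by (simp add: algebra_simps)
  also have "\<dots> \<le> real k * (2 * real k / real n)" using w2 by (intro mult_left_mono) auto
  also have "\<dots> = 2 * (real k)\<^sup>2 / real n * 1" by (simp add: power2_eq_square)
  also have "\<dots> \<le> 2 * (real k)\<^sup>2 / real n * (1 + 2 * \<tau>)"
    using \<open>\<tau> \<ge> 0\<close> n by (intro mult_left_mono) auto
  finally show "\<bar>real k * ln A - ln E\<bar> \<le> 2 * (real k)\<^sup>2 / real n * (1 + 2 * \<tau>)"
    using 1 by (simp add: abs_le_iff)
qed

section \<open>Linearisation of the log ratio\<close>

lemma sym_mean_elem_sym:
  "sym_mean k n p x = (elem_sym {..<n} k (\<lambda>i. \<bar>x i\<bar> powr p) / real (n choose k)) powr (1 / (real k * p))"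
  by (simp add: sym_mean_def elem_sym_def)

text \<open>The logarithm of the n-th mean is exactly the average of the ln |x i|. That of the k-th
  mean is ln A / p up to \<open>elem_sym_log_bound\<close>, and ln A is replaced by A - 1. The two
  errors are the two summands of the bound.\<close>

lemma mean_ratio_linearisation:
  fixes x :: "nat \<Rightarrow> real"
  assumes "p \<ge> 1" and "k \<ge> 1" and "2 * k \<le> n" and x: "\<And>i. i < n \<Longrightarrow> x i \<noteq> 0"
    and y: "\<And>i. i < n \<Longrightarrow> \<bar>x i\<bar> powr p \<le> \<tau>" and "\<tau> \<ge> 0" and tau: "4 * real k * \<tau> \<le> real n"
    and A: "A = (\<Sum>i<n. \<bar>x i\<bar> powr p) / real n" "\<bar>A - 1\<bar> \<le> 1 / 2"
  shows "mean_ratio k n n p x > 0"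
    and "\<bar>ln (mean_ratio k n n p x) - m_const p - (\<Sum>i<n. lin_stat p (x i)) / real n\<bar>
      \<le> 2 * (A - 1)\<^sup>2 + 2 * real k / real n * (1 + 2 * \<tau>)"
proof -
  have n: "real n > 0" using assms by simp
  define y where "y i = \<bar>x i\<bar> powr p" for i
  have y0: "y i > 0" if "i < n" for i using x[OF that] by (simp add: y_def)
  have Ah: "A \<ge> 1 / 2" using A(2) by linarith
  define E where "E = elem_sym {..<n} k y / real (n choose k)"
  have y1: "y i \<le> \<tau>" if "i < n" for i using y[OF that] by (simp add: y_def)
  have A1: "A = (\<Sum>i<n. y i) / real n" by (simp add: A(1) y_def)
  have E0: "E > 0" and LE: "\<bar>real k * ln A - ln E\<bar> \<le> 2 * (real k)\<^sup>2 / real n * (1 + 2 * \<tau>)"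
    unfolding E_def
    using elem_sym_log_bound[OF \<open>k \<ge> 1\<close> \<open>2 * k \<le> n\<close> y0 y1 \<open>\<tau> \<ge> 0\<close> A1 Ah tau] by auto
  have Sk: "sym_mean k n p x = E powr (1 / (real k * p))" by (simp add: sym_mean_elem_sym E_def y_def[abs_def])
  \<comment> \<open>The only n-subset is the full index set, so the n-th symmetric mean is the
    geometric mean of the |x i|.\<close>
  have "{I. I \<subseteq> {..<n} \<and> card I = n} = {{..<n}}"
    by (auto dest: card_subset_eq[OF finite_lessThan])
  then have Sn: "sym_mean n n p x = (\<Prod>i<n. y i) powr (1 / (real n * p))"
    by (simp add: sym_mean_def y_def)
  have prod0: "(\<Prod>i<n. y i) > 0" using y0 by (intro prod_pos) auto
  have nz: "(\<Prod>i<n. y i) \<noteq> 0" "E \<noteq> 0" using prod0 E0 by linarith+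
  then have pp: "(\<Prod>i<n. y i) powr (1 / (real n * p)) > 0" "E powr (1 / (real k * p)) > 0"
    by (simp_all only: powr_gt_zero not_False_eq_True)
  then show "mean_ratio k n n p x > 0" unfolding mean_ratio_def Sk Sn by (rule divide_pos_pos)
  have "ln (\<Prod>i<n. y i) = (\<Sum>i<n. ln (y i))"
    using y0 by (intro ln_prod) (auto simp: less_imp_neq[symmetric])
  also have "\<dots> = (\<Sum>i<n. p * ln \<bar>x i\<bar>)" using x by (intro sum.cong) (auto simp: y_def ln_powr)
  finally have "ln (\<Prod>i<n. y i) / (real n * p) = (\<Sum>i<n. ln \<bar>x i\<bar>) / real n"
    using \<open>p \<ge> 1\<close> n by (simp add: sum_distrib_left[symmetric])
  then have lnr: "ln (mean_ratio k n n p x) = (\<Sum>i<n. ln \<bar>x i\<bar>) / real n - ln E / (real k * p)"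
    unfolding mean_ratio_def Sk Sn using pp nz by (simp only: ln_divide_pos ln_powr) simp
  have "(\<Sum>i<n. lin_stat p (x i)) = (\<Sum>i<n. ln \<bar>x i\<bar>) - real n * m_const p - ((\<Sum>i<n. \<bar>x i\<bar> powr p) - real n) / p"
    by (simp add: lin_stat_def sum_subtractf sum_divide_distrib[symmetric])
  also have "((\<Sum>i<n. \<bar>x i\<bar> powr p) - real n) / p = real n * ((A - 1) / p)"
  proof -
    have S: "(\<Sum>i<n. \<bar>x i\<bar> powr p) = real n * A" using n by (simp add: A(1))
    show ?thesis unfolding S by (simp add: right_diff_distrib)
  qed
  finally have lin: "(\<Sum>i<n. lin_stat p (x i)) / real n = (\<Sum>i<n. ln \<bar>x i\<bar>) / real n - m_const p - (A - 1) / p"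
    using n by (simp add: diff_divide_distrib)
  have "ln (mean_ratio k n n p x) - m_const p - (\<Sum>i<n. lin_stat p (x i)) / real n
      = ((A - 1) - ln A) / p + (real k * ln A - ln E) / (real k * p)"
    unfolding lnr lin using \<open>p \<ge> 1\<close> \<open>k \<ge> 1\<close> by (simp add: field_simps)
  then have "\<bar>ln (mean_ratio k n n p x) - m_const p - (\<Sum>i<n. lin_stat p (x i)) / real n\<bar>
      \<le> \<bar>(A - 1) - ln A\<bar> / p + \<bar>real k * ln A - ln E\<bar> / (real k * p)"
    using \<open>p \<ge> 1\<close> \<open>k \<ge> 1\<close> by (simp only:) (rule order_trans[OF abs_triangle_ineq], simp)
  also have "\<dots> \<le> 2 * (A - 1)\<^sup>2 / 1 + 2 * (real k)\<^sup>2 / real n * (1 + 2 * \<tau>) / (real k * 1)"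
  proof (intro add_mono frac_le)
    have "\<bar>ln (1 + (A - 1)) - (A - 1)\<bar> \<le> 2 * (A - 1)\<^sup>2"
      by (rule abs_ln_one_plus_x_minus_x_bound) (use A(2) in simp)
    then show "\<bar>(A - 1) - ln A\<bar> \<le> 2 * (A - 1)\<^sup>2" by (simp add: abs_minus_commute)
  qed (use LE \<open>p \<ge> 1\<close> \<open>k \<ge> 1\<close> \<open>\<tau> \<ge> 0\<close> in auto)
  also have "\<dots> = 2 * (A - 1)\<^sup>2 + 2 * real k / real n * (1 + 2 * \<tau>)"
    using \<open>k \<ge> 1\<close> by (simp add: power2_eq_square)
  finally show "\<bar>ln (mean_ratio k n n p x) - m_const p - (\<Sum>i<n. lin_stat p (x i)) / real n\<bar>
      \<le> 2 * (A - 1)\<^sup>2 + 2 * real k / real n * (1 + 2 * \<tau>)" .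
qed

text \<open>Here h stands for b_n / sqrt n, so that h * n = b_n sqrt n. Dividing the linearisation
  error by h gives the three terms bounded by r: the first two vanish asymptotically, while 4 k
  \<epsilon> is small only through the choice of \<epsilon>. Passing from the logarithm l to exp l -
  1 costs 2 l^2 / h, of order h.\<close>

lemma mean_ratio_deviation_bound:
  fixes x :: "nat \<Rightarrow> real"
  assumes "p \<ge> 1" and "k \<ge> 1" and "2 * k \<le> n" and "\<And>i. i < n \<Longrightarrow> x i \<noteq> 0"
    and "\<And>i. i < n \<Longrightarrow> \<bar>x i\<bar> powr p \<le> \<epsilon> * (h * real n)" and "\<epsilon> \<ge> 0" and h: "h > 0"
    and small: "4 * real k * \<epsilon> * h \<le> 1" "K * h \<le> 1 / 2" "(K + 1) * h \<le> 1"
    and A: "\<bar>(\<Sum>i<n. \<bar>x i\<bar> powr p - 1) / (h * real n)\<bar> \<le> K"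
    and W: "W = (\<Sum>i<n. lin_stat p (x i)) / (h * real n)" "\<bar>W\<bar> \<le> K"
    and r: "2 * K\<^sup>2 * h + 2 * real k / (h * real n) + 4 * real k * \<epsilon> \<le> r" "r \<le> 1"
  shows "\<bar>W - (exp (- m_const p) * mean_ratio k n n p x - 1) / h\<bar> \<le> r + 2 * (K + 1)\<^sup>2 * h"
proof -
  have n: "real n > 0" using assms by simp
  define A where "A = (\<Sum>i<n. \<bar>x i\<bar> powr p) / real n"
  have "(\<Sum>i<n. \<bar>x i\<bar> powr p - 1) / (h * real n) = (A - 1) / h"
    using n h by (simp add: A_def sum_subtractf field_simps)
  then have "\<bar>A - 1\<bar> / h \<le> K" using A h by simp
  then have Ah: "\<bar>A - 1\<bar> \<le> K * h" using h by (simp add: field_simps)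
  define l where "l = ln (mean_ratio k n n p x) - m_const p"
  have tau: "4 * real k * (\<epsilon> * (h * real n)) \<le> real n"
    using mult_right_mono[OF small(1), of "real n"] n by (simp add: mult_ac)
  have t0: "\<epsilon> * (h * real n) \<ge> 0" using \<open>\<epsilon> \<ge> 0\<close> h n by simp
  note lin = mean_ratio_linearisation[OF \<open>p \<ge> 1\<close> \<open>k \<ge> 1\<close> \<open>2 * k \<le> n\<close> assms(4) assms(5) t0 tau A_def]
  have A2: "\<bar>A - 1\<bar> \<le> 1 / 2" using Ah small by linarith
  have pos: "mean_ratio k n n p x > 0"
    and D: "\<bar>l - (\<Sum>i<n. lin_stat p (x i)) / real n\<bar> \<le> 2 * (A - 1)\<^sup>2 + 2 * real k / real n * (1 + 2 * (\<epsilon> * (h * real n)))"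
    using lin[OF _ _ A2] by (auto simp: l_def)
  have "(A - 1)\<^sup>2 \<le> (K * h)\<^sup>2" using power_mono[OF Ah, of 2] by simp
  then have D2: "\<bar>l - (\<Sum>i<n. lin_stat p (x i)) / real n\<bar> \<le> 2 * (K * h)\<^sup>2 + 2 * real k / real n * (1 + 2 * (\<epsilon> * (h * real n)))"
    using D by linarith
  have "\<bar>l / h - W\<bar> = \<bar>l - (\<Sum>i<n. lin_stat p (x i)) / real n\<bar> / h"
  proof -
    have "l / h - W = (l - (\<Sum>i<n. lin_stat p (x i)) / real n) / h"
      using h n by (simp add: W(1) field_simps)
    then show ?thesis using h by simp
  qed
  also have "\<dots> \<le> (2 * (K * h)\<^sup>2 + 2 * real k / real n * (1 + 2 * (\<epsilon> * (h * real n)))) / h"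
    using D2 h by (intro divide_right_mono) auto
  also have "\<dots> = 2 * K\<^sup>2 * h + 2 * real k / (h * real n) + 4 * real k * \<epsilon>"
    using h n by (simp add: field_simps power2_eq_square)
  finally have lW: "\<bar>l / h - W\<bar> \<le> r" using r by linarith
  then have lh: "\<bar>l / h\<bar> \<le> K + 1" using W r by linarith
  then have lh2: "\<bar>l\<bar> \<le> (K + 1) * h" using h by (simp add: field_simps)
  then have l1: "\<bar>l\<bar> \<le> 1" using small by linarith
  have "\<bar>exp l - 1 - l\<bar> \<le> 2 * l\<^sup>2"
  proof -
    obtain t where t: "\<bar>t\<bar> \<le> \<bar>l\<bar>" "exp l = (\<Sum>m<2. l ^ m / fact m) + exp t / fact 2 * l ^ 2"
      using Maclaurin_exp_le[of l 2] by auto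
    have "exp t \<le> exp 1" using t(1) l1 by simp
    then have "exp t \<le> 3" using exp_le by linarith
    have "exp l - 1 - l = exp t / 2 * l\<^sup>2" using t(2) by (simp add: eval_nat_numeral)
    then have "\<bar>exp l - 1 - l\<bar> = exp t / 2 * l\<^sup>2" by (simp only: abs_mult) simp
    also have "\<dots> \<le> 2 * l\<^sup>2" using \<open>exp t \<le> 3\<close> by (intro mult_right_mono) auto
    finally show ?thesis .
  qed
  also have "l\<^sup>2 \<le> ((K + 1) * h)\<^sup>2" using power_mono[OF lh2, of 2] by simp
  finally have e: "\<bar>exp l - 1 - l\<bar> \<le> 2 * (K + 1)\<^sup>2 * h * h" by (simp add: power2_eq_square mult_ac)
  have "exp (- m_const p) * mean_ratio k n n p x = exp l"
    using pos by (simp add: l_def exp_diff exp_minus divide_inverse mult.commute)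
  then have "\<bar>(exp (- m_const p) * mean_ratio k n n p x - 1) / h - l / h\<bar> = \<bar>exp l - 1 - l\<bar> / h"
    using h by (simp add: diff_divide_distrib[symmetric])
  also have "\<dots> \<le> 2 * (K + 1)\<^sup>2 * h" using e h by (simp add: pos_divide_le_eq)
  finally show ?thesis using lW by linarith
qed

lemma measurable_mean_ratio [measurable]:
  shows "mean_ratio k1 k2 n p \<in> borel_measurable (Rn n)"
proof -
  have "sym_mean k n p \<in> borel_measurable (Rn n)" for k
  proof -
    have "(\<lambda>x. \<bar>x i\<bar> powr p) \<in> borel_measurable (Rn n)" if "i < n" for i
    proof -
      have [measurable]: "(\<lambda>x. x i) \<in> borel_measurable (Rn n)"
        using that by (intro measurable_component_singleton) auto
      show ?thesis by measurable
    qed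
    then have "(\<lambda>x. \<Prod>i\<in>I. \<bar>x i\<bar> powr p) \<in> borel_measurable (Rn n)"
      if "I \<in> {I. I \<subseteq> {..<n} \<and> card I = k}" for I
      using that by (intro borel_measurable_prod) auto
    then have "(\<lambda>x. \<Sum>I | I \<subseteq> {..<n} \<and> card I = k. \<Prod>i\<in>I. \<bar>x i\<bar> powr p) \<in> borel_measurable (Rn n)"
      by (rule borel_measurable_sum)
    then show ?thesis unfolding sym_mean_def[abs_def] by measurable
  qed
  then show ?thesis unfolding mean_ratio_def[abs_def] by measurable
qed

section \<open>Gaussian vectors: the ratio is exponentially equivalent to a sum of independent
  variables\<close>

definition gauss_vec :: "nat \<Rightarrow> real \<Rightarrow> (nat \<Rightarrow> real) measure" where
  "gauss_vec n p = PiM {..<n} (\<lambda>_. p_gaussian p)"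

lemma sets_gauss: "p \<ge> 1 \<Longrightarrow> sets (gauss_vec n p) = sets (Rn n)"
  unfolding gauss_vec_def by (intro sets_PiM_cong refl sets_p_gaussian)

lemma space_gauss: "p \<ge> 1 \<Longrightarrow> space (gauss_vec n p) = space (Rn n)"
  by (rule sets_eq_imp_space_eq[OF sets_gauss])

lemma prob_space_gauss: "p \<ge> 1 \<Longrightarrow> prob_space (gauss_vec n p)"
  unfolding gauss_vec_def by (intro prob_space_PiM prob_space_p_gaussian)

definition ratio_dev :: "nat \<Rightarrow> real \<Rightarrow> (nat \<Rightarrow> real) \<Rightarrow> nat \<Rightarrow> (nat \<Rightarrow> real) \<Rightarrow> real" where
  "ratio_dev k p b n x = sqrt (real n) / b n * (exp (- m_const p) * mean_ratio k n n p x - 1)"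

locale mod_scale =
  fixes p :: real and k :: nat and b :: "nat \<Rightarrow> real"
  assumes p: "p \<ge> 1" and k: "k \<ge> 1" and bpos: "\<And>n. n \<ge> 1 \<Longrightarrow> b n > 0"
    and b0: "(\<lambda>n. b n / sqrt (real n)) \<longlonglongrightarrow> 0" and binf: "filterlim b at_top sequentially"
begin

interpretation g: prob_space "p_gaussian p" by (rule prob_space_p_gaussian[OF p])

lemmas sets_gauss_vec [measurable_cong] = sets_gauss[OF p]
lemmas prob_space_gauss_vec = prob_space_gauss[OF p]

lemma measurable_coord: "i < n \<Longrightarrow> (\<lambda>x. x i) \<in> borel_measurable (gauss_vec n p)"
  unfolding measurable_cong_sets[OF sets_gauss_vec refl] by (intro measurable_component_singleton) auto

lemma coord_set: "i < n \<Longrightarrow> B \<in> sets borel \<Longrightarrow> {x \<in> space (gauss_vec n p). x i \<in> B} \<in> sets (gauss_vec n p)"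
  using measurable_sets[OF measurable_coord] by (simp add: vimage_def Int_def conj_commute)

lemma sq_b_at_top: "filterlim (\<lambda>n. (b n)\<^sup>2) at_top sequentially"
  using filterlim_at_top_mult_at_top[OF binf binf] by (simp add: power2_eq_square)

definition lin_sum :: "nat \<Rightarrow> (nat \<Rightarrow> real) \<Rightarrow> real" where
  "lin_sum n x = (\<Sum>i<n. lin_stat p (x i)) / (b n * sqrt (real n))"

definition powr_sum :: "nat \<Rightarrow> (nat \<Rightarrow> real) \<Rightarrow> real" where
  "powr_sum n x = (\<Sum>i<n. \<bar>x i\<bar> powr p - 1) / (b n * sqrt (real n))"

lemma mgf_lin_sum: "quadratic_mgf (\<lambda>n. gauss_vec n p) lin_sum (\<lambda>n. (b n)\<^sup>2) (s_sq p)"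
  unfolding gauss_vec_def lin_sum_def[abs_def] s_sq_lin_stat[OF p]
  by (rule quadratic_mgf_iid_sum[OF g.prob_space_axioms sets_p_gaussian[OF p] measurable_lin_stat _
      lin_stat_exp_moment[OF p] lin_stat_integral_zero(2)[OF p] bpos b0 binf]) auto

lemma mgf_powr_sum: "quadratic_mgf (\<lambda>n. gauss_vec n p) powr_sum (\<lambda>n. (b n)\<^sup>2)
    (\<integral>x. (\<bar>x\<bar> powr p - 1)\<^sup>2 \<partial>p_gaussian p)"
  unfolding gauss_vec_def powr_sum_def[abs_def]
proof (rule quadratic_mgf_iid_sum[OF g.prob_space_axioms sets_p_gaussian[OF p] _ _ powr_exp_moment[OF p] _ bpos b0 binf])
  show "(\<integral>x. \<bar>x\<bar> powr p - 1 \<partial>p_gaussian p) = 0"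
    using p_gaussian_integral_powr[OF p] g.prob_space by simp
qed (use p in auto)

lemma gauss_vec_component:
  assumes "i < n" and "B \<in> sets borel"
  shows "measure (gauss_vec n p) {x \<in> space (gauss_vec n p). x i \<in> B} = measure (p_gaussian p) B"
proof -
  have "p_gaussian p = distr (gauss_vec n p) (p_gaussian p) (\<lambda>x. x i)"
    unfolding gauss_vec_def using assms g.prob_space_axioms by (intro distr_PiM_component[symmetric]) auto
  also have "measure \<dots> B = measure (gauss_vec n p) {x \<in> space (gauss_vec n p). x i \<in> B}"
    using assms by (subst measure_distr)
      (auto simp: gauss_vec_def sets_p_gaussian[OF p] intro!: arg_cong[where f = "measure _"])
  finally show ?thesis by simp
qed

lemma gauss_vec_nonzero: "AE x in gauss_vec n p. \<forall>i<n. x i \<noteq> 0"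
proof -
  interpret G: prob_space "gauss_vec n p" by (rule prob_space_gauss_vec)
  have "AE x in gauss_vec n p. x i \<noteq> 0" if "i < n" for i
  proof -
    have "measure (p_gaussian p) {0} = 0"
      using p_gaussian_AE_nonzero[OF p] sets_p_gaussian[OF p]
      by (subst (asm) AE_iff_measurable[of "{0}"]) (auto simp: g.emeasure_eq_measure space_p_gaussian[OF p])
    then have "measure (gauss_vec n p) {x \<in> space (gauss_vec n p). x i \<in> {0}} = 0"
      using gauss_vec_component[OF that, of "{0}"] by simp
    moreover have "{x \<in> space (gauss_vec n p). x i \<in> {0}} \<in> sets (gauss_vec n p)"
      using that by (intro coord_set) auto
    ultimately show ?thesis
      by (subst AE_iff_measurable[of "{x \<in> space (gauss_vec n p). x i \<in> {0}}"])
        (auto simp: G.emeasure_eq_measure)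
  qed
  then have "AE x in gauss_vec n p. \<forall>i\<in>{..<n}. x i \<noteq> 0" by (subst AE_ball_countable) auto
  then show ?thesis by eventually_elim auto
qed

text \<open>Union bound over n coordinates, each with tail E exp (- \<epsilon> b_n sqrt n / (2 p)).
  The exponent dominates b_n^2 because b_n / sqrt n tends to 0, and it dominates ln n because b_n
  \<ge> 1 eventually.\<close>

lemma max_tail_small:
  assumes "\<epsilon> > 0"
  shows "superexp_small (\<lambda>n. (b n)\<^sup>2) (\<lambda>n. measure (gauss_vec n p)
    {x \<in> space (gauss_vec n p). \<exists>i<n. \<bar>x i\<bar> powr p > \<epsilon> * (b n * sqrt (real n))})"
  unfolding superexp_small_def
proof
  fix C :: real
  define E where "E = (\<integral>x. exp (1 / (2 * p) * \<bar>x\<bar> powr p) \<partial>p_gaussian p)"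
  \<comment> \<open>The tail exponent is 4 c b_n sqrt n. One quarter of it pays for the factor n,
    one for E and one for C b_n^2.\<close>
  define c where "c = \<epsilon> / (8 * p)"
  have c: "c > 0" using assms p by (simp add: c_def)
  have "\<forall>\<^sub>F n in sequentially. b n \<ge> 1" using binf by (auto simp: filterlim_at_top)
  moreover have "\<forall>\<^sub>F n in sequentially. \<bar>C\<bar> * (b n / sqrt (real n)) < c"
    using order_tendstoD(2)[OF tendsto_mult_right_zero[OF b0, of "\<bar>C\<bar>"] c] .
  moreover have "\<forall>\<^sub>F n in sequentially. ln (real n) \<le> c * sqrt (real n)" using c by real_asymp
  moreover have "\<forall>\<^sub>F n in sequentially. \<bar>E\<bar> \<le> exp (c * sqrt (real n))" using c by real_asymp
  ultimately show "\<forall>\<^sub>F n in sequentially. measure (gauss_vec n p)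
    {x \<in> space (gauss_vec n p). \<exists>i<n. \<bar>x i\<bar> powr p > \<epsilon> * (b n * sqrt (real n))} \<le> exp (- C * (b n)\<^sup>2)"
    using eventually_ge_at_top[of 1]
  proof eventually_elim
    case (elim n)
    interpret G: prob_space "gauss_vec n p" by (rule prob_space_gauss_vec)
    have n: "real n \<ge> 1" using elim by simp
    define \<tau> where "\<tau> = \<epsilon> * (b n * sqrt (real n))"
    have sb: "sqrt (real n) \<le> b n * sqrt (real n)" using elim(1) by (simp add: mult_le_cancel_right1)
    have tail: "measure (p_gaussian p) {x. \<bar>x\<bar> powr p \<ge> \<tau>} \<le> exp (- (1 / (2 * p)) * \<tau>) * E"
      using chernoff_bound[of "p_gaussian p" "\<lambda>x. \<bar>x\<bar> powr p" "1 / (2 * p)" \<tau>]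
        p_gaussian_integrable_exp_powr[OF p] g.prob_space_axioms p sets_p_gaussian[OF p]
      by (simp add: E_def cong: measurable_cong_sets)
    have "{x \<in> space (gauss_vec n p). \<exists>i<n. \<bar>x i\<bar> powr p > \<tau>}
        = (\<Union>i<n. {x \<in> space (gauss_vec n p). x i \<in> {x. \<bar>x\<bar> powr p > \<tau>}})" by auto
    also have "measure (gauss_vec n p) \<dots>
        \<le> (\<Sum>i<n. measure (gauss_vec n p) {x \<in> space (gauss_vec n p). x i \<in> {x. \<bar>x\<bar> powr p > \<tau>}})"
      by (intro measure_UNION_le coord_set) auto
    also have "\<dots> = (\<Sum>i<n. measure (p_gaussian p) {x. \<bar>x\<bar> powr p > \<tau>})"
      by (intro sum.cong gauss_vec_component) auto
    also have "\<dots> \<le> (\<Sum>i<n. exp (- (1 / (2 * p)) * \<tau>) * E)"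
      by (intro sum_mono order_trans[OF g.finite_measure_mono tail]) (auto simp: sets_p_gaussian[OF p])
    also have "\<dots> = real n * (exp (- (1 / (2 * p)) * \<tau>) * E)" by simp
    also have "\<dots> \<le> exp (c * sqrt (real n)) * (exp (- (1 / (2 * p)) * \<tau>) * exp (c * sqrt (real n)))"
    proof (intro mult_mono)
      have "exp (ln (real n)) \<le> exp (c * sqrt (real n))" using elim(3) by (simp only: exp_le_cancel_iff)
      then show "real n \<le> exp (c * sqrt (real n))" using n by simp
      show "E \<le> exp (c * sqrt (real n))" using elim(4) by linarith
    qed (auto simp: E_def)
    also have "\<dots> = exp (2 * c * sqrt (real n) - 4 * c * (b n * sqrt (real n)))"
      using p by (simp add: exp_add[symmetric] \<tau>_def c_def)
    also have "\<dots> \<le> exp (- C * (b n)\<^sup>2)"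
    proof -
      have "C * (b n)\<^sup>2 \<le> \<bar>C\<bar> * (b n)\<^sup>2" by (intro mult_right_mono) auto
      also have "\<dots> = (\<bar>C\<bar> * (b n / sqrt (real n))) * (b n * sqrt (real n))"
        using n by (simp add: power2_eq_square)
      also have "\<dots> \<le> c * (b n * sqrt (real n))"
        using elim(1,2) by (intro mult_right_mono) auto
      finally have "C * (b n)\<^sup>2 \<le> c * (b n * sqrt (real n))" .
      moreover have "c * sqrt (real n) \<le> c * (b n * sqrt (real n))" using sb c by (intro mult_left_mono) auto
      moreover have "0 \<le> c * (b n * sqrt (real n))" using c elim(1) by simp
      ultimately have "2 * (c * sqrt (real n)) - 4 * (c * (b n * sqrt (real n))) \<le> - C * (b n)\<^sup>2" by linarith
      then show ?thesis by (simp add: mult.assoc)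
    qed
    finally show ?case by (simp add: \<tau>_def)
  qed
qed

lemma measurable_ratio_dev: "ratio_dev k p b n \<in> borel_measurable (Rn n)"
  unfolding ratio_dev_def[abs_def] by measurable

text \<open>Apart from the null set where a coordinate vanishes,
  \<open>mean_ratio_deviation_bound\<close> applies off three events of superexponentially small
  probability: a large linear sum, a large power sum, or a coordinate with |x i|^p above \<epsilon>
  b_n sqrt n.\<close>

lemma ratio_dev_exp_equivalent:
  assumes "\<delta> > 0"
  shows "superexp_small (\<lambda>n. (b n)\<^sup>2) (\<lambda>n. measure (gauss_vec n p)
    {x \<in> space (gauss_vec n p). \<bar>lin_sum n x - ratio_dev k p b n x\<bar> > \<delta>})"
  unfolding superexp_small_def
proof
  fix C :: real
  interpret L: quadratic_mgf "\<lambda>n. gauss_vec n p" lin_sum "\<lambda>n. (b n)\<^sup>2" "s_sq p" by (rule mgf_lin_sum)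
  interpret P: quadratic_mgf "\<lambda>n. gauss_vec n p" powr_sum "\<lambda>n. (b n)\<^sup>2"
    "\<integral>x. (\<bar>x\<bar> powr p - 1)\<^sup>2 \<partial>p_gaussian p" by (rule mgf_powr_sum)
  \<comment> \<open>Part of the surplus in C + 2 absorbs the factor 3 from the union of three
    events.\<close>
  obtain K1 where K1: "K1 > 0" "\<forall>\<^sub>F n in sequentially. measure (gauss_vec n p)
      {x \<in> space (gauss_vec n p). \<bar>lin_sum n x\<bar> \<ge> K1} \<le> exp (- (C + 2) * (b n)\<^sup>2)"
    using L.exp_tight[of "C + 2"] by auto
  obtain K2 where K2: "K2 > 0" "\<forall>\<^sub>F n in sequentially. measure (gauss_vec n p)
      {x \<in> space (gauss_vec n p). \<bar>powr_sum n x\<bar> \<ge> K2} \<le> exp (- (C + 2) * (b n)\<^sup>2)"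
    using P.exp_tight[of "C + 2"] by auto
  define K where "K = max K1 K2"
  have K: "K > 0" using K1 by (simp add: K_def)
  define d where "d = min \<delta> 1"
  have d: "d > 0" "d \<le> 1" "d \<le> \<delta>" using assms by (auto simp: d_def)
  have d8: "d / 8 > 0" using d by simp
  \<comment> \<open>Error budget: the maximum term takes d / 4, the quadratic and the binomial term
    d / 8 each, the passage from the logarithm to the ratio d / 2; together d \<le>
    \<delta>.\<close>
  define \<epsilon> where "\<epsilon> = d / (16 * real k)"
  have e: "\<epsilon> > 0" "4 * real k * \<epsilon> = d / 4" using d k by (auto simp: \<epsilon>_def)
  define h where "h n = b n / sqrt (real n)" for n
  have h0: "h \<longlonglongrightarrow> 0" using b0 by (simp add: h_def[abs_def])
  have ev: "\<forall>\<^sub>F n in sequentially. c * h n < r" if "r > 0" for c r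
    using order_tendstoD(2)[OF tendsto_mult_right_zero[OF h0, of c] that] .
  have "\<forall>\<^sub>F n in sequentially. b n \<ge> max 1 (2 * real k / (d / 8))" using binf unfolding filterlim_at_top by blast
  moreover have "\<forall>\<^sub>F n in sequentially. n \<ge> max 1 (2 * k)" by (rule eventually_ge_at_top)
  moreover have "\<forall>\<^sub>F n in sequentially. (b n)\<^sup>2 \<ge> ln 3" using sq_b_at_top unfolding filterlim_at_top by blast
  moreover note ev[OF zero_less_one, of "4 * real k * \<epsilon>"] ev[OF half_gt_zero[OF zero_less_one], of K]
    ev[OF zero_less_one, of "K + 1"] ev[OF d8, of "2 * K\<^sup>2"] ev[OF half_gt_zero[OF d(1)], of "2 * (K + 1)\<^sup>2"] K1(2) K2(2)
    max_tail_small[OF e(1), unfolded superexp_small_def, rule_format, of "C + 2"]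
  ultimately show "\<forall>\<^sub>F n in sequentially. measure (gauss_vec n p)
      {x \<in> space (gauss_vec n p). \<bar>lin_sum n x - ratio_dev k p b n x\<bar> > \<delta>} \<le> exp (- C * (b n)\<^sup>2)"
  proof (eventually_elim, goal_cases)
    case (1 n)
    interpret G: prob_space "gauss_vec n p" by (rule prob_space_gauss_vec)
    have n: "real n \<ge> 1" "2 * k \<le> n" "k \<le> n" using 1(2) by auto
    have b1: "b n \<ge> 1" "b n \<ge> 2 * real k / (d / 8)" using 1(1) by auto
    have hn: "h n > 0" using b1 n by (simp add: h_def)
    have hb: "h n * real n = b n * sqrt (real n)" using n by (simp add: h_def field_simps)
    note m[measurable] = L.meas P.meas measurable_ratio_dev
    let ?S = "space (gauss_vec n p)"
    let ?A = "{x \<in> ?S. \<bar>lin_sum n x\<bar> \<ge> K1}" and ?B = "{x \<in> ?S. \<bar>powr_sum n x\<bar> \<ge> K2}"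
      and ?T = "{x \<in> ?S. \<exists>i<n. \<bar>x i\<bar> powr p > \<epsilon> * (b n * sqrt (real n))}"
    have mA: "?A \<in> sets (gauss_vec n p)" "?B \<in> sets (gauss_vec n p)" by measurable
    have mT: "?T \<in> sets (gauss_vec n p)"
    proof -
      have "?T = (\<Union>i<n. {x \<in> ?S. x i \<in> {z. \<bar>z\<bar> powr p > \<epsilon> * (b n * sqrt (real n))}})" by auto
      also have "\<dots> \<in> sets (gauss_vec n p)" by (intro sets.finite_UN coord_set) auto
      finally show ?thesis .
    qed
    have bound: "\<bar>lin_sum n x - ratio_dev k p b n x\<bar> \<le> \<delta>"
      if x: "x \<in> ?S" "x \<notin> ?A" "x \<notin> ?B" "x \<notin> ?T" "\<forall>i<n. x i \<noteq> 0" for x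
    proof -
      have "b n * sqrt (real n) \<ge> 2 * real k / (d / 8) * 1" using b1 n by (intro mult_mono) auto
      then have kn: "2 * real k / (h n * real n) \<le> d / 8"
        using d hn n b1 unfolding hb by (simp add: field_simps)
      have "\<bar>lin_sum n x - (exp (- m_const p) * mean_ratio k n n p x - 1) / h n\<bar> \<le> d / 2 + 2 * (K + 1)\<^sup>2 * h n"
      proof (rule mean_ratio_deviation_bound[OF p k n(2) _ _ less_imp_le[OF e(1)] hn])
        show "x i \<noteq> 0" "\<bar>x i\<bar> powr p \<le> \<epsilon> * (h n * real n)" if "i < n" for i
        proof -
          show "x i \<noteq> 0" using x that by auto
          have "\<not> \<bar>x i\<bar> powr p > \<epsilon> * (b n * sqrt (real n))" using x(1,4) that by blast
          then show "\<bar>x i\<bar> powr p \<le> \<epsilon> * (h n * real n)" unfolding hb by simp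
        qed
        show "4 * real k * \<epsilon> * h n \<le> 1" "K * h n \<le> 1 / 2" "(K + 1) * h n \<le> 1" using 1 by auto
        show "\<bar>(\<Sum>i<n. \<bar>x i\<bar> powr p - 1) / (h n * real n)\<bar> \<le> K" "\<bar>lin_sum n x\<bar> \<le> K"
          using x unfolding hb by (auto simp: K_def powr_sum_def)
        show "lin_sum n x = (\<Sum>i<n. lin_stat p (x i)) / (h n * real n)" unfolding hb by (simp add: lin_sum_def)
        show "2 * K\<^sup>2 * h n + 2 * real k / (h n * real n) + 4 * real k * \<epsilon> \<le> d / 2"
          using kn e(2) 1 by linarith
        show "d / 2 \<le> 1" using d by simp
      qed
      also have "(exp (- m_const p) * mean_ratio k n n p x - 1) / h n = ratio_dev k p b n x"
        by (simp add: ratio_dev_def h_def)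
      finally show ?thesis using 1 d by linarith
    qed
    have "G.prob {x \<in> ?S. \<bar>lin_sum n x - ratio_dev k p b n x\<bar> > \<delta>} \<le> G.prob (?A \<union> ?B \<union> ?T)"
    proof (rule G.finite_measure_mono_AE)
      show "AE x in gauss_vec n p. x \<in> {x \<in> ?S. \<bar>lin_sum n x - ratio_dev k p b n x\<bar> > \<delta>} \<longrightarrow> x \<in> ?A \<union> ?B \<union> ?T"
        using gauss_vec_nonzero
      proof eventually_elim
        case (elim x)
        show ?case
        proof (rule impI, rule ccontr)
          assume a: "x \<in> {x \<in> ?S. \<bar>lin_sum n x - ratio_dev k p b n x\<bar> > \<delta>}"
            and nb: "x \<notin> ?A \<union> ?B \<union> ?T"
          have "x \<in> ?S" using a by (rule CollectE) (rule conjunct1)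
          moreover have "x \<notin> ?A" "x \<notin> ?B" "x \<notin> ?T" using nb by blast+
          ultimately have "\<bar>lin_sum n x - ratio_dev k p b n x\<bar> \<le> \<delta>" using elim by (intro bound)
          moreover have "\<bar>lin_sum n x - ratio_dev k p b n x\<bar> > \<delta>" using a by (rule CollectE) (rule conjunct2)
          ultimately show False by linarith
        qed
      qed
    qed (use mA mT in auto)
    also have "\<dots> \<le> G.prob ?A + G.prob ?B + G.prob ?T"
      using mA mT by (intro order_trans[OF measure_Un_le] add_mono measure_Un_le) auto
    also have "\<dots> \<le> 3 * exp (- (C + 2) * (b n)\<^sup>2)" using 1 by simp
    also have "\<dots> \<le> exp ((b n)\<^sup>2) * exp (- (C + 2) * (b n)\<^sup>2)"
    proof (intro mult_right_mono)
      have "exp (ln 3) \<le> exp ((b n)\<^sup>2)" using 1(3) by (simp only: exp_le_cancel_iff)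
      then show "3 \<le> exp ((b n)\<^sup>2)" by simp
    qed simp
    also have "\<dots> = exp (- (C + 1) * (b n)\<^sup>2)"
      unfolding exp_add[symmetric] by (rule arg_cong[where f = exp]) (simp add: algebra_simps)
    also have "\<dots> \<le> exp (- C * (b n)\<^sup>2)"
      unfolding exp_le_cancel_iff by (rule mult_right_mono) auto
    finally show ?case .
  qed
qed

lemma mod_upper_ratio_dev: "mod_upper (\<lambda>n. gauss_vec n p) (ratio_dev k p b) (\<lambda>n. (b n)\<^sup>2) (s_sq p)"
proof -
  interpret L: quadratic_mgf "\<lambda>n. gauss_vec n p" lin_sum "\<lambda>n. (b n)\<^sup>2" "s_sq p" by (rule mgf_lin_sum)
  show ?thesis
    using measurable_ratio_dev
    by (intro mod_upper_exp_equivalent[OF prob_space_gauss_vec L.meas _ sq_b_at_top s_sq_pos[OF p]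
          L.upper[OF s_sq_pos[OF p]]] ratio_dev_exp_equivalent) (simp cong: measurable_cong_sets)
qed

lemma mod_lower_ratio_dev: "mod_lower (\<lambda>n. gauss_vec n p) (ratio_dev k p b) (\<lambda>n. (b n)\<^sup>2) (s_sq p)"
proof -
  interpret L: quadratic_mgf "\<lambda>n. gauss_vec n p" lin_sum "\<lambda>n. (b n)\<^sup>2" "s_sq p" by (rule mgf_lin_sum)
  show ?thesis
    using measurable_ratio_dev
    by (intro mod_lower_exp_equivalent[OF prob_space_gauss_vec L.meas _ sq_b_at_top s_sq_pos[OF p]
          L.lower[OF s_sq_pos[OF p]]] ratio_dev_exp_equivalent) (simp cong: measurable_cong_sets)
qed

end

section \<open>Cone measure\<close>

lemma lp_norm_nonneg: "lp_norm n p x \<ge> 0"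
  by (simp add: lp_norm_def)

lemma lp_norm_scale: "p \<ge> 1 \<Longrightarrow> c \<ge> 0 \<Longrightarrow> lp_norm n p (scale_vec n c x) = c * lp_norm n p x"
  by (simp add: lp_norm_def scale_vec_def abs_mult powr_mult sum_distrib_left[symmetric] sum_nonneg powr_powr)

lemma lp_norm_powr: "p \<ge> 1 \<Longrightarrow> lp_norm n p x powr p = (\<Sum>i<n. \<bar>x i\<bar> powr p)"
  by (simp add: lp_norm_def powr_powr sum_nonneg)

lemma lp_norm_pos: "p \<ge> 1 \<Longrightarrow> i < n \<Longrightarrow> x i \<noteq> 0 \<Longrightarrow> lp_norm n p x > 0"
proof -
  assume "p \<ge> 1" "i < n" "x i \<noteq> 0"
  then have "0 < \<bar>x i\<bar> powr p" by simp
  also have "\<dots> \<le> (\<Sum>i<n. \<bar>x i\<bar> powr p)" using \<open>i < n\<close> by (intro member_le_sum) auto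
  finally show ?thesis by (simp add: lp_norm_def)
qed

lemma measurable_coord_Rn: "i < n \<Longrightarrow> (\<lambda>x. x i) \<in> borel_measurable (Rn n)"
  by (intro measurable_component_singleton) auto

lemma measurable_lp_norm [measurable]: "lp_norm n p \<in> borel_measurable (Rn n)"
proof -
  have "(\<lambda>x. \<bar>x i\<bar> powr p) \<in> borel_measurable (Rn n)" if "i < n" for i
    using measurable_coord_Rn[OF that] by measurable
  then have "(\<lambda>x. \<Sum>i<n. \<bar>x i\<bar> powr p) \<in> borel_measurable (Rn n)"
    by (intro borel_measurable_sum) auto
  then show ?thesis unfolding lp_norm_def[abs_def] by measurable
qed

lemma scale_vec_space: "scale_vec n c x \<in> space (Rn n)"
  by (simp add: scale_vec_def space_PiM)

lemma scale_vec_scale_vec: "scale_vec n c (scale_vec n d x) = scale_vec n (c * d) x"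
  by (auto simp: scale_vec_def fun_eq_iff)

lemma scale_vec_1: "x \<in> space (Rn n) \<Longrightarrow> scale_vec n 1 x = x"
  by (auto simp: scale_vec_def fun_eq_iff space_PiM PiE_def extensional_def)

lemma measurable_scale_vec [measurable (raw)]:
  assumes "f \<in> borel_measurable M" and "g \<in> M \<rightarrow>\<^sub>M Rn n"
  shows "(\<lambda>x. scale_vec n (f x) (g x)) \<in> M \<rightarrow>\<^sub>M Rn n"
  unfolding scale_vec_def
proof (rule measurable_restrict)
  fix i assume "i \<in> {..<n}"
  then have "(\<lambda>x. g x i) \<in> borel_measurable M"
    using measurable_compose[OF assms(2) measurable_coord_Rn] by auto
  then show "(\<lambda>x. f x * g x i) \<in> borel_measurable M" using assms(1) by measurable
qed

definition normalize_vec :: "nat \<Rightarrow> real \<Rightarrow> (nat \<Rightarrow> real) \<Rightarrow> nat \<Rightarrow> real" where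
  "normalize_vec n p x = scale_vec n (1 / lp_norm n p x) x"

lemma measurable_normalize_vec [measurable]: "normalize_vec n p \<in> Rn n \<rightarrow>\<^sub>M Rn n"
  unfolding normalize_vec_def[abs_def] by measurable

lemma normalize_scale_vec:
  assumes "p \<ge> 1" and "c > 0"
  shows "normalize_vec n p (scale_vec n c x) = normalize_vec n p x"
  using assms by (simp add: normalize_vec_def lp_norm_scale scale_vec_scale_vec)

lemma sets_lebesgue_Rn [measurable_cong]: "sets (lebesgue_Rn n) = sets (Rn n)"
  unfolding lebesgue_Rn_def by (intro sets_PiM_cong) auto

lemma space_lebesgue_Rn: "space (lebesgue_Rn n) = space (Rn n)"
  by (rule sets_eq_imp_space_eq[OF sets_lebesgue_Rn])

text \<open>The open cone over \<open>A\<close>; it omits the origin, which is a null set.\<close>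

definition unit_cone :: "nat \<Rightarrow> real \<Rightarrow> (nat \<Rightarrow> real) set \<Rightarrow> (nat \<Rightarrow> real) set" where
  "unit_cone n p A = {x \<in> space (Rn n). 0 < lp_norm n p x \<and> lp_norm n p x \<le> 1 \<and> normalize_vec n p x \<in> A}"

lemma unit_cone_sets [measurable (raw)]:
  assumes [measurable]: "A \<in> sets (Rn n)"
  shows "unit_cone n p A \<in> sets (Rn n)"
  unfolding unit_cone_def by measurable

lemma emeasure_lebesgue_Rn_scaled:
  assumes "s > 0" and [measurable]: "C \<in> sets (Rn n)"
  shows "emeasure (lebesgue_Rn n) C = ennreal (s ^ n) * emeasure (lebesgue_Rn n) {x \<in> space (Rn n). scale_vec n s x \<in> C}"
proof -
  have m: "{x \<in> space (Rn n). scale_vec n s x \<in> C} \<in> sets (Rn n)" by measurable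
  have "emeasure (lebesgue_Rn n) C = (\<integral>\<^sup>+x. indicator C x \<partial>lebesgue_Rn n)"
    using sets_lebesgue_Rn by simp
  also have "\<dots> = ennreal (\<bar>s\<bar> ^ card {..<n}) * (\<integral>\<^sup>+x. indicator C (\<lambda>i\<in>{..<n}. 0 + s * x i) \<partial>lebesgue_Rn n)"
    unfolding lebesgue_Rn_def using assms sets_lebesgue_Rn[of n]
    by (intro nn_integral_PiM_lborel_affine) (auto simp: lebesgue_Rn_def)
  also have "(\<integral>\<^sup>+x. indicator C (\<lambda>i\<in>{..<n}. 0 + s * x i) \<partial>lebesgue_Rn n)
      = (\<integral>\<^sup>+x. indicator {x \<in> space (Rn n). scale_vec n s x \<in> C} x \<partial>lebesgue_Rn n)"
    by (intro nn_integral_cong) (auto simp: indicator_def scale_vec_def space_lebesgue_Rn)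
  also have "\<dots> = emeasure (lebesgue_Rn n) {x \<in> space (Rn n). scale_vec n s x \<in> C}"
    using m sets_lebesgue_Rn by simp
  finally show ?thesis using assms by simp
qed

text \<open>The integrand is the derivative of - exp (- s^p / p), which tends to 0 at
  infinity.\<close>

lemma exp_powr_layer_cake:
  assumes p: "p \<ge> 1" and u: "u > 0"
  shows "ennreal (exp (- (u powr p / p))) = (\<integral>\<^sup>+s. ennreal (s powr (p - 1) * exp (- (s powr p / p))) * indicator {u..} s \<partial>lborel)"
proof -
  have "(\<integral>\<^sup>+s. ennreal (s powr (p - 1) * exp (- (s powr p / p))) * indicator {u..} s \<partial>lborel)
      = ennreal (0 - (- exp (- (u powr p / p))))"
  proof (rule nn_integral_FTC_atLeast)
    show "((\<lambda>s. - exp (- (s powr p / p))) has_real_derivative s powr (p - 1) * exp (- (s powr p / p))) (at s)" if "u \<le> s" for s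
      using that u p by (auto intro!: derivative_eq_intros simp: powr_diff)
    show "((\<lambda>s. - exp (- (s powr p / p))) \<longlongrightarrow> 0) at_top" using p by real_asymp
  qed auto
  then show ?thesis by simp
qed

context
  fixes p :: real
  assumes p: "p \<ge> 1"
begin

interpretation g: prob_space "p_gaussian p" by (rule prob_space_p_gaussian[OF p])

lemma gauss_vec_density:
  "gauss_vec n p = density (lebesgue_Rn n) (\<lambda>x. \<Prod>i<n. ennreal (1 / (2 * p powr (1 / p) * Gamma (1 + 1 / p)) * exp (- (\<bar>x i\<bar> powr p) / p)))"
proof -
  define f where "f = (\<lambda>x. 1 / (2 * p powr (1 / p) * Gamma (1 + 1 / p)) * exp (- (\<bar>x\<bar> powr p) / p))"
  interpret G: product_sigma_finite "\<lambda>_::nat. p_gaussian p"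
    by (simp add: product_sigma_finite_def g.sigma_finite_measure_axioms)
  interpret L: product_sigma_finite "\<lambda>_::nat. lborel :: real measure" by (rule product_sigma_finite_lborel)
  have [measurable]: "f \<in> borel_measurable borel" unfolding f_def by measurable
  have mf: "(\<lambda>x. ennreal (f (x i))) \<in> borel_measurable (lebesgue_Rn n)" if "i < n" for i
  proof -
    have "(\<lambda>x. x i) \<in> borel_measurable (lebesgue_Rn n)"
      using measurable_coord_Rn[OF that] by (simp cong: measurable_cong_sets)
    then show ?thesis by measurable
  qed
  have mp: "(\<lambda>x. \<Prod>i<n. ennreal (f (x i))) \<in> borel_measurable (lebesgue_Rn n)"
    using mf by (intro borel_measurable_prod_ennreal) auto
  have "density (lebesgue_Rn n) (\<lambda>x. \<Prod>i<n. ennreal (f (x i))) = PiM {..<n} (\<lambda>_. p_gaussian p)"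
  proof (rule G.PiM_eqI)
    show "sets (density (lebesgue_Rn n) (\<lambda>x. \<Prod>i<n. ennreal (f (x i)))) = sets (PiM {..<n} (\<lambda>_. p_gaussian p))"
      by (simp add: sets_lebesgue_Rn) (intro sets_PiM_cong refl sets_p_gaussian[OF p, symmetric])
    fix A assume A: "\<And>i. i \<in> {..<n} \<Longrightarrow> A i \<in> sets (p_gaussian p)"
    then have A': "i < n \<Longrightarrow> A i \<in> sets borel" for i using sets_p_gaussian[OF p] by auto
    have PA: "Pi\<^sub>E {..<n} A \<in> sets (lebesgue_Rn n)" unfolding sets_lebesgue_Rn using A' by (intro sets_PiM_I_finite) auto
    have "emeasure (density (lebesgue_Rn n) (\<lambda>x. \<Prod>i<n. ennreal (f (x i)))) (Pi\<^sub>E {..<n} A)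
        = (\<integral>\<^sup>+x. (\<Prod>i<n. ennreal (f (x i))) * indicator (Pi\<^sub>E {..<n} A) x \<partial>lebesgue_Rn n)"
      using mp PA by (intro emeasure_density) auto
    also have "\<dots> = (\<integral>\<^sup>+x. (\<Prod>i<n. ennreal (f (x i)) * indicator (A i) (x i)) \<partial>lebesgue_Rn n)"
    proof (intro nn_integral_cong)
      fix x assume "x \<in> space (lebesgue_Rn n)"
      then have "x \<in> extensional {..<n}" by (auto simp: space_lebesgue_Rn space_PiM PiE_def)
      then have "indicator (Pi\<^sub>E {..<n} A) x = (\<Prod>i<n. indicator (A i) (x i) :: ennreal)"
        by (auto simp: indicator_def PiE_def Pi_def prod_zero_iff intro!: prod.neutral[symmetric])
      then show "(\<Prod>i<n. ennreal (f (x i))) * indicator (Pi\<^sub>E {..<n} A) x = (\<Prod>i<n. ennreal (f (x i)) * indicator (A i) (x i))"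
        by (simp add: prod.distrib)
    qed
    also have "\<dots> = (\<Prod>i<n. \<integral>\<^sup>+x. ennreal (f x) * indicator (A i) x \<partial>lborel)"
      unfolding lebesgue_Rn_def using A' by (intro L.product_nn_integral_prod) auto
    also have "\<dots> = (\<Prod>i<n. emeasure (p_gaussian p) (A i))"
    proof -
      have "p_gaussian p = density lborel (\<lambda>x. ennreal (f x))" by (simp add: p_gaussian_def f_def)
      then show ?thesis using A' by (intro prod.cong refl) (simp add: emeasure_density)
    qed
    finally show "emeasure (density (lebesgue_Rn n) (\<lambda>x. \<Prod>i<n. ennreal (f (x i)))) (Pi\<^sub>E {..<n} A)
      = (\<Prod>i<n. emeasure (p_gaussian p) (A i))" .
  qed simp
  then show ?thesis by (simp add: gauss_vec_def f_def)
qed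

lemmas [measurable_cong] = sets_gauss[OF p]

lemma origin_sets: "{\<lambda>i\<in>{..<n}. 0 :: real} \<in> sets (Rn n)"
proof -
  have eq: "{\<lambda>i\<in>{..<n}. 0} = (\<Pi>\<^sub>E i\<in>{..<n}. {0::real})" by (auto simp: PiE_def fun_eq_iff extensional_def)
  show ?thesis unfolding eq by (rule sets_PiM_I_finite) auto
qed

lemma lebesgue_Rn_origin:
  assumes "n \<ge> 1" shows "emeasure (lebesgue_Rn n) {\<lambda>i\<in>{..<n}. 0} = 0"
proof -
  interpret L: product_sigma_finite "\<lambda>_::nat. lborel :: real measure" by (rule product_sigma_finite_lborel)
  have "{\<lambda>i\<in>{..<n}. 0} = (\<Pi>\<^sub>E i\<in>{..<n}. {0::real})" by (auto simp: PiE_def fun_eq_iff extensional_def)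
  also have "emeasure (lebesgue_Rn n) \<dots> = (\<Prod>i<n. emeasure lborel {0::real})"
    unfolding lebesgue_Rn_def by (intro L.emeasure_PiM) auto
  also have "\<dots> = 0" using assms by simp
  finally show ?thesis .
qed

lemma lp_norm_zero_iff:
  assumes "x \<in> space (Rn n)" shows "lp_norm n p x = 0 \<longleftrightarrow> x = (\<lambda>i\<in>{..<n}. 0)"
proof
  assume 0: "lp_norm n p x = 0"
  then have "x i = 0" if "i < n" for i using lp_norm_pos[OF p that, of x] by auto
  then show "x = (\<lambda>i\<in>{..<n}. 0)" using assms by (auto simp: fun_eq_iff space_PiM PiE_def extensional_def)
qed (use p in \<open>simp add: lp_norm_def\<close>)

text \<open>
  The density of \<open>gauss_vec\<close> is a function of the norm, hence a mixture of indicator functions of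
  balls; on each ball the direction is distributed according to the cone measure.
\<close>

lemma gauss_vec_normalize:
  assumes "n \<ge> 1"
  obtains K where "\<And>A. A \<in> sets (Rn n) \<Longrightarrow>
    emeasure (gauss_vec n p) {x \<in> space (Rn n). normalize_vec n p x \<in> A} = K * emeasure (lebesgue_Rn n) (unit_cone n p A)"
proof -
  define c where "c = 1 / (2 * p powr (1 / p) * Gamma (1 + 1 / p))"
  define w where "w s = ennreal (s powr (p - 1) * exp (- (s powr p / p)))" for s
  have [measurable]: "w \<in> borel_measurable borel" unfolding w_def by measurable
  have "Gamma (1 + 1 / p) > 0" using p by (intro Gamma_real_pos add_pos_pos) auto
  then have c: "c \<ge> 0" using p by (simp add: c_def)
  interpret L: product_sigma_finite "\<lambda>_::nat. lborel :: real measure" by (rule product_sigma_finite_lborel)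
  interpret lb: sigma_finite_measure "lebesgue_Rn n" unfolding lebesgue_Rn_def by (rule L.sigma_finite) simp
  interpret pair_sigma_finite "lebesgue_Rn n" "lborel :: real measure" ..
  \<comment> \<open>The integral collects the weights of the balls of radius s, with s ^ n from the
    scaling of volume. Its value is left open here and is determined later by total mass.\<close>
  define K where "K = ennreal (c ^ n) * (\<integral>\<^sup>+s. w s * ennreal (s ^ n) * indicator {0<..} s \<partial>lborel)"
  have "emeasure (gauss_vec n p) {x \<in> space (Rn n). normalize_vec n p x \<in> A} = K * emeasure (lebesgue_Rn n) (unit_cone n p A)"
    if A[measurable]: "A \<in> sets (Rn n)" for A
  proof -
    define B where "B = {x \<in> space (Rn n). normalize_vec n p x \<in> A}"
    have B[measurable]: "B \<in> sets (Rn n)" unfolding B_def by measurable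
    have dens: "(\<Prod>i<n. ennreal (c * exp (- (\<bar>x i\<bar> powr p) / p))) = ennreal (c ^ n) * ennreal (exp (- (lp_norm n p x powr p / p)))" for x
    proof -
      have "(\<Prod>i<n. ennreal (c * exp (- (\<bar>x i\<bar> powr p) / p))) = ennreal (\<Prod>i<n. c * exp (- (\<bar>x i\<bar> powr p) / p))"
        using c by (intro prod_ennreal) auto
      also have "(\<Prod>i<n. c * exp (- (\<bar>x i\<bar> powr p) / p)) = c ^ n * exp (\<Sum>i<n. - (\<bar>x i\<bar> powr p) / p)"
        by (simp add: prod.distrib exp_sum)
      also have "(\<Sum>i<n. - (\<bar>x i\<bar> powr p) / p) = - (lp_norm n p x powr p / p)"
        using p by (simp add: lp_norm_powr sum_negf sum_divide_distrib)
      finally show ?thesis using c by (simp add: ennreal_mult)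
    qed
    have nz: "AE x in lebesgue_Rn n. lp_norm n p x > 0"
    proof (rule AE_I[of _ _ "{\<lambda>i\<in>{..<n}. 0}"])
      show "{x \<in> space (lebesgue_Rn n). \<not> lp_norm n p x > 0} \<subseteq> {\<lambda>i\<in>{..<n}. 0}"
      proof
        fix x assume "x \<in> {x \<in> space (lebesgue_Rn n). \<not> lp_norm n p x > 0}"
        then have "x \<in> space (Rn n)" "lp_norm n p x = 0"
          using lp_norm_nonneg[of n p x] by (auto simp: space_lebesgue_Rn)
        then show "x \<in> {\<lambda>i\<in>{..<n}. 0}" using lp_norm_zero_iff by simp
      qed
      show "{\<lambda>i\<in>{..<n}. 0} \<in> sets (lebesgue_Rn n)" unfolding sets_lebesgue_Rn by (rule origin_sets)
    qed (rule lebesgue_Rn_origin[OF assms])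
    have mp: "(\<lambda>x. \<Prod>i<n. ennreal (c * exp (- (\<bar>x i\<bar> powr p) / p))) \<in> borel_measurable (lebesgue_Rn n)"
      unfolding dens by measurable
    have "emeasure (gauss_vec n p) B = (\<integral>\<^sup>+x. (\<Prod>i<n. ennreal (c * exp (- (\<bar>x i\<bar> powr p) / p))) * indicator B x \<partial>lebesgue_Rn n)"
      unfolding gauss_vec_density c_def[symmetric] using mp sets_lebesgue_Rn by (intro emeasure_density) auto
    also have "\<dots> = (\<integral>\<^sup>+x. ennreal (c ^ n) * (\<integral>\<^sup>+s. w s * indicator {0<..} s * indicator {x \<in> B. 0 < lp_norm n p x \<and> lp_norm n p x \<le> s} x \<partial>lborel) \<partial>lebesgue_Rn n)"
    proof (rule nn_integral_cong_AE)
      show "AE x in lebesgue_Rn n. (\<Prod>i<n. ennreal (c * exp (- (\<bar>x i\<bar> powr p) / p))) * indicator B x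
        = ennreal (c ^ n) * (\<integral>\<^sup>+s. w s * indicator {0<..} s * indicator {x \<in> B. 0 < lp_norm n p x \<and> lp_norm n p x \<le> s} x \<partial>lborel)"
        using nz
      proof eventually_elim
        case (elim x)
        have "(\<integral>\<^sup>+s. w s * indicator {0<..} s * indicator {x \<in> B. 0 < lp_norm n p x \<and> lp_norm n p x \<le> s} x \<partial>lborel)
            = (\<integral>\<^sup>+s. w s * indicator {lp_norm n p x..} s * indicator B x \<partial>lborel)"
          using elim by (intro nn_integral_cong) (auto simp: indicator_def)
        also have "\<dots> = ennreal (exp (- (lp_norm n p x powr p / p))) * indicator B x"
          unfolding exp_powr_layer_cake[OF p elim] w_def by (intro nn_integral_multc) auto
        finally show ?case unfolding dens by (simp add: mult.assoc)
      qed
    qed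
    also have "\<dots> = ennreal (c ^ n) * (\<integral>\<^sup>+x. \<integral>\<^sup>+s. w s * indicator {0<..} s * indicator {x \<in> B. 0 < lp_norm n p x \<and> lp_norm n p x \<le> s} x \<partial>lborel \<partial>lebesgue_Rn n)"
      by (intro nn_integral_cmult) measurable
    also have "(\<integral>\<^sup>+x. \<integral>\<^sup>+s. w s * indicator {0<..} s * indicator {x \<in> B. 0 < lp_norm n p x \<and> lp_norm n p x \<le> s} x \<partial>lborel \<partial>lebesgue_Rn n)
        = (\<integral>\<^sup>+s. \<integral>\<^sup>+x. w s * indicator {0<..} s * indicator {x \<in> B. 0 < lp_norm n p x \<and> lp_norm n p x \<le> s} x \<partial>lebesgue_Rn n \<partial>lborel)"
      by (intro Fubini'[symmetric]) measurable
    also have "\<dots> = (\<integral>\<^sup>+s. w s * ennreal (s ^ n) * indicator {0<..} s * emeasure (lebesgue_Rn n) (unit_cone n p A) \<partial>lborel)"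
    proof (intro nn_integral_cong)
      fix s :: real
      let ?C = "{x \<in> B. 0 < lp_norm n p x \<and> lp_norm n p x \<le> s}"
      have Ceq: "?C = {x \<in> space (Rn n). x \<in> B \<and> 0 < lp_norm n p x \<and> lp_norm n p x \<le> s}" by (auto simp: B_def)
      have C: "?C \<in> sets (Rn n)" unfolding Ceq by measurable
      have "(\<integral>\<^sup>+x. w s * indicator {0<..} s * indicator ?C x \<partial>lebesgue_Rn n) = w s * indicator {0<..} s * emeasure (lebesgue_Rn n) ?C"
        using C sets_lebesgue_Rn by (simp add: nn_integral_cmult)
      also have "\<dots> = w s * ennreal (s ^ n) * indicator {0<..} s * emeasure (lebesgue_Rn n) (unit_cone n p A)"
      proof (cases "s > 0")
        case True
        \<comment> \<open>\<open>normalize_vec\<close> is scale invariant, so dilation by s carries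
          the cone of radius 1 onto the one of radius s.\<close>
        have "{x \<in> space (Rn n). scale_vec n s x \<in> ?C} = unit_cone n p A"
          using True p by (auto simp: unit_cone_def B_def scale_vec_space lp_norm_scale normalize_scale_vec zero_less_mult_iff mult_le_cancel_left1)
        then show ?thesis using emeasure_lebesgue_Rn_scaled[OF True C] True by (simp add: mult.assoc)
      qed simp
      finally show "(\<integral>\<^sup>+x. w s * indicator {0<..} s * indicator ?C x \<partial>lebesgue_Rn n)
        = w s * ennreal (s ^ n) * indicator {0<..} s * emeasure (lebesgue_Rn n) (unit_cone n p A)" .
    qed
    also have "\<dots> = (\<integral>\<^sup>+s. w s * ennreal (s ^ n) * indicator {0<..} s \<partial>lborel) * emeasure (lebesgue_Rn n) (unit_cone n p A)"
      by (intro nn_integral_multc) measurable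
    finally show ?thesis unfolding B_def K_def by (simp add: mult.assoc)
  qed
  then show ?thesis using that by blast
qed

text \<open>The two cones differ at most by the origin, which belongs to the closed one exactly when
  A meets the sphere.\<close>

lemma cone_set_emeasure:
  assumes "n \<ge> 1" and A: "A \<in> sets (Rn n)"
  shows "emeasure (lebesgue_Rn n) {scale_vec n r a | r a. r \<in> {0..1} \<and> a \<in> A \<inter> lp_sphere n p}
    = emeasure (lebesgue_Rn n) (unit_cone n p A)"
proof -
  let ?O = "if A \<inter> lp_sphere n p = {} then {} else {\<lambda>i\<in>{..<n}. 0 :: real}"
  let ?T = "{scale_vec n r a | r a. r \<in> {0..1} \<and> a \<in> A \<inter> lp_sphere n p}"
  have "?T = unit_cone n p A \<union> ?O"
  proof (intro equalityI subsetI)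
    fix x assume "x \<in> ?T"
    then obtain r a where ra: "x = scale_vec n r a" "r \<in> {0..1}" "a \<in> A" "a \<in> lp_sphere n p" by auto
    show "x \<in> unit_cone n p A \<union> ?O"
    proof (cases "r = 0")
      case True
      then have "x = (\<lambda>i\<in>{..<n}. 0)" using ra by (auto simp: scale_vec_def)
      then show ?thesis using ra by auto
    next
      case False
      then have "r > 0" "r \<le> 1" using ra by auto
      moreover have "lp_norm n p a = 1" "a \<in> space (Rn n)" using ra by (auto simp: lp_sphere_def)
      moreover from this have "normalize_vec n p a = a" by (simp add: normalize_vec_def scale_vec_1)
      ultimately have "x \<in> unit_cone n p A"
        using ra p by (simp add: unit_cone_def scale_vec_space lp_norm_scale normalize_scale_vec)
      then show ?thesis by simp
    qed
  next
    fix x assume x: "x \<in> unit_cone n p A \<union> ?O"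
    show "x \<in> ?T"
    proof (cases "x \<in> unit_cone n p A")
      case True
      then have u: "x \<in> space (Rn n)" "0 < lp_norm n p x" "lp_norm n p x \<le> 1" "normalize_vec n p x \<in> A"
        by (auto simp: unit_cone_def)
      have "lp_norm n p (normalize_vec n p x) = 1"
        using u p by (simp add: normalize_vec_def lp_norm_scale)
      then have "normalize_vec n p x \<in> lp_sphere n p"
        by (simp add: lp_sphere_def normalize_vec_def scale_vec_space)
      moreover have "x = scale_vec n (lp_norm n p x) (normalize_vec n p x)"
        using u by (simp add: normalize_vec_def scale_vec_scale_vec scale_vec_1)
      ultimately show ?thesis using u by (intro CollectI exI[of _ "lp_norm n p x"] exI[of _ "normalize_vec n p x"]) auto
    next
      case False
      then have "A \<inter> lp_sphere n p \<noteq> {}" "x = (\<lambda>i\<in>{..<n}. 0)" using x by (auto split: if_splits)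
      moreover have "scale_vec n 0 a = (\<lambda>i\<in>{..<n}. 0)" for a by (auto simp: scale_vec_def)
      ultimately show ?thesis by (auto intro!: exI[of _ "0::real"])
    qed
  qed
  moreover have "?O \<in> sets (lebesgue_Rn n)" "emeasure (lebesgue_Rn n) ?O = 0"
  proof -
    show "?O \<in> sets (lebesgue_Rn n)" unfolding sets_lebesgue_Rn using origin_sets by simp
    show "emeasure (lebesgue_Rn n) ?O = 0" using lebesgue_Rn_origin[OF assms(1)] by simp
  qed
  moreover have "unit_cone n p A \<in> sets (lebesgue_Rn n)" using A sets_lebesgue_Rn by simp
  ultimately show ?thesis by (simp add: emeasure_Un_null_set null_sets_def)
qed

lemma lp_ball_emeasure:
  assumes "n \<ge> 1"
  shows "emeasure (lebesgue_Rn n) (lp_ball n p) = emeasure (lebesgue_Rn n) (unit_cone n p (space (Rn n)))"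
proof -
  have nv: "normalize_vec n p x \<in> space (Rn n)" for x by (simp add: normalize_vec_def scale_vec_space)
  have "lp_norm n p (\<lambda>i\<in>{..<n}. 0) = 0" using p by (simp add: lp_norm_def)
  moreover have "(\<lambda>i\<in>{..<n}. 0::real) \<in> space (Rn n)" by (simp add: space_PiM)
  ultimately have "lp_ball n p = unit_cone n p (space (Rn n)) \<union> {\<lambda>i\<in>{..<n}. 0}"
    using lp_norm_nonneg[of n p] by (auto simp: lp_ball_def unit_cone_def nv lp_norm_zero_iff[symmetric] less_le)
  moreover have "{\<lambda>i\<in>{..<n}. 0} \<in> null_sets (lebesgue_Rn n)"
    using lebesgue_Rn_origin[OF assms] origin_sets by (simp add: null_sets_def sets_lebesgue_Rn)
  moreover have "unit_cone n p (space (Rn n)) \<in> sets (lebesgue_Rn n)" using sets_lebesgue_Rn by simp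
  ultimately show ?thesis by (simp only: emeasure_Un_null_set)
qed

text \<open>The constant of \<open>gauss_vec_normalize\<close> is found by taking A to be the whole
  space. The resulting equation K * L = 1 also shows that the volume L of the ball is neither 0 nor
  infinite.\<close>

lemma emeasure_gauss_normalize:
  assumes "n \<ge> 1" and A: "A \<in> sets (Rn n)"
  shows "emeasure (distr (gauss_vec n p) (Rn n) (normalize_vec n p)) A
    = emeasure (lebesgue_Rn n) (unit_cone n p A) / emeasure (lebesgue_Rn n) (unit_cone n p (space (Rn n)))"
proof -
  interpret G: prob_space "gauss_vec n p" by (rule prob_space_gauss[OF p])
  obtain K where K: "\<And>A. A \<in> sets (Rn n) \<Longrightarrow>
    emeasure (gauss_vec n p) {x \<in> space (Rn n). normalize_vec n p x \<in> A} = K * emeasure (lebesgue_Rn n) (unit_cone n p A)"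
    using gauss_vec_normalize[OF assms(1)] by blast
  let ?L = "emeasure (lebesgue_Rn n) (unit_cone n p (space (Rn n)))"
  have "normalize_vec n p x \<in> space (Rn n)" for x by (simp add: normalize_vec_def scale_vec_space)
  then have 1: "K * ?L = 1" using K[of "space (Rn n)"] G.emeasure_space_1 by (simp add: space_gauss[OF p])
  then have L: "?L \<noteq> 0" "?L \<noteq> \<top>" "K \<noteq> \<top>" by (auto simp: ennreal_mult_top ennreal_top_mult split: if_splits)
  have "K = K * (?L / ?L)" using L by (simp add: ennreal_divide_self less_top)
  also have "\<dots> = 1 / ?L" using 1 by (simp add: ennreal_times_divide)
  finally have K1: "K = 1 / ?L" .
  have "emeasure (distr (gauss_vec n p) (Rn n) (normalize_vec n p)) A = K * emeasure (lebesgue_Rn n) (unit_cone n p A)"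
    using A K[OF A] by (subst emeasure_distr) (auto simp: space_gauss[OF p] vimage_def Int_def conj_commute cong: measurable_cong_sets)
  then show ?thesis unfolding K1 by (simp add: divide_ennreal_def mult.commute)
qed

text \<open>Equality of the set functions on the sigma-algebra is enough. In particular the defining
  set function is countably additive, so \<open>measure_of\<close> does not fall back to the zero
  measure.\<close>

lemma cone_measure_eq:
  assumes "n \<ge> 1"
  shows "cone_measure n p = distr (gauss_vec n p) (Rn n) (normalize_vec n p)" (is "_ = ?D")
proof -
  have "cone_measure n p = measure_of (space (Rn n)) (sets (Rn n)) (emeasure ?D)"
    unfolding cone_measure_def
  proof (rule measure_of_eq[OF sets.space_closed])
    fix A assume "A \<in> sigma_sets (space (Rn n)) (sets (Rn n))"
    then have A: "A \<in> sets (Rn n)" by (simp add: sets.sigma_sets_eq)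
    show "emeasure (lebesgue_Rn n) {scale_vec n r a | r a. r \<in> {0..1} \<and> a \<in> A \<inter> lp_sphere n p}
        / emeasure (lebesgue_Rn n) (lp_ball n p) = emeasure ?D A"
      by (simp only: cone_set_emeasure[OF assms A] lp_ball_emeasure[OF assms] emeasure_gauss_normalize[OF assms A])
  qed
  also have "\<dots> = measure_of (space ?D) (sets ?D) (emeasure ?D)" by simp
  also have "\<dots> = ?D" by (rule measure_of_of_measure)
  finally show ?thesis .
qed

section \<open>Scale invariance of the ratio and the laws of case (i)\<close>

lemma sym_mean_scale:
  assumes "k \<ge> 1" "c > 0"
  shows "sym_mean k n p (scale_vec n c x) = c * sym_mean k n p x"
proof -
  have "(\<Prod>i\<in>I. \<bar>scale_vec n c x i\<bar> powr p) = c powr (real k * p) * (\<Prod>i\<in>I. \<bar>x i\<bar> powr p)"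
    if "I \<subseteq> {..<n}" "card I = k" for I
  proof -
    have "(\<Prod>i\<in>I. \<bar>scale_vec n c x i\<bar> powr p) = (\<Prod>i\<in>I. c powr p * \<bar>x i\<bar> powr p)"
      using that assms by (intro prod.cong) (auto simp: scale_vec_def abs_mult powr_mult)
    also have "\<dots> = (c powr p) ^ k * (\<Prod>i\<in>I. \<bar>x i\<bar> powr p)" using that by (simp add: prod.distrib)
    also have "(c powr p) ^ k = c powr (real k * p)" using assms by (simp add: powr_realpow[symmetric] powr_powr mult.commute)
    finally show ?thesis .
  qed
  then have "(\<Sum>I | I \<subseteq> {..<n} \<and> card I = k. \<Prod>i\<in>I. \<bar>scale_vec n c x i\<bar> powr p)
      = c powr (real k * p) * (\<Sum>I | I \<subseteq> {..<n} \<and> card I = k. \<Prod>i\<in>I. \<bar>x i\<bar> powr p)"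
    by (simp add: sum_distrib_left)
  then have "sym_mean k n p (scale_vec n c x)
      = (c powr (real k * p) * ((\<Sum>I | I \<subseteq> {..<n} \<and> card I = k. \<Prod>i\<in>I. \<bar>x i\<bar> powr p) / real (n choose k))) powr (1 / (real k * p))"
    by (simp add: sym_mean_def)
  also have "\<dots> = c * sym_mean k n p x"
    using assms p by (subst powr_mult) (auto simp: sym_mean_def powr_powr intro!: divide_nonneg_nonneg sum_nonneg prod_nonneg)
  finally show ?thesis .
qed

lemma ratio_dev_scale:
  assumes "k \<ge> 1" "n \<ge> 1" "c > 0"
  shows "ratio_dev k p b n (scale_vec n c x) = ratio_dev k p b n x"
  using assms by (simp add: ratio_dev_def mean_ratio_def sym_mean_scale)

lemma gauss_lp_norm_pos: "n \<ge> 1 \<Longrightarrow> AE x in gauss_vec n p. lp_norm n p x > 0"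
proof -
  assume n: "n \<ge> 1"
  note s = origin_sets[of n]
  have "absolutely_continuous (lebesgue_Rn n) (gauss_vec n p)"
    unfolding gauss_vec_density
    by (intro absolutely_continuousI_density borel_measurable_prod_ennreal)
      (auto intro!: measurable_compose[OF measurable_coord_Rn, of _ n] simp: measurable_cong_sets[OF sets_lebesgue_Rn refl])
  then have "{\<lambda>i\<in>{..<n}. 0} \<in> null_sets (gauss_vec n p)"
    using lebesgue_Rn_origin[OF n] s sets_lebesgue_Rn by (auto simp: absolutely_continuous_def null_sets_def)
  then have "AE x in gauss_vec n p. x \<notin> {\<lambda>i\<in>{..<n}. 0}" by (rule AE_not_in)
  moreover have "AE x in gauss_vec n p. x \<in> space (Rn n)" using AE_space[of "gauss_vec n p"] by (simp add: space_gauss[OF p])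
  ultimately show ?thesis
    by eventually_elim (use lp_norm_nonneg[of n p] in \<open>auto simp: lp_norm_zero_iff[symmetric] less_le\<close>)
qed

lemma ratio_dev_cone:
  assumes "k \<ge> 1" "n \<ge> 1" and [measurable]: "A \<in> sets borel"
  shows "measure (cone_measure n p) {x \<in> space (Rn n). ratio_dev k p b n x \<in> A}
    = measure (gauss_vec n p) {x \<in> space (Rn n). ratio_dev k p b n x \<in> A}"
proof -
  have [measurable]: "ratio_dev k p b n \<in> borel_measurable (Rn n)" unfolding ratio_dev_def[abs_def] by measurable
  have "measure (cone_measure n p) {x \<in> space (Rn n). ratio_dev k p b n x \<in> A}
    = measure (gauss_vec n p) {x \<in> space (Rn n). ratio_dev k p b n (normalize_vec n p x) \<in> A}"
    unfolding cone_measure_eq[OF assms(2)]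
    by (subst measure_distr)
      (auto simp: space_gauss[OF p] normalize_vec_def scale_vec_space intro!: arg_cong[where f = "measure _"] cong: measurable_cong_sets)
  also have "\<dots> = measure (gauss_vec n p) {x \<in> space (Rn n). ratio_dev k p b n x \<in> A}"
  proof (rule measure_eq_AE)
    show "AE x in gauss_vec n p. x \<in> {x \<in> space (Rn n). ratio_dev k p b n (normalize_vec n p x) \<in> A}
        \<longleftrightarrow> x \<in> {x \<in> space (Rn n). ratio_dev k p b n x \<in> A}"
      using gauss_lp_norm_pos[OF assms(2)]
      by eventually_elim (auto simp: normalize_vec_def ratio_dev_scale[OF assms(1,2)])
  qed (unfold sets_gauss[OF p], measurable)
  finally show ?thesis .
qed

text \<open>By Fubini R may be held at a fixed value r. For r > 0 scale invariance removes it, and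
  the remaining r form a null set.\<close>

lemma ratio_dev_radial:
  assumes "k \<ge> 1" "n \<ge> 1" and [measurable]: "A \<in> sets borel"
    and "prob_space N" and [measurable]: "R \<in> borel_measurable N" and pos: "AE \<omega> in N. R \<omega> > 0"
  shows "measure (radial_law n p N R) {x \<in> space (Rn n). ratio_dev k p b n x \<in> A}
    = measure (gauss_vec n p) {x \<in> space (Rn n). ratio_dev k p b n x \<in> A}"
proof -
  interpret N: prob_space N by fact
  interpret G: prob_space "gauss_vec n p" by (rule prob_space_gauss[OF p])
  have ps: "prob_space (cone_measure n p)"
    unfolding cone_measure_eq[OF assms(2)] by (intro G.prob_space_distr) (simp cong: measurable_cong_sets)
  interpret C: prob_space "cone_measure n p" by fact
  interpret D: prob_space "distr N borel R" by (intro N.prob_space_distr) simp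
  interpret P: pair_sigma_finite "distr N borel R" "cone_measure n p" ..
  have sc[measurable_cong]: "sets (cone_measure n p) = sets (Rn n)" unfolding cone_measure_eq[OF assms(2)] by simp
  have [measurable]: "ratio_dev k p b n \<in> borel_measurable (Rn n)" unfolding ratio_dev_def[abs_def] by measurable
  define B where "B = {x \<in> space (Rn n). ratio_dev k p b n x \<in> A}"
  have B[measurable]: "B \<in> sets (Rn n)" unfolding B_def by measurable
  have spC: "space (cone_measure n p) = space (Rn n)" by (rule sets_eq_imp_space_eq[OF sc])
  have "emeasure (radial_law n p N R) B = (\<integral>\<^sup>+z. indicator B z \<partial>radial_law n p N R)"
    by (simp add: radial_law_def)
  also have "\<dots> = (\<integral>\<^sup>+z. indicator B ((\<lambda>(r, \<theta>). scale_vec n r \<theta>) z) \<partial>(distr N borel R \<Otimes>\<^sub>M cone_measure n p))"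
    unfolding radial_law_def by (intro nn_integral_distr) measurable
  also have "\<dots> = (\<integral>\<^sup>+r. \<integral>\<^sup>+\<theta>. indicator B (scale_vec n r \<theta>) \<partial>cone_measure n p \<partial>distr N borel R)"
    by (subst C.nn_integral_fst[symmetric]) (auto simp: split_beta')
  also have "\<dots> = (\<integral>\<^sup>+r. emeasure (cone_measure n p) B \<partial>distr N borel R)"
  proof (rule nn_integral_cong_AE)
    have "AE r in distr N borel R. r > 0" using pos by (subst AE_distr_iff) auto
    then show "AE r in distr N borel R. (\<integral>\<^sup>+\<theta>. indicator B (scale_vec n r \<theta>) \<partial>cone_measure n p) = emeasure (cone_measure n p) B"
    proof eventually_elim
      case (elim r)
      have "(\<integral>\<^sup>+\<theta>. indicator B (scale_vec n r \<theta>) \<partial>cone_measure n p) = (\<integral>\<^sup>+\<theta>. indicator B \<theta> \<partial>cone_measure n p)"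
        by (intro nn_integral_cong)
          (auto simp: indicator_def B_def ratio_dev_scale[OF assms(1,2) elim] scale_vec_space spC)
      then show ?case using B sc by simp
    qed
  qed
  also have "\<dots> = emeasure (cone_measure n p) B" using D.emeasure_space_1 by simp
  finally have "measure (radial_law n p N R) B = measure (cone_measure n p) B" by (simp add: measure_def)
  then show ?thesis using ratio_dev_cone[OF assms(1-3)] by (simp add: B_def)
qed

end

section \<open>Surface measure\<close>

lemma powr_diff_le:
  fixes u w a p :: real
  assumes "p \<ge> 1" "0 \<le> u" "u \<le> a" "0 \<le> w" "w \<le> a"
  shows "\<bar>w powr p - u powr p\<bar> \<le> p * a powr (p - 1) * \<bar>w - u\<bar>"
proof -
  have *: "w powr p - u powr p \<le> p * a powr (p - 1) * (w - u)" if "0 \<le> u" "u < w" "w \<le> a" for u w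
  proof (cases "u = 0")
    \<comment> \<open>The mean value theorem is applied only for u > 0; at 0 the factorisation of
      w^p into w^(p-1) and w takes its place.\<close>
    case True
    have "w powr p = w powr (p - 1) * w" using that True by (simp add: powr_mult_base[symmetric] powr_diff)
    also have "\<dots> \<le> (p * a powr (p - 1)) * w"
    proof (intro mult_right_mono)
      have "w powr (p - 1) \<le> a powr (p - 1)" using that \<open>p \<ge> 1\<close> by (intro powr_mono2) auto
      also have "\<dots> \<le> p * a powr (p - 1)" using \<open>p \<ge> 1\<close> by (simp add: mult_le_cancel_right1)
      finally show "w powr (p - 1) \<le> p * a powr (p - 1)" .
    qed (use that in auto)
    finally show ?thesis using True \<open>p \<ge> 1\<close> by simp
  next
    case False
    have "\<exists>z. u < z \<and> z < w \<and> w powr p - u powr p = (w - u) * (p * z powr (p - 1))"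
      using that False by (intro MVT2) (auto intro!: derivative_eq_intros simp: powr_diff)
    then obtain z where z: "u < z" "z < w" "w powr p - u powr p = (w - u) * (p * z powr (p - 1))" by blast
    have "z powr (p - 1) \<le> a powr (p - 1)" using z that \<open>p \<ge> 1\<close> by (intro powr_mono2) auto
    then have "(w - u) * (p * z powr (p - 1)) \<le> (w - u) * (p * a powr (p - 1))"
      using that \<open>p \<ge> 1\<close> by (intro mult_left_mono) auto
    then show ?thesis using z by (simp add: mult.commute)
  qed
  consider "u < w" | "w < u" | "u = w" by linarith
  then show ?thesis
  proof cases
    case 1
    then have "u powr p \<le> w powr p" using assms by (intro powr_mono2) auto
    then show ?thesis using *[OF assms(2) 1 assms(5)] 1 by simp
  next
    case 2
    then have "w powr p \<le> u powr p" using assms by (intro powr_mono2) auto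
    then show ?thesis using *[OF assms(4) 2 assms(3)] 2 by simp
  qed simp
qed

text \<open>The counterpart of \<open>powr_diff_le\<close> with the same factor a^(p-1), so that
  this factor can be cancelled between the two.\<close>

lemma powr_diff_ge:
  fixes a b p :: real
  assumes "p \<ge> 1" "0 \<le> b" "b \<le> a"
  shows "(a - b) * a powr (p - 1) \<le> a powr p - b powr p"
proof -
  have e: "x powr p = x * x powr (p - 1)" if "x \<ge> 0" for x
    using that by (cases "x = 0") (auto simp: powr_mult_base)
  have "b * b powr (p - 1) \<le> b * a powr (p - 1)" using assms by (intro mult_left_mono powr_mono2) auto
  then show ?thesis using assms by (simp add: e algebra_simps)
qed

section \<open>The chart of the cap where the last coordinate dominates\<close>

definition chart_height :: "nat \<Rightarrow> real \<Rightarrow> (nat \<Rightarrow> real) \<Rightarrow> real" where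
  "chart_height d p y = (1 - (\<Sum>i<d. \<bar>y i\<bar> powr p)) powr (1 / p)"

definition chart_dom :: "nat \<Rightarrow> real \<Rightarrow> (nat \<Rightarrow> real) set" where
  "chart_dom d p = {y \<in> space (Rn d). (\<Sum>i<d. \<bar>y i\<bar> powr p) < 1 \<and> (\<forall>i<d. \<bar>y i\<bar> \<le> chart_height d p y)}"

definition chart :: "nat \<Rightarrow> real \<Rightarrow> (nat \<Rightarrow> real) \<Rightarrow> nat \<Rightarrow> real" where
  "chart d p y = y(d := chart_height d p y)"

definition top_cap :: "nat \<Rightarrow> real \<Rightarrow> (nat \<Rightarrow> real) set" where
  "top_cap d p = {x \<in> lp_sphere (Suc d) p. \<forall>i<d. \<bar>x i\<bar> \<le> x d}"

lemma restrict_measurable: "(\<lambda>x. restrict x {..<d}) \<in> Rn (Suc d) \<rightarrow>\<^sub>M Rn d"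
  by (intro measurable_restrict_subset) auto

lemma lp_sphere_sets: "lp_sphere n p \<in> sets (Rn n)"
  unfolding lp_sphere_def by measurable

lemma coord_le_dist: "i < n \<Longrightarrow> \<bar>x i - y i\<bar> \<le> euclidean_dist n x y"
proof -
  assume i: "i < n"
  have "\<bar>x i - y i\<bar> = sqrt ((x i - y i)\<^sup>2)" by simp
  also have "\<dots> \<le> sqrt (\<Sum>i<n. (x i - y i)\<^sup>2)"
    using i by (intro real_sqrt_le_mono member_le_sum) auto
  finally show ?thesis by (simp add: euclidean_dist_def L2_set_def)
qed

context
  fixes p :: real and d :: nat
  assumes p: "p \<ge> 1" and d: "d \<ge> 1"
begin

lemma lessThan_nonempty: "{..<d} \<noteq> {}"
proof -
  have "0 \<in> {..<d}" using d by simp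
  then show ?thesis by blast
qed

lemma chart_height_powr:
  assumes "y \<in> chart_dom d p"
  shows "chart_height d p y powr p = 1 - (\<Sum>i<d. \<bar>y i\<bar> powr p)" "chart_height d p y > 0"
  using assms p by (auto simp: chart_height_def chart_dom_def powr_powr)

text \<open>The height is the largest of d + 1 coordinates whose p-th powers add up to 1, so its
  p-th power is at least their average. This bounds the Jacobian in \<open>cone_slice_bounds\<close>
  from below.\<close>

lemma chart_height_bounds:
  assumes y: "y \<in> chart_dom d p"
  shows "chart_height d p y \<le> 1" "chart_height d p y powr p \<ge> 1 / real (Suc d)"
proof -
  have s0: "0 \<le> (\<Sum>i<d. \<bar>y i\<bar> powr p)" by (intro sum_nonneg) auto
  then show "chart_height d p y \<le> 1"
    using y p by (auto simp: chart_height_def chart_dom_def intro!: powr_le1)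
  have "(\<Sum>i<d. \<bar>y i\<bar> powr p) \<le> (\<Sum>i<d. chart_height d p y powr p)"
    using y p by (intro sum_mono powr_mono2) (auto simp: chart_dom_def)
  then have "1 - chart_height d p y powr p \<le> real d * chart_height d p y powr p"
    using chart_height_powr(1)[OF y] by simp
  then show "chart_height d p y powr p \<ge> 1 / real (Suc d)" by (simp add: field_simps)
qed

text \<open>Let a be the larger height. All coordinates of both points are at most a, so the
  differences of p-th powers bring in p * a^(p-1), while the difference of heights is multiplied by
  a^(p-1); the factor cancels however small a is. This is why the sphere is cut into caps with a
  dominating coordinate.\<close>

lemma chart_height_lipschitz:
  assumes y: "y \<in> chart_dom d p" and z: "z \<in> chart_dom d p"
  shows "\<bar>chart_height d p y - chart_height d p z\<bar> \<le> p * (\<Sum>i<d. \<bar>y i - z i\<bar>)"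
proof -
  have *: "chart_height d p y - chart_height d p z \<le> p * (\<Sum>i<d. \<bar>y i - z i\<bar>)"
    if y: "y \<in> chart_dom d p" and z: "z \<in> chart_dom d p" and le: "chart_height d p z \<le> chart_height d p y" for y z
  proof -
    define a where "a = chart_height d p y"
    define b where "b = chart_height d p z"
    have ab: "0 < b" "b \<le> a" using le chart_height_powr(2)[OF z] by (auto simp: a_def b_def)
    have "(a - b) * a powr (p - 1) \<le> a powr p - b powr p"
      using ab p by (intro powr_diff_ge) auto
    also have "\<dots> = (\<Sum>i<d. \<bar>z i\<bar> powr p - \<bar>y i\<bar> powr p)"
      unfolding a_def b_def chart_height_powr(1)[OF y] chart_height_powr(1)[OF z] by (simp add: sum_subtractf)
    also have "\<dots> \<le> (\<Sum>i<d. p * a powr (p - 1) * \<bar>y i - z i\<bar>)"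
    proof (intro sum_mono)
      fix i assume i: "i \<in> {..<d}"
      have "\<bar>y i\<bar> \<le> a" "\<bar>z i\<bar> \<le> a" using y z i ab by (auto simp: chart_dom_def a_def b_def)
      then have "\<bar>\<bar>z i\<bar> powr p - \<bar>y i\<bar> powr p\<bar> \<le> p * a powr (p - 1) * \<bar>\<bar>z i\<bar> - \<bar>y i\<bar>\<bar>"
        using p by (intro powr_diff_le) auto
      also have "\<dots> \<le> p * a powr (p - 1) * \<bar>y i - z i\<bar>"
        using p by (intro mult_left_mono) auto
      finally show "\<bar>z i\<bar> powr p - \<bar>y i\<bar> powr p \<le> p * a powr (p - 1) * \<bar>y i - z i\<bar>" by linarith
    qed
    also have "\<dots> = (p * (\<Sum>i<d. \<bar>y i - z i\<bar>)) * a powr (p - 1)" by (simp add: sum_distrib_left mult_ac)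
    finally have le: "(a - b) * a powr (p - 1) \<le> (p * (\<Sum>i<d. \<bar>y i - z i\<bar>)) * a powr (p - 1)" .
    have "a powr (p - 1) > 0" using ab by auto
    from mult_right_le_imp_le[OF le this] show ?thesis by (simp add: a_def b_def)
  qed
  show ?thesis
    using *[OF y z] *[OF z y] by (cases "chart_height d p z \<le> chart_height d p y") (auto simp: abs_minus_commute)
qed

lemma measurable_chart_height [measurable]: "chart_height d p \<in> borel_measurable (Rn d)"
proof -
  have "(\<lambda>x. \<bar>x i\<bar> powr p) \<in> borel_measurable (Rn d)" if "i < d" for i
    using measurable_coord_Rn[OF that] by measurable
  then have "(\<lambda>x. \<Sum>i<d. \<bar>x i\<bar> powr p) \<in> borel_measurable (Rn d)" by (intro borel_measurable_sum) auto
  then show ?thesis unfolding chart_height_def[abs_def] by measurable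
qed

lemma chart_dom_sets [measurable]: "chart_dom d p \<in> sets (Rn d)"
proof -
  have a: "(\<lambda>x. \<bar>x i\<bar> powr p) \<in> borel_measurable (Rn d)" "(\<lambda>x. \<bar>x i\<bar>) \<in> borel_measurable (Rn d)" if "i < d" for i
    using measurable_coord_Rn[OF that] by measurable
  have s: "(\<lambda>x. \<Sum>i<d. \<bar>x i\<bar> powr p) \<in> borel_measurable (Rn d)" using a(1) by (intro borel_measurable_sum) auto
  have "chart_dom d p = {y \<in> space (Rn d). (\<Sum>i<d. \<bar>y i\<bar> powr p) < 1}
      \<inter> (\<Inter>i<d. {y \<in> space (Rn d). \<bar>y i\<bar> \<le> chart_height d p y})"
    using d by (auto simp: chart_dom_def)
  also have "\<dots> \<in> sets (Rn d)"
  proof (intro sets.Int sets.finite_INT)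
    show "{y \<in> space (Rn d). (\<Sum>i<d. \<bar>y i\<bar> powr p) < 1} \<in> sets (Rn d)" using s by measurable
    show "{y \<in> space (Rn d). \<bar>y i\<bar> \<le> chart_height d p y} \<in> sets (Rn d)" if "i \<in> {..<d}" for i
      using a(2)[of i] that by (intro borel_measurable_le) auto
  qed (use lessThan_nonempty in auto)
  finally show ?thesis .
qed

lemma top_cap_sets: "top_cap d p \<in> sets (Rn (Suc d))"
proof -
  have "top_cap d p = lp_sphere (Suc d) p \<inter> (\<Inter>i<d. {x \<in> space (Rn (Suc d)). \<bar>x i\<bar> \<le> x d})"
    using d by (auto simp: top_cap_def lp_sphere_def)
  also have "\<dots> \<in> sets (Rn (Suc d))"
  proof (intro sets.Int sets.finite_INT lp_sphere_sets)
    fix i assume "i \<in> {..<d}"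
    then have "(\<lambda>x. x i) \<in> borel_measurable (Rn (Suc d))" "(\<lambda>x. x d) \<in> borel_measurable (Rn (Suc d))"
      by (auto intro!: measurable_coord_Rn)
    then show "{x \<in> space (Rn (Suc d)). \<bar>x i\<bar> \<le> x d} \<in> sets (Rn (Suc d))" by measurable
  qed (use lessThan_nonempty in auto)
  finally show ?thesis .
qed

lemma lp_norm_eq_1_iff: "lp_norm n p x = 1 \<longleftrightarrow> (\<Sum>i<n. \<bar>x i\<bar> powr p) = 1"
proof -
  have "lp_norm n p x = (lp_norm n p x powr p) powr (1 / p)"
    using p lp_norm_nonneg[of n p x] by (simp add: powr_powr)
  then have "lp_norm n p x = 1 \<longleftrightarrow> lp_norm n p x powr p = 1" by (metis powr_one_eq_one)
  then show ?thesis using p by (simp add: lp_norm_powr)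
qed

lemma chart_in_top: assumes y: "y \<in> chart_dom d p" shows "chart d p y \<in> top_cap d p"
  and "restrict (chart d p y) {..<d} = y"
proof -
  have sp: "y \<in> space (Rn d)" using y by (simp add: chart_dom_def)
  have "(\<Sum>i<Suc d. \<bar>chart d p y i\<bar> powr p) = 1"
    using chart_height_powr[OF y] by (simp add: chart_def)
  moreover have "chart d p y \<in> space (Rn (Suc d))"
    using sp by (auto simp: chart_def space_PiM PiE_def extensional_def)
  ultimately show "chart d p y \<in> top_cap d p"
    using y by (auto simp: top_cap_def lp_sphere_def lp_norm_eq_1_iff chart_dom_def chart_def)
  show "restrict (chart d p y) {..<d} = y"
    using sp by (auto simp: chart_def fun_eq_iff space_PiM PiE_def extensional_def)
qed

lemma top_restrict: assumes x: "x \<in> top_cap d p" shows "restrict x {..<d} \<in> chart_dom d p"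
  and "chart d p (restrict x {..<d}) = x"
proof -
  have sp: "x \<in> space (Rn (Suc d))" and le: "\<And>i. i < d \<Longrightarrow> \<bar>x i\<bar> \<le> x d"
    and 1: "(\<Sum>i<d. \<bar>x i\<bar> powr p) + \<bar>x d\<bar> powr p = 1"
    using x by (auto simp: top_cap_def lp_sphere_def lp_norm_eq_1_iff)
  have x0: "x d \<ge> 0" using le[of 0] d by simp
  have "x d \<noteq> 0"
  proof
    assume 0: "x d = 0"
    then have "\<bar>x i\<bar> powr p = 0" if "i < d" for i using le[OF that] by simp
    then show False using 1 0 by simp
  qed
  then have xd: "x d > 0" using x0 by simp
  have S: "(\<Sum>i<d. \<bar>restrict x {..<d} i\<bar> powr p) = 1 - x d powr p"
    using 1 xd by (simp add: eq_diff_eq)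
  have h: "chart_height d p (restrict x {..<d}) = x d"
    unfolding chart_height_def S using xd p by (simp add: powr_powr)
  show "restrict x {..<d} \<in> chart_dom d p"
    using S xd le by (auto simp: chart_dom_def h space_PiM)
  show "chart d p (restrict x {..<d}) = x"
    using sp by (auto simp: chart_def h fun_eq_iff space_PiM PiE_def extensional_def)
qed

lemma chart_image: "B \<subseteq> chart_dom d p \<Longrightarrow> chart d p ` B = {x \<in> top_cap d p. restrict x {..<d} \<in> B}"
  using chart_in_top top_restrict by (force simp: image_iff)

lemma chart_image_sets: "B \<in> sets (Rn d) \<Longrightarrow> B \<subseteq> chart_dom d p \<Longrightarrow> chart d p ` B \<in> sets (Rn (Suc d))"
proof -
  assume B: "B \<in> sets (Rn d)" "B \<subseteq> chart_dom d p"
  have "chart d p ` B = top_cap d p \<inter> ((\<lambda>x. restrict x {..<d}) -` B \<inter> space (Rn (Suc d)))"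
    unfolding chart_image[OF B(2)] by (auto simp: top_cap_def lp_sphere_def)
  then show ?thesis using measurable_sets[OF restrict_measurable B(1)] top_cap_sets by simp
qed

section \<open>Hausdorff measure and cone measure compared with Lebesgue measure in the
  chart\<close>

abbreviation (input) Haus :: "(nat \<Rightarrow> real) set \<Rightarrow> ennreal" where
  "Haus \<equiv> hausdorff_measure (euclidean_dist (Suc d)) d"

text \<open>Forgetting the last coordinate and shifting by t maps the graph over \<open>B\<close>
  onto a set containing the flat copy of B', and this map is a contraction. Only the lift from the
  flat copy to the graph costs a factor; the height has Lipschitz constant p * d there, each of the
  d coordinate differences being at most the Euclidean distance.\<close>

lemma hausdorff_translate:
  assumes B: "B \<subseteq> chart_dom d p" and B': "B' \<subseteq> chart_dom d p"
    and tr: "B' = {y \<in> space (Rn d). (\<lambda>i\<in>{..<d}. t i + y i) \<in> B}"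
  shows "Haus (chart d p ` B') \<le> ennreal (6 * (p * real d * (real d + 1) + 2)) * Haus (chart d p ` B)"
proof -
  \<comment> \<open>An element of \<open>Rn d\<close> takes the value \<open>undefined\<close> at d.
    Replacing it by 0 embeds the chart domain in a hyperplane, as
    \<open>hausdorff_measure_graph_le\<close> requires.\<close>
  define flat where "flat y = y(d := 0)" for y :: "nat \<Rightarrow> real"
  have ch: "chart d p ` B' = (\<lambda>y. y(d := chart_height d p y)) ` (flat ` B')"
    by (simp add: image_image chart_def flat_def chart_height_def)
  have "Haus (chart d p ` B') \<le> ennreal (6 * ((p * real d) * (real d + 1) + 2)) * Haus (flat ` B')"
    unfolding ch
  proof (rule hausdorff_measure_graph_le[OF d])
    show "0 \<le> p * real d" using p by simp
    fix y assume "y \<in> flat ` B'"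
    then show "y d = 0" by (auto simp: flat_def)
    fix z assume "z \<in> flat ` B'"
    with \<open>y \<in> flat ` B'\<close> obtain u w where uw: "y = flat u" "z = flat w" "u \<in> B'" "w \<in> B'" by auto
    have "\<bar>chart_height d p u - chart_height d p w\<bar> \<le> p * (\<Sum>i<d. \<bar>u i - w i\<bar>)"
      using uw B' by (intro chart_height_lipschitz) auto
    also have "\<dots> \<le> p * (\<Sum>i<d. euclidean_dist (Suc d) y z)"
    proof (intro mult_left_mono sum_mono)
      fix i assume "i \<in> {..<d}"
      then show "\<bar>u i - w i\<bar> \<le> euclidean_dist (Suc d) y z"
        using coord_le_dist[of i "Suc d" y z] by (simp add: uw flat_def)
    qed (use p in auto)
    finally have "\<bar>chart_height d p u - chart_height d p w\<bar> \<le> p * real d * euclidean_dist (Suc d) y z" by simp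
    moreover have "chart_height d p u = chart_height d p y" "chart_height d p w = chart_height d p z"
      by (auto simp: uw flat_def chart_height_def)
    ultimately show "\<bar>chart_height d p y - chart_height d p z\<bar> \<le> p * real d * euclidean_dist (Suc d) y z" by simp
  qed
  also have "\<dots> \<le> ennreal (6 * ((p * real d) * (real d + 1) + 2)) * Haus (chart d p ` B)"
  proof (intro mult_left_mono)
    define \<phi> where "\<phi> x = flat (\<lambda>i\<in>{..<d}. x i - t i)" for x :: "nat \<Rightarrow> real"
    have "flat ` B' \<subseteq> \<phi> ` (chart d p ` B)"
    proof
      fix z assume "z \<in> flat ` B'"
      then obtain y where y: "z = flat y" "y \<in> space (Rn d)" "(\<lambda>i\<in>{..<d}. t i + y i) \<in> B" by (auto simp: tr)
      have "\<phi> (chart d p (\<lambda>i\<in>{..<d}. t i + y i)) = z"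
        using y by (auto simp: \<phi>_def flat_def chart_def fun_eq_iff space_PiM PiE_def extensional_def)
      then show "z \<in> \<phi> ` (chart d p ` B)" using y by blast
    qed
    then have "Haus (flat ` B') \<le> Haus (\<phi> ` (chart d p ` B))" by (intro hausdorff_measure_subset[OF d])
    also have "\<dots> \<le> Haus (chart d p ` B)"
    proof (rule hausdorff_measure_contraction[OF d])
      fix x y
      have "(euclidean_dist (Suc d) (\<phi> x) (\<phi> y))\<^sup>2 \<le> (euclidean_dist (Suc d) x y)\<^sup>2"
        by (simp add: euclidean_dist_sq \<phi>_def flat_def)
      then show "euclidean_dist (Suc d) (\<phi> x) (\<phi> y) \<le> euclidean_dist (Suc d) x y"
        using euclidean_dist_nonneg by (rule power2_le_imp_le)
    qed
    finally show "Haus (flat ` B') \<le> Haus (chart d p ` B)" .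
  qed simp
  finally show ?thesis .
qed

text \<open>On the line through z parallel to the last axis substitute r(t), the norm of z(d := t).
  Then \<open>\<phi>\<close> becomes the indicator of the cone, with Jacobian q^(p-1) for q = t /
  r(t). This q is the height of a chart point, so 1 / (d + 1) \<le> q^p \<le> q^(p-1) \<le>
  1.\<close>

lemma cone_slice_bounds:
  assumes B[measurable]: "B \<in> sets (Rn d)" and BD: "B \<subseteq> chart_dom d p"
  defines "\<phi> \<equiv> \<lambda>(z, r). indicator {0<..1} r * indicator B (scale_vec d (1 / r) z) :: ennreal"
  assumes z: "z \<in> space (Rn d)"
  shows "(\<integral>\<^sup>+r. \<phi> (z, r) \<partial>lborel) \<le> (\<integral>\<^sup>+t. indicator (unit_cone (Suc d) p (chart d p ` B)) (z(d := t)) \<partial>lborel)"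
    and "(\<integral>\<^sup>+t. indicator (unit_cone (Suc d) p (chart d p ` B)) (z(d := t)) \<partial>lborel)
      \<le> ennreal (real (Suc d)) * (\<integral>\<^sup>+r. \<phi> (z, r) \<partial>lborel)"
proof -
  define c where "c = (\<Sum>i<d. \<bar>z i\<bar> powr p)"
  have c: "c \<ge> 0" unfolding c_def by (intro sum_nonneg) auto
  define r where "r t = (c + t powr p) powr (1 / p)" for t
  define r' where "r' t = (c + t powr p) powr (1 / p - 1) * t powr (p - 1)" for t
  have pos: "c + t powr p > 0" if "t > 0" for t using c that by (simp add: add_nonneg_pos)
  have rpos: "r t > 0" if "t > 0" for t using pos[OF that] by (simp add: r_def)
  have rp: "r t powr p = c + t powr p" if "t > 0" for t using pos[OF that] p by (simp add: r_def powr_powr)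
  have nrm: "lp_norm (Suc d) p (z(d := t)) = r t" if "t > 0" for t
  proof -
    have "(\<Sum>i<Suc d. \<bar>(z(d := t)) i\<bar> powr p) = c + t powr p" using that by (simp add: c_def)
    then show ?thesis by (simp add: lp_norm_def r_def)
  qed
  have sub: "(\<integral>\<^sup>+t. \<phi> (z, r t) * ennreal (r' t) * indicator {0<..} t \<partial>lborel)
      = (\<integral>\<^sup>+s. \<phi> (z, s) * indicator {c powr (1 / p)<..} s \<partial>lborel)"
  proof (rule nn_integral_substitution_Ioi)
    show "(\<lambda>s. \<phi> (z, s)) \<in> borel_measurable borel"
      unfolding \<phi>_def prod.case using z by measurable
    show "(r has_real_derivative r' t) (at t)" if "t > 0" for t
    proof -
      have "(r has_real_derivative (1 / p * (c + t powr p) powr (1 / p - 1)) * (p * t powr (p - 1))) (at t)"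
        unfolding r_def[abs_def] using that pos[OF that] p
        by (auto intro!: derivative_eq_intros simp: powr_diff)
      then show ?thesis using p by (simp add: r'_def)
    qed
    show "continuous_on {0<..} r'" unfolding r'_def[abs_def] using pos by (auto intro!: continuous_intros simp: less_imp_neq[symmetric])
    show "0 < r' t" if "t > 0" for t using that pos[OF that] by (simp add: r'_def)
    show "(r \<longlongrightarrow> c powr (1 / p)) (at_right 0)"
    proof -
      have "((\<lambda>t. t powr p) \<longlongrightarrow> 0) (at_right (0::real))" using p by real_asymp
      then have "((\<lambda>t. c + t powr p) \<longlongrightarrow> c + 0) (at_right (0::real))" by (intro tendsto_intros)
      then show ?thesis unfolding r_def[abs_def] using p c
        by (intro tendsto_powr') (auto simp: eventually_at_filter)
    qed
    show "filterlim r at_top at_top"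
    proof (rule filterlim_at_top_mono[OF filterlim_ident])
      show "\<forall>\<^sub>F t in at_top. t \<le> r t"
        using eventually_gt_at_top[of 0]
      proof eventually_elim
        case (elim t)
        have "t = (t powr p) powr (1 / p)" using elim p by (simp add: powr_powr)
        also have "\<dots> \<le> r t" unfolding r_def using c p elim by (intro powr_mono2) auto
        finally show ?case .
      qed
    qed
  qed
  \<comment> \<open>The substitution reaches only s above the norm of z itself. No smaller s
    contributes: z / s in B forces the sum of its p-th powers below 1.\<close>
  have drop: "(\<integral>\<^sup>+s. \<phi> (z, s) * indicator {c powr (1 / p)<..} s \<partial>lborel) = (\<integral>\<^sup>+s. \<phi> (z, s) \<partial>lborel)"
  proof (intro nn_integral_cong)
    fix s :: real
    have "c powr (1 / p) < s" if s: "s > 0" and "scale_vec d (1 / s) z \<in> B"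
    proof -
      have "(\<Sum>i<d. \<bar>scale_vec d (1 / s) z i\<bar> powr p) < 1" using that BD by (auto simp: chart_dom_def)
      also have "(\<Sum>i<d. \<bar>scale_vec d (1 / s) z i\<bar> powr p) = c / s powr p"
        using s by (simp add: scale_vec_def c_def abs_mult powr_divide sum_divide_distrib)
      finally have "c < s powr p" using s by (simp add: field_simps)
      then have "c powr (1 / p) < (s powr p) powr (1 / p)" using c p by (intro powr_less_mono2) auto
      then show ?thesis using s p by (simp add: powr_powr)
    qed
    then show "\<phi> (z, s) * indicator {c powr (1 / p)<..} s = \<phi> (z, s)"
      by (auto simp: \<phi>_def indicator_def)
  qed
  have ind: "indicator (unit_cone (Suc d) p (chart d p ` B)) (z(d := t)) = \<phi> (z, r t) * indicator {0<..} t"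
    and r'b: "\<phi> (z, r t) * indicator {0<..} t \<noteq> 0 \<Longrightarrow> r' t \<le> 1 \<and> 1 \<le> real (Suc d) * r' t" for t
  proof -
    let ?x = "z(d := t)"
    have sp: "?x \<in> space (Rn (Suc d))" using z by (auto simp: space_PiM PiE_def extensional_def)
    have nx: "normalize_vec (Suc d) p ?x = (scale_vec d (1 / r t) z)(d := t / r t)" if "t > 0"
      using nrm[OF that] by (auto simp: normalize_vec_def scale_vec_def fun_eq_iff)
    have h: "chart_height d p (scale_vec d (1 / r t) z) = t / r t" if "t > 0" for t
    proof -
      have "(\<Sum>i<d. \<bar>scale_vec d (1 / r t) z i\<bar> powr p) = c / r t powr p"
        using rpos[OF that] by (simp add: scale_vec_def c_def abs_mult powr_divide sum_divide_distrib)
      then have "1 - (\<Sum>i<d. \<bar>scale_vec d (1 / r t) z i\<bar> powr p) = (t / r t) powr p"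
        using that rpos[OF that] pos[OF that] rp[OF that] by (simp add: powr_divide field_simps)
      then show ?thesis using that rpos[OF that] p by (simp add: chart_height_def powr_powr)
    qed
    have mem: "normalize_vec (Suc d) p ?x \<in> chart d p ` B \<longleftrightarrow> scale_vec d (1 / r t) z \<in> B" if t: "t > 0"
    proof
      assume "scale_vec d (1 / r t) z \<in> B"
      moreover have "normalize_vec (Suc d) p ?x = chart d p (scale_vec d (1 / r t) z)"
        unfolding nx[OF t] chart_def h[OF t] ..
      ultimately show "normalize_vec (Suc d) p ?x \<in> chart d p ` B" by simp
    next
      assume "normalize_vec (Suc d) p ?x \<in> chart d p ` B"
      then obtain y where y: "y \<in> B" "normalize_vec (Suc d) p ?x = chart d p y" by auto
      have "y = restrict (chart d p y) {..<d}" using chart_in_top(2) BD y by auto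
      also have "\<dots> = scale_vec d (1 / r t) z"
        unfolding y(2)[symmetric] nx[OF t] by (auto simp: scale_vec_def fun_eq_iff)
      finally show "scale_vec d (1 / r t) z \<in> B" using y by simp
    qed
    have neg: "normalize_vec (Suc d) p ?x \<notin> chart d p ` B" if t: "t \<le> 0"
    proof
      assume "normalize_vec (Suc d) p ?x \<in> chart d p ` B"
      then obtain y where y: "y \<in> B" "normalize_vec (Suc d) p ?x = chart d p y" by auto
      have "chart d p y d > 0" using chart_height_powr(2) BD y by (auto simp: chart_def)
      moreover have "normalize_vec (Suc d) p ?x d \<le> 0"
        using t lp_norm_nonneg[of "Suc d" p ?x] by (simp add: normalize_vec_def scale_vec_def divide_nonpos_nonneg)
      ultimately show False using y by simp
    qed
    show "indicator (unit_cone (Suc d) p (chart d p ` B)) ?x = \<phi> (z, r t) * indicator {0<..} t"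
    proof (cases "t > 0")
      case True
      then show ?thesis using sp nrm[OF True] rpos[OF True] mem[OF True]
        by (simp add: unit_cone_def \<phi>_def indicator_def)
    next
      case False
      then show ?thesis using neg by (simp add: unit_cone_def indicator_def)
    qed
    assume "\<phi> (z, r t) * indicator {0<..} t \<noteq> 0"
    then have t: "t > 0" and "scale_vec d (1 / r t) z \<in> B" by (auto simp: \<phi>_def indicator_def split: if_splits)
    then have D: "scale_vec d (1 / r t) z \<in> chart_dom d p" using BD by auto
    define q where "q = t / r t"
    have q: "q > 0" "q \<le> 1" "q powr p \<ge> 1 / real (Suc d)"
      using chart_height_bounds[OF D] t rpos[OF t] unfolding h[OF t] by (auto simp: q_def)
    have r'q: "r' t = q powr (p - 1)"
    proof -
      have "(c + t powr p) powr (1 / p - 1) = r t powr (1 - p)"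
      proof -
        have "r t powr (1 - p) = (c + t powr p) powr (1 / p * (1 - p))" by (simp add: r_def powr_powr)
        also have "1 / p * (1 - p) = 1 / p - 1" using p by (simp add: field_simps)
        finally show ?thesis by simp
      qed
      also have "\<dots> = inverse (r t powr (p - 1))" using powr_minus[of "r t" "p - 1"] by simp
      finally have e: "(c + t powr p) powr (1 / p - 1) = inverse (r t powr (p - 1))" .
      have "q powr (p - 1) = t powr (p - 1) / r t powr (p - 1)"
        using t rpos[OF t] by (simp add: q_def powr_divide)
      then show ?thesis unfolding r'_def e by (simp add: divide_inverse mult.commute)
    qed
    have "q powr p \<le> q powr (p - 1)" using q p by (intro powr_mono') auto
    then have "real (Suc d) * q powr p \<le> real (Suc d) * q powr (p - 1)" by (intro mult_left_mono) auto
    moreover have "1 \<le> real (Suc d) * q powr p"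
      using q(3) pos_divide_le_eq[of "real (Suc d)" 1 "q powr p"] by (simp add: mult.commute)
    ultimately have "1 \<le> real (Suc d) * q powr (p - 1)" by (rule order_trans[rotated])
    moreover have "q powr (p - 1) \<le> 1" using q p by (intro powr_le1) auto
    ultimately show "r' t \<le> 1 \<and> 1 \<le> real (Suc d) * r' t" by (simp add: r'q)
  qed
  have "(\<integral>\<^sup>+s. \<phi> (z, s) \<partial>lborel) = (\<integral>\<^sup>+t. \<phi> (z, r t) * indicator {0<..} t * ennreal (r' t) \<partial>lborel)"
    unfolding drop[symmetric] sub[symmetric] by (simp add: mult_ac)
  also have "\<dots> \<le> (\<integral>\<^sup>+t. \<phi> (z, r t) * indicator {0<..} t \<partial>lborel)"
  proof (intro nn_integral_mono)
    fix t
    show "\<phi> (z, r t) * indicator {0<..} t * ennreal (r' t) \<le> \<phi> (z, r t) * indicator {0<..} t"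
    proof (cases "\<phi> (z, r t) * indicator {0<..} t = 0")
      case False
      then have "ennreal (r' t) \<le> 1" using r'b by (simp add: ennreal_le_1)
      then show ?thesis by (metis mult.right_neutral mult_left_mono zero_le)
    next
      case True
      show ?thesis unfolding True by simp
    qed
  qed
  finally show "(\<integral>\<^sup>+r. \<phi> (z, r) \<partial>lborel) \<le> (\<integral>\<^sup>+t. indicator (unit_cone (Suc d) p (chart d p ` B)) (z(d := t)) \<partial>lborel)"
    unfolding ind .
  have mr: "(\<lambda>t. \<phi> (z, r t) * indicator {0<..} t * ennreal (r' t)) \<in> borel_measurable lborel"
  proof -
    have "(\<lambda>s. \<phi> (z, s)) \<in> borel_measurable borel"
      unfolding \<phi>_def prod.case using z by measurable
    then show ?thesis unfolding r_def r'_def by measurable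
  qed
  have "(\<integral>\<^sup>+t. indicator (unit_cone (Suc d) p (chart d p ` B)) (z(d := t)) \<partial>lborel)
      \<le> (\<integral>\<^sup>+t. ennreal (real (Suc d)) * (\<phi> (z, r t) * indicator {0<..} t * ennreal (r' t)) \<partial>lborel)"
    unfolding ind
  proof (intro nn_integral_mono)
    fix t
    show "\<phi> (z, r t) * indicator {0<..} t \<le> ennreal (real (Suc d)) * (\<phi> (z, r t) * indicator {0<..} t * ennreal (r' t))"
    proof (cases "\<phi> (z, r t) * indicator {0<..} t = 0")
      case False
      then have "1 \<le> ennreal (real (Suc d) * r' t)" using r'b by (simp add: ennreal_ge_1)
      also have "\<dots> = ennreal (real (Suc d)) * ennreal (r' t)" by (rule ennreal_mult') simp
      finally have "\<phi> (z, r t) * indicator {0<..} t * 1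
          \<le> \<phi> (z, r t) * indicator {0<..} t * (ennreal (real (Suc d)) * ennreal (r' t))"
        by (intro mult_left_mono) auto
      then show ?thesis by (simp add: mult_ac)
    next
      case True
      show ?thesis unfolding True by simp
    qed
  qed
  also have "\<dots> = ennreal (real (Suc d)) * (\<integral>\<^sup>+t. \<phi> (z, r t) * indicator {0<..} t * ennreal (r' t) \<partial>lborel)"
    using mr by (rule nn_integral_cmult)
  also have "(\<integral>\<^sup>+t. \<phi> (z, r t) * indicator {0<..} t * ennreal (r' t) \<partial>lborel) = (\<integral>\<^sup>+r. \<phi> (z, r) \<partial>lborel)"
    unfolding drop[symmetric] sub[symmetric] by (simp add: mult_ac)
  finally show "(\<integral>\<^sup>+t. indicator (unit_cone (Suc d) p (chart d p ` B)) (z(d := t)) \<partial>lborel)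
      \<le> ennreal (real (Suc d)) * (\<integral>\<^sup>+r. \<phi> (z, r) \<partial>lborel)" .
qed

text \<open>Integrate the slice bounds over z. With the order exchanged, for fixed r the admissible
  z form the dilate r B, of measure r^d times that of B; the integral over r gives
  \<open>\<kappa>\<close>.\<close>

lemma cone_volume:
  assumes B[measurable]: "B \<in> sets (Rn d)" and BD: "B \<subseteq> chart_dom d p"
  defines "\<kappa> \<equiv> \<integral>\<^sup>+r. ennreal (r ^ d) * indicator {0<..1} r \<partial>lborel"
  defines "U \<equiv> emeasure (lebesgue_Rn (Suc d)) (unit_cone (Suc d) p (chart d p ` B))"
  shows "\<kappa> * emeasure (lebesgue_Rn d) B \<le> U" and "U \<le> ennreal (real (Suc d)) * (\<kappa> * emeasure (lebesgue_Rn d) B)"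
proof -
  interpret L: product_sigma_finite "\<lambda>_::nat. lborel :: real measure" by (rule product_sigma_finite_lborel)
  interpret ld: sigma_finite_measure "lebesgue_Rn d" unfolding lebesgue_Rn_def by (rule L.sigma_finite) simp
  interpret pair_sigma_finite "lebesgue_Rn d" "lborel :: real measure" ..
  define \<phi> where "\<phi> = (\<lambda>(z, r). indicator {0<..1} r * indicator B (scale_vec d (1 / r) z) :: ennreal)"
  have m\<phi>[measurable]: "\<phi> \<in> borel_measurable (lebesgue_Rn d \<Otimes>\<^sub>M lborel)" unfolding \<phi>_def by measurable
  note CS = chart_image_sets[OF B BD]
  have U: "U = (\<integral>\<^sup>+z. \<integral>\<^sup>+t. indicator (unit_cone (Suc d) p (chart d p ` B)) (z(d := t)) \<partial>lborel \<partial>lebesgue_Rn d)"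
  proof -
    have s: "unit_cone (Suc d) p (chart d p ` B) \<in> sets (lebesgue_Rn (Suc d))"
      using unit_cone_sets[OF CS] sets_lebesgue_Rn by simp
    then have "U = (\<integral>\<^sup>+x. indicator (unit_cone (Suc d) p (chart d p ` B)) x \<partial>lebesgue_Rn (Suc d))"
      unfolding U_def by simp
    also have "\<dots> = (\<integral>\<^sup>+z. \<integral>\<^sup>+t. indicator (unit_cone (Suc d) p (chart d p ` B)) (z(d := t)) \<partial>lborel \<partial>lebesgue_Rn d)"
      using s unfolding lebesgue_Rn_def lessThan_Suc by (intro L.product_nn_integral_insert) auto
    finally show ?thesis .
  qed
  have "(\<integral>\<^sup>+z. \<integral>\<^sup>+r. \<phi> (z, r) \<partial>lborel \<partial>lebesgue_Rn d) = (\<integral>\<^sup>+r. \<integral>\<^sup>+z. \<phi> (z, r) \<partial>lebesgue_Rn d \<partial>lborel)"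
    by (intro Fubini'[symmetric]) measurable
  also have "\<dots> = (\<integral>\<^sup>+r. ennreal (r ^ d) * indicator {0<..1} r * emeasure (lebesgue_Rn d) B \<partial>lborel)"
  proof (intro nn_integral_cong)
    fix r :: real
    show "(\<integral>\<^sup>+z. \<phi> (z, r) \<partial>lebesgue_Rn d) = ennreal (r ^ d) * indicator {0<..1} r * emeasure (lebesgue_Rn d) B"
    proof (cases "r \<in> {0<..1}")
      case True
      let ?C = "{z \<in> space (Rn d). scale_vec d (1 / r) z \<in> B}"
      have C: "?C \<in> sets (Rn d)" by measurable
      have "(\<integral>\<^sup>+z. \<phi> (z, r) \<partial>lebesgue_Rn d) = (\<integral>\<^sup>+z. indicator ?C z \<partial>lebesgue_Rn d)"
        using True by (intro nn_integral_cong) (auto simp: \<phi>_def indicator_def space_lebesgue_Rn)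
      also have "\<dots> = emeasure (lebesgue_Rn d) ?C" using C sets_lebesgue_Rn by simp
      also have "\<dots> = ennreal (r ^ d) * emeasure (lebesgue_Rn d) {x \<in> space (Rn d). scale_vec d r x \<in> ?C}"
        using True C by (intro emeasure_lebesgue_Rn_scaled) auto
      also have "{x \<in> space (Rn d). scale_vec d r x \<in> ?C} = B"
        using True sets.sets_into_space[OF B] by (auto simp: scale_vec_space scale_vec_scale_vec scale_vec_1)
      finally show ?thesis using True by simp
    qed (simp add: \<phi>_def)
  qed
  also have "\<dots> = \<kappa> * emeasure (lebesgue_Rn d) B"
    unfolding \<kappa>_def by (intro nn_integral_multc) measurable
  finally have I: "(\<integral>\<^sup>+z. \<integral>\<^sup>+r. \<phi> (z, r) \<partial>lborel \<partial>lebesgue_Rn d) = \<kappa> * emeasure (lebesgue_Rn d) B" .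
  show "\<kappa> * emeasure (lebesgue_Rn d) B \<le> U"
    unfolding U I[symmetric] \<phi>_def
    using cone_slice_bounds(1)[OF B BD] by (rule nn_integral_mono) (simp add: space_lebesgue_Rn)
  have "U \<le> (\<integral>\<^sup>+z. ennreal (real (Suc d)) * (\<integral>\<^sup>+r. \<phi> (z, r) \<partial>lborel) \<partial>lebesgue_Rn d)"
    unfolding U \<phi>_def
    using cone_slice_bounds(2)[OF B BD] by (rule nn_integral_mono) (simp add: space_lebesgue_Rn)
  also have "\<dots> = ennreal (real (Suc d)) * (\<kappa> * emeasure (lebesgue_Rn d) B)"
    unfolding I[symmetric] by (intro nn_integral_cmult) measurable
  finally show "U \<le> ennreal (real (Suc d)) * (\<kappa> * emeasure (lebesgue_Rn d) B)" .
qed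

lemma measurable_chart: "chart d p \<in> Rn d \<rightarrow>\<^sub>M Rn (Suc d)"
proof -
  have "(\<lambda>y. \<lambda>i\<in>{..<Suc d}. if i = d then chart_height d p y else y i) \<in> Rn d \<rightarrow>\<^sub>M Rn (Suc d)"
  proof (rule measurable_restrict)
    fix i assume "i \<in> {..<Suc d}"
    then show "(\<lambda>y. if i = d then chart_height d p y else y i) \<in> borel_measurable (Rn d)"
      using measurable_chart_height measurable_coord_Rn[of i d] by (cases "i = d") auto
  qed
  moreover have "chart d p y = (\<lambda>i\<in>{..<Suc d}. if i = d then chart_height d p y else y i)"
    if "y \<in> space (Rn d)" for y
    using that by (auto simp: chart_def fun_eq_iff space_PiM PiE_def extensional_def)
  ultimately show ?thesis by (subst measurable_cong) auto
qed

lemma top_set_chart: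
  assumes A: "A \<in> sets (Rn (Suc d))" and "A \<subseteq> top_cap d p"
  obtains B where "B \<in> sets (Rn d)" "B \<subseteq> chart_dom d p" "A = chart d p ` B"
proof
  let ?B = "chart_dom d p \<inter> (chart d p -` A \<inter> space (Rn d))"
  show "?B \<in> sets (Rn d)" using measurable_sets[OF measurable_chart A] chart_dom_sets by simp
  show "?B \<subseteq> chart_dom d p" by simp
  show "A = chart d p ` ?B"
  proof (intro equalityI subsetI)
    fix x assume x: "x \<in> A"
    then have "restrict x {..<d} \<in> ?B" "x = chart d p (restrict x {..<d})"
      using top_restrict assms(2) by (auto simp: chart_dom_def)
    then show "x \<in> chart d p ` ?B" by blast
  qed auto
qed

end

section \<open>Symmetries carrying every point of the sphere into the cap\<close>

definition swap_sign :: "nat \<Rightarrow> nat \<Rightarrow> real \<Rightarrow> (nat \<Rightarrow> real) \<Rightarrow> nat \<Rightarrow> real" where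
  "swap_sign d j s x = (\<lambda>i\<in>{..<Suc d}. s * x (Transposition.transpose j d i))"

lemma swap_sign_space: "swap_sign d j s x \<in> space (Rn (Suc d))"
  by (simp add: swap_sign_def space_PiM)

lemma transpose_lt: "j \<le> d \<Longrightarrow> i < Suc d \<Longrightarrow> Transposition.transpose j d i < Suc d"
  by (auto simp: Transposition.transpose_def)

lemma measurable_swap_sign: "j \<le> d \<Longrightarrow> swap_sign d j s \<in> Rn (Suc d) \<rightarrow>\<^sub>M Rn (Suc d)"
  unfolding swap_sign_def[abs_def]
proof (rule measurable_restrict)
  fix i assume "j \<le> d" "i \<in> {..<Suc d}"
  then have "(\<lambda>x. x (Transposition.transpose j d i)) \<in> borel_measurable (Rn (Suc d))"
    using transpose_lt[of j d i] by (intro measurable_coord_Rn) auto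
  then show "(\<lambda>x. s * x (Transposition.transpose j d i)) \<in> borel_measurable (Rn (Suc d))" by measurable
qed

text \<open>This depends on the sign multiplying all coordinates. Negating only the last coordinate
  after the exchange would not give an involution when j differs from d.\<close>

lemma swap_sign_involution:
  assumes "j \<le> d" "s * s = 1" "x \<in> space (Rn (Suc d))"
  shows "swap_sign d j s (swap_sign d j s x) = x"
proof
  fix i
  show "swap_sign d j s (swap_sign d j s x) i = x i"
  proof (cases "i < Suc d")
    case True
    then show ?thesis using transpose_lt[OF assms(1) True] assms(2)
      by (simp add: swap_sign_def mult.assoc[symmetric])
  next
    case False
    then show ?thesis using assms(3) by (auto simp: swap_sign_def space_PiM PiE_def extensional_def)
  qed
qed

lemma sum_transpose: "j \<le> d \<Longrightarrow> (\<Sum>i<Suc d. f (Transposition.transpose j d i)) = (\<Sum>i<Suc d. f i)"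
  by (rule sum.reindex_bij_witness[of _ "Transposition.transpose j d" "Transposition.transpose j d"])
     (auto simp: transpose_lt simp del: lessThan_Suc sum.lessThan_Suc)

lemma prod_transpose: "j \<le> d \<Longrightarrow> (\<Prod>i<Suc d. f (Transposition.transpose j d i)) = (\<Prod>i<Suc d. f i)"
  by (rule prod.reindex_bij_witness[of _ "Transposition.transpose j d" "Transposition.transpose j d"])
     (auto simp: transpose_lt simp del: lessThan_Suc prod.lessThan_Suc)

lemma sign_abs: "s * s = 1 \<Longrightarrow> \<bar>s\<bar> = 1" for s :: real
  by (metis abs_1 abs_mult_self_eq abs_square_eq_1 power2_eq_square)

lemma lp_norm_swap_sign:
  assumes "j \<le> d" "s * s = 1"
  shows "lp_norm (Suc d) p (swap_sign d j s x) = lp_norm (Suc d) p x"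
proof -
  have "(\<Sum>i<Suc d. \<bar>swap_sign d j s x i\<bar> powr p) = (\<Sum>i<Suc d. \<bar>x (Transposition.transpose j d i)\<bar> powr p)"
    using sign_abs[OF assms(2)] by (intro sum.cong) (auto simp: swap_sign_def abs_mult)
  also have "\<dots> = (\<Sum>i<Suc d. \<bar>x i\<bar> powr p)" by (rule sum_transpose[OF assms(1)])
  finally show ?thesis by (simp add: lp_norm_def)
qed

lemma euclidean_dist_swap_sign:
  assumes "j \<le> d" "s * s = 1"
  shows "euclidean_dist (Suc d) (swap_sign d j s x) (swap_sign d j s y) = euclidean_dist (Suc d) x y"
proof -
  have "(\<Sum>i<Suc d. (swap_sign d j s x i - swap_sign d j s y i)\<^sup>2)
      = (\<Sum>i<Suc d. (x (Transposition.transpose j d i) - y (Transposition.transpose j d i))\<^sup>2)"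
  proof (intro sum.cong refl)
    fix i assume "i \<in> {..<Suc d}"
    then have "(swap_sign d j s x i - swap_sign d j s y i)\<^sup>2
        = (s * s) * (x (Transposition.transpose j d i) - y (Transposition.transpose j d i))\<^sup>2"
      by (simp add: swap_sign_def right_diff_distrib[symmetric] power2_eq_square mult_ac)
    then show "(swap_sign d j s x i - swap_sign d j s y i)\<^sup>2
        = (x (Transposition.transpose j d i) - y (Transposition.transpose j d i))\<^sup>2"
      using assms(2) by simp
  qed
  also have "\<dots> = (\<Sum>i<Suc d. (x i - y i)\<^sup>2)" by (rule sum_transpose[OF assms(1)])
  finally show ?thesis unfolding euclidean_dist_def L2_set_def by simp
qed

lemma sphere_cover:
  assumes x: "x \<in> lp_sphere (Suc d) p" and p: "p \<ge> 1"
  shows "\<exists>j\<le>d. \<exists>s\<in>{1, -1}. swap_sign d j s x \<in> top_cap d p"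
proof -
  define m where "m = Max ((\<lambda>i. \<bar>x i\<bar>) ` {..<Suc d})"
  have "m \<in> (\<lambda>i. \<bar>x i\<bar>) ` {..<Suc d}" unfolding m_def by (intro Max_in) auto
  then obtain j where j: "j \<le> d" "m = \<bar>x j\<bar>" by (auto simp: less_Suc_eq_le)
  have le: "\<bar>x i\<bar> \<le> \<bar>x j\<bar>" if "i < Suc d" for i
    unfolding j(2)[symmetric] m_def using that by (intro Max_ge) auto
  define s :: real where "s = (if x j \<ge> 0 then 1 else - 1)"
  have s: "s \<in> {1, - 1}" "s * s = 1" "\<bar>s\<bar> = 1" "s * x j = \<bar>x j\<bar>" by (simp_all add: s_def)
  have top: "swap_sign d j s x d = \<bar>x j\<bar>" using s(4) by (simp add: swap_sign_def)
  have "\<bar>swap_sign d j s x i\<bar> \<le> \<bar>x j\<bar>" if "i < d" for i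
    using that s(3) le[OF transpose_lt[OF j(1), of i]] by (simp add: swap_sign_def abs_mult)
  moreover have "lp_norm (Suc d) p (swap_sign d j s x) = 1"
    using x lp_norm_swap_sign[OF j(1) s(2)] by (simp add: lp_sphere_def)
  ultimately have "swap_sign d j s x \<in> top_cap d p"
    by (simp add: top_cap_def lp_sphere_def swap_sign_space top)
  then show ?thesis using s j by blast
qed

lemma swap_sign_scale: "j \<le> d \<Longrightarrow> swap_sign d j s (scale_vec (Suc d) c x) = scale_vec (Suc d) c (swap_sign d j s x)"
  using transpose_lt[of j d] by (auto simp: swap_sign_def scale_vec_def fun_eq_iff)

context
  fixes p :: real
  assumes p: "p \<ge> 1"
begin

interpretation g: prob_space "p_gaussian p" by (rule prob_space_p_gaussian[OF p])

lemma prob_space_cone: "n \<ge> 1 \<Longrightarrow> prob_space (cone_measure n p)"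
  unfolding cone_measure_eq[OF p] by (intro prob_space.prob_space_distr prob_space_gauss p)
    (simp add: sets_gauss[OF p] cong: measurable_cong_sets)

lemma sets_cone: "n \<ge> 1 \<Longrightarrow> sets (cone_measure n p) = sets (Rn n)"
  by (simp add: cone_measure_eq[OF p])

lemma p_gaussian_sign:
  assumes "s \<in> {1, - 1}" and A[measurable]: "A \<in> sets borel"
  shows "emeasure (p_gaussian p) {z. s * z \<in> A} = emeasure (p_gaussian p) A"
proof (cases "s = 1")
  case False
  then have s: "s = - 1" using assms by simp
  define f where "f x = ennreal (1 / (2 * p powr (1 / p) * Gamma (1 + 1 / p)) * exp (- (\<bar>x\<bar> powr p) / p))" for x
  have [measurable]: "f \<in> borel_measurable borel" unfolding f_def by measurable
  have pg: "p_gaussian p = density lborel f" by (simp add: p_gaussian_def f_def[abs_def])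
  have S: "{z. s * z \<in> A} \<in> sets borel" by measurable
  have "emeasure (p_gaussian p) A = (\<integral>\<^sup>+x. f x * indicator A x \<partial>lborel)"
    unfolding pg by (intro emeasure_density) auto
  also have "\<dots> = ennreal \<bar>- 1\<bar> * (\<integral>\<^sup>+x. f (0 + (- 1) * x) * indicator A (0 + (- 1) * x) \<partial>lborel)"
    by (intro nn_integral_real_affine) auto
  also have "\<dots> = (\<integral>\<^sup>+x. f x * indicator {z. s * z \<in> A} x \<partial>lborel)"
    by (simp, intro nn_integral_cong) (auto simp: f_def indicator_def s)
  also have "\<dots> = emeasure (p_gaussian p) {z. s * z \<in> A}"
    unfolding pg using S by (intro emeasure_density[symmetric]) auto
  finally show ?thesis by simp
qed simp

lemma gauss_swap_sign:
  assumes "j \<le> d" and "s \<in> {1, - 1}"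
  shows "distr (gauss_vec (Suc d) p) (Rn (Suc d)) (swap_sign d j s) = gauss_vec (Suc d) p"
  unfolding gauss_vec_def[of "Suc d"]
proof -
  let ?G = "PiM {..<Suc d} (\<lambda>_. p_gaussian p)"
  let ?tr = "Transposition.transpose j d"
  interpret G: product_sigma_finite "\<lambda>_::nat. p_gaussian p"
    by (simp add: product_sigma_finite_def g.sigma_finite_measure_axioms)
  have sG: "sets ?G = sets (Rn (Suc d))" using sets_gauss[OF p, of "Suc d"] by (simp add: gauss_vec_def)
  have spG: "space ?G = space (Rn (Suc d))" by (rule sets_eq_imp_space_eq[OF sG])
  have m: "swap_sign d j s \<in> ?G \<rightarrow>\<^sub>M Rn (Suc d)"
    unfolding measurable_cong_sets[OF sG refl] by (rule measurable_swap_sign[OF assms(1)])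
  show "distr ?G (Rn (Suc d)) (swap_sign d j s) = ?G"
  proof (rule G.PiM_eqI)
    show "sets (distr ?G (Rn (Suc d)) (swap_sign d j s)) = sets ?G" using sG by simp
    fix A assume "\<And>i. i \<in> {..<Suc d} \<Longrightarrow> A i \<in> sets (p_gaussian p)"
    then have A: "i < Suc d \<Longrightarrow> A i \<in> sets borel" for i using sets_p_gaussian[OF p] by simp
    have At: "i < Suc d \<Longrightarrow> A (?tr i) \<in> sets borel" for i using A transpose_lt[OF assms(1)] by simp
    have PA: "Pi\<^sub>E {..<Suc d} A \<in> sets (Rn (Suc d))" using A by (intro sets_PiM_I_finite) auto
    define E where "E i = {z. s * z \<in> A (?tr i)}" for i
    have Em: "E i \<in> sets (p_gaussian p)" if "i \<in> {..<Suc d}" for i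
    proof -
      have [measurable]: "A (?tr i) \<in> sets borel" using At that by simp
      have "E i \<in> sets borel" unfolding E_def by measurable
      then show ?thesis using sets_p_gaussian[OF p] by simp
    qed
    have "emeasure (distr ?G (Rn (Suc d)) (swap_sign d j s)) (Pi\<^sub>E {..<Suc d} A)
        = emeasure ?G (swap_sign d j s -` Pi\<^sub>E {..<Suc d} A \<inter> space ?G)"
      by (rule emeasure_distr[OF m PA])
    also have "swap_sign d j s -` Pi\<^sub>E {..<Suc d} A \<inter> space ?G = Pi\<^sub>E {..<Suc d} E"
    proof (intro equalityI subsetI)
      fix x assume x: "x \<in> swap_sign d j s -` Pi\<^sub>E {..<Suc d} A \<inter> space ?G"
      show "x \<in> Pi\<^sub>E {..<Suc d} E"
      proof
        fix i assume i: "i \<in> {..<Suc d}"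
        then have "swap_sign d j s x (?tr i) \<in> A (?tr i)" using x transpose_lt[OF assms(1)] by auto
        then show "x i \<in> E i" using i transpose_lt[OF assms(1)] by (simp add: swap_sign_def E_def)
      qed (use x in \<open>auto simp: spG space_PiM PiE_def extensional_def\<close>)
    next
      fix x assume x: "x \<in> Pi\<^sub>E {..<Suc d} E"
      have "swap_sign d j s x \<in> Pi\<^sub>E {..<Suc d} A"
      proof
        fix i assume i: "i \<in> {..<Suc d}"
        then have "x (?tr i) \<in> E (?tr i)" using x transpose_lt[OF assms(1)] by auto
        then show "swap_sign d j s x i \<in> A i" using i by (simp add: swap_sign_def E_def)
      qed (auto simp: swap_sign_def)
      then show "x \<in> swap_sign d j s -` Pi\<^sub>E {..<Suc d} A \<inter> space ?G"
        using x by (auto simp: spG space_PiM PiE_def space_p_gaussian[OF p])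
    qed
    also have "emeasure ?G (Pi\<^sub>E {..<Suc d} E) = (\<Prod>i<Suc d. emeasure (p_gaussian p) (E i))"
      using Em by (intro G.emeasure_PiM) auto
    also have "\<dots> = (\<Prod>i<Suc d. emeasure (p_gaussian p) (A (?tr i)))"
      using At unfolding E_def by (intro prod.cong refl p_gaussian_sign assms(2)) auto
    also have "\<dots> = (\<Prod>i<Suc d. emeasure (p_gaussian p) (A i))"
      by (rule prod_transpose[OF assms(1)])
    finally show "emeasure (distr ?G (Rn (Suc d)) (swap_sign d j s)) (Pi\<^sub>E {..<Suc d} A)
        = (\<Prod>i<Suc d. emeasure (p_gaussian p) (A i))" .
  qed simp
qed

text \<open>The symmetry is inherited from the Gaussian vector, because \<open>swap_sign\<close>
  preserves the norm and commutes with normalisation.\<close>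

lemma cone_swap_sign:
  assumes "j \<le> d" and s: "s \<in> {1, - 1}" and A: "A \<in> sets (Rn (Suc d))"
  shows "emeasure (cone_measure (Suc d) p) {x \<in> space (Rn (Suc d)). swap_sign d j s x \<in> A}
    = emeasure (cone_measure (Suc d) p) A"
proof -
  let ?G = "gauss_vec (Suc d) p"
  have ss: "s * s = 1" using s by auto
  have mT[measurable]: "swap_sign d j s \<in> Rn (Suc d) \<rightarrow>\<^sub>M Rn (Suc d)" by (rule measurable_swap_sign[OF assms(1)])
  have mN: "normalize_vec (Suc d) p \<in> ?G \<rightarrow>\<^sub>M Rn (Suc d)" and mT': "swap_sign d j s \<in> ?G \<rightarrow>\<^sub>M Rn (Suc d)"
    unfolding measurable_cong_sets[OF sets_gauss[OF p] refl] by measurable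
  have comm: "swap_sign d j s (normalize_vec (Suc d) p x) = normalize_vec (Suc d) p (swap_sign d j s x)" for x
    by (simp add: normalize_vec_def swap_sign_scale[OF assms(1)] lp_norm_swap_sign[OF assms(1) ss])
  have nv: "normalize_vec (Suc d) p x \<in> space (Rn (Suc d))" for x by (simp add: normalize_vec_def scale_vec_space)
  have cone: "emeasure (cone_measure (Suc d) p) C = emeasure ?G {x \<in> space (Rn (Suc d)). normalize_vec (Suc d) p x \<in> C}"
    if "C \<in> sets (Rn (Suc d))" for C
    using emeasure_distr[OF mN that]
    by (simp add: cone_measure_eq[OF p] space_gauss[OF p] vimage_def Int_def conj_commute)
  have A': "{x \<in> space (Rn (Suc d)). swap_sign d j s x \<in> A} \<in> sets (Rn (Suc d))" using A by measurable
  have NA: "{x \<in> space (Rn (Suc d)). normalize_vec (Suc d) p x \<in> A} \<in> sets (Rn (Suc d))" using A by measurable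
  have "emeasure (cone_measure (Suc d) p) {x \<in> space (Rn (Suc d)). swap_sign d j s x \<in> A}
      = emeasure ?G {x \<in> space (Rn (Suc d)). normalize_vec (Suc d) p (swap_sign d j s x) \<in> A}"
    unfolding cone[OF A']
    by (intro arg_cong[where f = "emeasure _"]) (auto simp: comm[symmetric] nv)
  also have "\<dots> = emeasure (distr ?G (Rn (Suc d)) (swap_sign d j s)) {x \<in> space (Rn (Suc d)). normalize_vec (Suc d) p x \<in> A}"
    unfolding emeasure_distr[OF mT' NA] space_gauss[OF p]
    by (intro arg_cong[where f = "emeasure _"]) (auto simp: swap_sign_space)
  also have "\<dots> = emeasure (cone_measure (Suc d) p) A"
    unfolding gauss_swap_sign[OF assms(1) s] cone[OF A] ..
  finally show ?thesis .
qed

lemma cone_sphere: "n \<ge> 1 \<Longrightarrow> AE x in cone_measure n p. x \<in> lp_sphere n p"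
proof -
  assume n: "n \<ge> 1"
  have "AE x in gauss_vec n p. normalize_vec n p x \<in> lp_sphere n p"
    using gauss_lp_norm_pos[OF p n]
    by eventually_elim (simp add: lp_sphere_def normalize_vec_def scale_vec_space lp_norm_scale[OF p])
  moreover have "normalize_vec n p \<in> gauss_vec n p \<rightarrow>\<^sub>M Rn n"
    unfolding measurable_cong_sets[OF sets_gauss[OF p] refl] by measurable
  ultimately show ?thesis
    unfolding cone_measure_eq[OF p n]
    by (subst AE_distr_iff) (auto simp: lp_sphere_def)
qed

text \<open>On the cap both measures are compared with Lebesgue measure in the chart, which bounds
  ratios of masses by n * P. Taking the cap itself, of mass at least 1 / (2 n) under either measure,
  as reference set gives an absolute bound with one factor 2 n; summing over the 2 n copies of the
  cap gives the other.\<close>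

lemma surface_cone_comparable:
  fixes d :: nat
  defines "n \<equiv> Suc d"
  defines "\<sigma> \<equiv> surface_measure n p" and "\<nu> \<equiv> cone_measure n p"
  defines "P \<equiv> ennreal (6 * (p * real d * (real d + 1) + 2))"
  defines "C \<equiv> of_nat (2 * n) * (of_nat (2 * n) * (of_nat n * P))"
  assumes d: "d \<ge> 1" and prob: "prob_space \<sigma>" and A: "A \<in> sets (Rn n)"
  shows "emeasure \<sigma> A \<le> C * emeasure \<nu> A" and "emeasure \<nu> A \<le> C * emeasure \<sigma> A"
proof -
  interpret \<sigma>: prob_space \<sigma> by fact
  interpret \<nu>: prob_space \<nu> unfolding \<nu>_def n_def by (rule prob_space_cone) simp
  let ?S = "lp_sphere n p"
  define H where "H = hausdorff_measure (euclidean_dist n) d"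
  note Hdef = H_def[unfolded n_def]
  have s\<nu>[measurable_cong]: "sets \<nu> = sets (Rn n)" unfolding \<nu>_def n_def by (rule sets_cone) simp
  have s\<sigma>[measurable_cong]: "sets \<sigma> = sets (Rn n)"
    unfolding \<sigma>_def surface_measure_def by (simp add: sets.sigma_sets_eq)
  have sp\<sigma>: "space \<sigma> = space (Rn n)" and sp\<nu>: "space \<nu> = space (Rn n)"
    using sets_eq_imp_space_eq s\<sigma> s\<nu> by blast+
  have S: "?S \<in> sets (Rn n)" by (rule lp_sphere_sets)
  have Ssub: "?S \<subseteq> space (Rn n)" by (auto simp: lp_sphere_def)
  text \<open>A measure built by \<open>measure_of\<close> is the zero measure unless the given set function is a
    measure; hence total mass \<open>1\<close> forces the Hausdorff measure to be one on the sphere.\<close>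
  have em: "emeasure \<sigma> X = (if measure_space (space (Rn n)) (sets (Rn n)) (\<lambda>A. H (A \<inter> ?S) / H ?S) then H (X \<inter> ?S) / H ?S else 0)"
    if "X \<in> sets (Rn n)" for X
    using that unfolding \<sigma>_def surface_measure_def emeasure_measure_of_conv
    by (simp add: sets.sigma_sets_eq H_def n_def)
  have ms: "measure_space (space (Rn n)) (sets (Rn n)) (\<lambda>A. H (A \<inter> ?S) / H ?S)"
  proof (rule ccontr)
    assume "\<not> ?thesis"
    then have "emeasure \<sigma> (space \<sigma>) = 0" using em[of "space (Rn n)"] by (simp add: sp\<sigma>)
    then show False using \<sigma>.emeasure_space_1 by simp
  qed
  have e\<sigma>: "emeasure \<sigma> X = H (X \<inter> ?S) / H ?S" if "X \<in> sets (Rn n)" for X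
    using em[OF that] ms by simp
  have H_mono: "H X \<le> H Y" if "X \<subseteq> Y" for X Y
    unfolding H_def using hausdorff_measure_subset[OF d that] .
  have top: "top_cap d p \<subseteq> ?S" by (auto simp: top_cap_def n_def)
  have top_m: "top_cap d p \<in> sets (Rn n)" unfolding n_def by (rule top_cap_sets[OF p d])
  have ch\<sigma>: "emeasure \<sigma> (chart d p ` B) = H (chart d p ` B) / H ?S"
    if "B \<in> sets (Rn d)" "B \<subseteq> chart_dom d p" for B
  proof -
    have "chart d p ` B \<in> sets (Rn n)" unfolding n_def by (rule chart_image_sets[OF p d that])
    moreover have "chart d p ` B \<inter> ?S = chart d p ` B"
      using chart_in_top(1)[OF p d] that top by blast
    ultimately show ?thesis using e\<sigma> by simp
  qed
  \<comment> \<open>\<open>\<sigma>\<close> restricted to the cap and read off in the chart. It is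
    finite and, by \<open>hausdorff_translate\<close>, quasi-invariant under translations within the
    chart domain.\<close>
  define \<eta> where "\<eta> = distr (density \<sigma> (indicator (top_cap d p))) (Rn d) (\<lambda>x. restrict x {..<d})"
  have mr: "(\<lambda>x. restrict x {..<d}) \<in> density \<sigma> (indicator (top_cap d p)) \<rightarrow>\<^sub>M Rn d"
    using restrict_measurable[of d] by (simp add: n_def cong: measurable_cong_sets)
  have e\<eta>: "emeasure \<eta> B = emeasure \<sigma> (chart d p ` B)" if B: "B \<in> sets (Rn d)" "B \<subseteq> chart_dom d p" for B
  proof -
    have pre: "(\<lambda>x. restrict x {..<d}) -` B \<inter> space (Rn n) \<in> sets (Rn n)"
      unfolding n_def by (rule measurable_sets[OF restrict_measurable B(1)])
    have "emeasure \<eta> B = emeasure (density \<sigma> (indicator (top_cap d p))) ((\<lambda>x. restrict x {..<d}) -` B \<inter> space (Rn n))"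
      unfolding \<eta>_def using emeasure_distr[OF mr B(1)] by (simp add: sp\<sigma>)
    also have "\<dots> = (\<integral>\<^sup>+x. indicator (top_cap d p) x * indicator ((\<lambda>x. restrict x {..<d}) -` B \<inter> space (Rn n)) x \<partial>\<sigma>)"
      using pre top_m s\<sigma> by (intro emeasure_density) auto
    also have "\<dots> = (\<integral>\<^sup>+x. indicator (chart d p ` B) x \<partial>\<sigma>)"
      using top Ssub unfolding chart_image[OF p d B(2)]
      by (intro nn_integral_cong) (auto simp: indicator_def)
    also have "\<dots> = emeasure \<sigma> (chart d p ` B)"
      using chart_image_sets[OF p d B] s\<sigma> by (simp add: n_def)
    finally show ?thesis .
  qed
  have fin\<eta>: "finite_measure \<eta>"
  proof
    have "emeasure \<eta> (space \<eta>) = emeasure (density \<sigma> (indicator (top_cap d p))) (space \<sigma>)"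
      unfolding \<eta>_def using emeasure_distr[OF mr sets.top] measurable_space[OF mr]
      by (simp add: vimage_def Int_def) (metis (mono_tags, lifting) Collect_cong Collect_mem_eq)
    also have "\<dots> = (\<integral>\<^sup>+x. indicator (top_cap d p) x * indicator (space \<sigma>) x \<partial>\<sigma>)"
      using top_m s\<sigma> by (intro emeasure_density) auto
    also have "\<dots> \<le> (\<integral>\<^sup>+x. 1 \<partial>\<sigma>)"
      by (rule nn_integral_mono) (simp add: indicator_def)
    also have "\<dots> = 1" using \<sigma>.emeasure_space_1 by simp
    finally show "emeasure \<eta> (space \<eta>) \<noteq> \<infinity>" by (auto simp: top_unique)
  qed
  have quasi: "emeasure \<eta> B1 * emeasure (lebesgue_Rn d) B2 \<le> P * (emeasure \<eta> B2 * emeasure (lebesgue_Rn d) B1)"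
    if B: "B1 \<in> sets (Rn d)" "B1 \<subseteq> chart_dom d p" "B2 \<in> sets (Rn d)" "B2 \<subseteq> chart_dom d p" for B1 B2
    unfolding lebesgue_Rn_def
  proof (rule quasi_invariant_comparison[OF _ fin\<eta>, of "{..<d}" "chart_dom d p"])
    have sL: "sets (PiM {..<d} (\<lambda>_. lborel :: real measure)) = sets (Rn d)"
      using sets_lebesgue_Rn[of d] by (simp add: lebesgue_Rn_def)
    show "sets \<eta> = sets (PiM {..<d} (\<lambda>_. lborel))" by (simp add: \<eta>_def sL)
    have spL: "space (PiM {..<d} (\<lambda>_. lborel :: real measure)) = space (Rn d)" by (rule sets_eq_imp_space_eq[OF sL])
    fix t :: "nat \<Rightarrow> real" and B :: "(nat \<Rightarrow> real) set"
    let ?B' = "{x \<in> space (PiM {..<d} (\<lambda>_. lborel)). (\<lambda>i\<in>{..<d}. t i + x i) \<in> B}"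
    assume B: "B \<in> sets (PiM {..<d} (\<lambda>_. lborel))" "B \<subseteq> chart_dom d p" and B': "?B' \<subseteq> chart_dom d p"
    have "(\<lambda>x. \<lambda>i\<in>{..<d}. t i + x i) \<in> Rn d \<rightarrow>\<^sub>M Rn d"
      by (intro measurable_restrict borel_measurable_add measurable_coord_Rn) auto
    from measurable_sets[OF this, of B] have mB': "?B' \<in> sets (Rn d)"
      using B(1) by (simp add: sL spL vimage_def Int_def conj_commute)
    have "H (chart d p ` ?B') \<le> P * H (chart d p ` B)"
      unfolding H_def n_def P_def by (rule hausdorff_translate[OF p d B(2) B']) (simp add: spL)
    then have "H (chart d p ` ?B') / H ?S \<le> (P * H (chart d p ` B)) / H ?S" by (rule divide_right_mono_ennreal)
    then show "emeasure \<eta> ?B' \<le> P * emeasure \<eta> B"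
      using mB' B B' sL by (simp add: e\<eta> ch\<sigma> ennreal_times_divide)
  qed (use B sets_lebesgue_Rn[of d] in \<open>auto simp: lebesgue_Rn_def\<close>)
  define Z where "Z = emeasure (lebesgue_Rn n) (unit_cone n p (space (Rn n)))"
  define \<kappa> where "\<kappa> = (\<integral>\<^sup>+r. ennreal (r ^ d) * indicator {0<..1} r \<partial>lborel)"
  have e\<nu>: "emeasure \<nu> X = emeasure (lebesgue_Rn n) (unit_cone n p X) * inverse Z" if "X \<in> sets (Rn n)" for X
    using emeasure_gauss_normalize[OF p _ that] unfolding \<nu>_def Z_def
    by (simp add: cone_measure_eq[OF p] n_def divide_ennreal_def)
  \<comment> \<open>As a cross product the comparison requires neither the values of
    \<open>\<kappa>\<close> and \<open>Z\<close> nor a division by a mass.\<close>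
  have cmp: "emeasure \<sigma> A1 * emeasure \<nu> A2 \<le> of_nat n * P * (emeasure \<sigma> A2 * emeasure \<nu> A1)"
    if A12: "A1 \<in> sets (Rn n)" "A1 \<subseteq> top_cap d p" "A2 \<in> sets (Rn n)" "A2 \<subseteq> top_cap d p" for A1 A2
  proof -
    obtain B1 where B1: "B1 \<in> sets (Rn d)" "B1 \<subseteq> chart_dom d p" "A1 = chart d p ` B1"
      using top_set_chart[OF p d, of A1] A12 unfolding n_def by blast
    obtain B2 where B2: "B2 \<in> sets (Rn d)" "B2 \<subseteq> chart_dom d p" "A2 = chart d p ` B2"
      using top_set_chart[OF p d, of A2] A12 unfolding n_def by blast
    let ?L = "emeasure (lebesgue_Rn d)"
    have u: "emeasure \<nu> A2 \<le> (of_nat n * (\<kappa> * ?L B2)) * inverse Z"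
      unfolding e\<nu>[OF A12(3)]
      using cone_volume(2)[OF p d B2(1,2)]
      by (intro mult_right_mono) (auto simp: B2(3) n_def \<kappa>_def ennreal_of_nat_eq_real_of_nat)
    have l: "(\<kappa> * ?L B1) * inverse Z \<le> emeasure \<nu> A1"
      unfolding e\<nu>[OF A12(1)]
      using cone_volume(1)[OF p d B1(1,2)] by (intro mult_right_mono) (auto simp: B1(3) n_def \<kappa>_def)
    have "emeasure \<sigma> A1 * emeasure \<nu> A2 \<le> emeasure \<sigma> A1 * ((of_nat n * (\<kappa> * ?L B2)) * inverse Z)"
      using u by (rule mult_left_mono) simp
    also have "\<dots> = (of_nat n * \<kappa> * inverse Z) * (emeasure \<eta> B1 * ?L B2)"
      by (simp add: e\<eta>[OF B1(1,2)] B1(3) mult_ac)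
    also have "\<dots> \<le> (of_nat n * \<kappa> * inverse Z) * (P * (emeasure \<eta> B2 * ?L B1))"
      using quasi[OF B1(1,2) B2(1,2)] by (rule mult_left_mono) simp
    also have "\<dots> = (of_nat n * P * emeasure \<sigma> A2) * ((\<kappa> * ?L B1) * inverse Z)"
      by (simp add: e\<eta>[OF B2(1,2)] B2(3) mult_ac)
    also have "\<dots> \<le> (of_nat n * P * emeasure \<sigma> A2) * emeasure \<nu> A1"
      using l by (rule mult_left_mono) simp
    finally show ?thesis by (simp add: mult_ac)
  qed
  define J where "J = {..d} \<times> {1, - 1 :: real}"
  have Jc: "card J = 2 * n" "finite J" by (auto simp: J_def n_def card_cartesian_product)
  define pull where "pull q X = {x \<in> space (Rn n). swap_sign d (fst q) (snd q) x \<in> X}" for q X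
  \<comment> \<open>The pieces may overlap where several coordinates are maximal in modulus. They
    are used only for upper bounds by subadditivity.\<close>
  define piece where "piece q X = {x \<in> X \<inter> ?S. swap_sign d (fst q) (snd q) x \<in> top_cap d p}" for q X
  have q: "fst q \<le> d" "snd q \<in> {1, - 1}" "snd q * snd q = 1" if "q \<in> J" for q
    using that by (auto simp: J_def)
  have pull_m: "pull q X \<in> sets (Rn n)" if "q \<in> J" "X \<in> sets (Rn n)" for q X
    using measurable_sets[OF measurable_swap_sign[OF q(1)[OF that(1)]], of X "snd q"] that(2)
    by (simp add: pull_def n_def vimage_def Int_def conj_commute)
  have piece_eq: "piece q X = (X \<inter> ?S) \<inter> pull q (top_cap d p)" for q X
    using Ssub by (auto simp: piece_def pull_def)
  have piece_m: "piece q X \<in> sets (Rn n)" if "q \<in> J" "X \<in> sets (Rn n)" for q X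
    unfolding piece_eq using that S pull_m[OF that(1) top_m] by auto
  have invol: "swap_sign d (fst q) (snd q) (swap_sign d (fst q) (snd q) x) = x" if "q \<in> J" "x \<in> space (Rn n)" for q x
    using that q by (intro swap_sign_involution) (auto simp: n_def)
  have sph: "swap_sign d (fst q) (snd q) x \<in> ?S" if "q \<in> J" "x \<in> ?S" for q x
    using that q by (auto simp: lp_sphere_def n_def swap_sign_space lp_norm_swap_sign)
  have piece_img: "piece q X = swap_sign d (fst q) (snd q) ` (pull q X \<inter> top_cap d p)"
    and piece_pull: "pull q X \<inter> top_cap d p = pull q (piece q X)"
    and piece_img': "pull q X \<inter> top_cap d p = swap_sign d (fst q) (snd q) ` piece q X" if qJ: "q \<in> J" and X: "X \<subseteq> space (Rn n)" for q X
  proof -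
    let ?T = "swap_sign d (fst q) (snd q)"
    have 1: "x \<in> piece q X \<Longrightarrow> ?T x \<in> pull q X \<inter> top_cap d p \<and> ?T (?T x) = x" for x
      using invol[OF qJ] X Ssub by (auto simp: piece_def pull_def n_def swap_sign_space)
    have 2: "x \<in> pull q X \<inter> top_cap d p \<Longrightarrow> ?T x \<in> piece q X \<and> ?T (?T x) = x" for x
      using invol[OF qJ] sph[OF qJ] top Ssub by (auto simp: piece_def pull_def)
    show "piece q X = ?T ` (pull q X \<inter> top_cap d p)" "pull q X \<inter> top_cap d p = ?T ` piece q X"
      using 1 2 by (auto simp: image_iff) (metis 1 2)+
    show "pull q X \<inter> top_cap d p = pull q (piece q X)"
      using 2 invol[OF qJ] by (auto simp: pull_def piece_def)
  qed
  have \<sigma>_piece: "emeasure \<sigma> (piece q X) = emeasure \<sigma> (pull q X \<inter> top_cap d p)" if qJ: "q \<in> J" and X: "X \<in> sets (Rn n)" for q X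
  proof -
    have Xs: "X \<subseteq> space (Rn n)" by (rule sets.sets_into_space[OF X])
    have contr: "H (swap_sign d (fst q) (snd q) ` Y) \<le> H Y" for Y
      unfolding H_def n_def using q[OF qJ]
      by (intro hausdorff_measure_contraction[OF d]) (simp add: euclidean_dist_swap_sign)
    have "H (piece q X) = H (pull q X \<inter> top_cap d p)"
      using contr[of "pull q X \<inter> top_cap d p"] contr[of "piece q X"]
      unfolding piece_img[OF qJ Xs, symmetric] piece_img'[OF qJ Xs, symmetric] by (rule antisym)
    moreover have "piece q X \<inter> ?S = piece q X" "pull q X \<inter> top_cap d p \<inter> ?S = pull q X \<inter> top_cap d p"
      using top by (auto simp: piece_def)
    ultimately show ?thesis
      using e\<sigma>[OF piece_m[OF qJ X]] e\<sigma>[of "pull q X \<inter> top_cap d p"] pull_m[OF qJ X] top_m by simp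
  qed
  have \<nu>_piece: "emeasure \<nu> (piece q X) = emeasure \<nu> (pull q X \<inter> top_cap d p)" if qJ: "q \<in> J" and X: "X \<in> sets (Rn n)" for q X
    unfolding piece_pull[OF qJ sets.sets_into_space[OF X]] unfolding pull_def \<nu>_def n_def
    using cone_swap_sign[OF q(1,2)[OF qJ] piece_m[OF qJ X, unfolded n_def]] by (simp add: n_def)
  have cover: "X \<inter> ?S \<subseteq> (\<Union>q\<in>J. piece q X)" for X
  proof
    fix x assume x: "x \<in> X \<inter> ?S"
    then obtain j s where js: "j \<le> d" "s \<in> {1, - 1}" "swap_sign d j s x \<in> top_cap d p"
      using sphere_cover[of x d p, OF _ p] by (auto simp: n_def)
    then show "x \<in> (\<Union>q\<in>J. piece q X)"
      using x by (intro UN_I[of "(j, s)"]) (auto simp: J_def piece_def)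
  qed
  have \<sigma>_sum: "emeasure \<sigma> X \<le> (\<Sum>q\<in>J. emeasure \<sigma> (pull q X \<inter> top_cap d p))" if X: "X \<in> sets (Rn n)" for X
  proof -
    have "emeasure \<sigma> X = emeasure \<sigma> (X \<inter> ?S)" using e\<sigma>[OF X] e\<sigma>[of "X \<inter> ?S"] X S by (simp add: Int_assoc)
    also have "\<dots> \<le> emeasure \<sigma> (\<Union>q\<in>J. piece q X)"
      using cover piece_m X Jc s\<sigma> by (intro emeasure_mono) auto
    also have "\<dots> \<le> (\<Sum>q\<in>J. emeasure \<sigma> (piece q X))"
      using piece_m X Jc s\<sigma> by (intro emeasure_subadditive_finite) auto
    also have "\<dots> = (\<Sum>q\<in>J. emeasure \<sigma> (pull q X \<inter> top_cap d p))"
      using \<sigma>_piece X by (intro sum.cong) auto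
    finally show ?thesis .
  qed
  have \<nu>_sum: "emeasure \<nu> X \<le> (\<Sum>q\<in>J. emeasure \<nu> (pull q X \<inter> top_cap d p))" if X: "X \<in> sets (Rn n)" for X
  proof -
    have "AE x in \<nu>. x \<in> ?S" unfolding \<nu>_def n_def by (rule cone_sphere) simp
    then have "emeasure \<nu> X = emeasure \<nu> (X \<inter> ?S)"
      using X S s\<nu> by (intro emeasure_eq_AE) auto
    also have "\<dots> \<le> emeasure \<nu> (\<Union>q\<in>J. piece q X)"
      using cover piece_m X Jc s\<nu> by (intro emeasure_mono) auto
    also have "\<dots> \<le> (\<Sum>q\<in>J. emeasure \<nu> (piece q X))"
      using piece_m X Jc s\<nu> by (intro emeasure_subadditive_finite) auto
    also have "\<dots> = (\<Sum>q\<in>J. emeasure \<nu> (pull q X \<inter> top_cap d p))"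
      using \<nu>_piece X by (intro sum.cong) auto
    finally show ?thesis .
  qed
  let ?N = "of_nat (2 * n) :: ennreal"
  \<comment> \<open>The 2 n pieces of the sphere have the masses of subsets of the cap, so the cap
    has mass at least 1 / (2 n).\<close>
  have top1: "1 \<le> ?N * emeasure \<sigma> (top_cap d p)"
  proof -
    have "1 = emeasure \<sigma> (space (Rn n))" using \<sigma>.emeasure_space_1 by (simp add: sp\<sigma>)
    also have "\<dots> \<le> (\<Sum>q\<in>J. emeasure \<sigma> (pull q (space (Rn n)) \<inter> top_cap d p))" by (rule \<sigma>_sum) simp
    also have "\<dots> \<le> (\<Sum>q\<in>J. emeasure \<sigma> (top_cap d p))"
      using top_m s\<sigma> by (intro sum_mono emeasure_mono) auto
    finally show ?thesis by (simp add: Jc)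
  qed
  have top2: "1 \<le> ?N * emeasure \<nu> (top_cap d p)"
  proof -
    have "1 = emeasure \<nu> (space (Rn n))" using \<nu>.emeasure_space_1 by (simp add: sp\<nu>)
    also have "\<dots> \<le> (\<Sum>q\<in>J. emeasure \<nu> (pull q (space (Rn n)) \<inter> top_cap d p))" by (rule \<nu>_sum) simp
    also have "\<dots> \<le> (\<Sum>q\<in>J. emeasure \<nu> (top_cap d p))"
      using top_m s\<nu> by (intro sum_mono emeasure_mono) auto
    finally show ?thesis by (simp add: Jc)
  qed
  have \<sigma>\<nu>: "emeasure \<sigma> Y \<le> ?N * (of_nat n * P) * emeasure \<nu> Y" if Y: "Y \<in> sets (Rn n)" "Y \<subseteq> top_cap d p" for Y
  proof -
    have "emeasure \<sigma> Y * 1 \<le> emeasure \<sigma> Y * (?N * emeasure \<nu> (top_cap d p))"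
      using top2 by (rule mult_left_mono) simp
    also have "\<dots> = ?N * (emeasure \<sigma> Y * emeasure \<nu> (top_cap d p))" by (simp add: mult_ac)
    also have "\<dots> \<le> ?N * (of_nat n * P * (emeasure \<sigma> (top_cap d p) * emeasure \<nu> Y))"
      using cmp[OF Y top_m] by (intro mult_left_mono) auto
    also have "\<dots> \<le> ?N * (of_nat n * P * (1 * emeasure \<nu> Y))"
      by (intro mult_left_mono mult_right_mono \<sigma>.emeasure_le_1) auto
    finally show ?thesis by (simp add: mult_ac)
  qed
  have \<nu>\<sigma>: "emeasure \<nu> Y \<le> ?N * (of_nat n * P) * emeasure \<sigma> Y" if Y: "Y \<in> sets (Rn n)" "Y \<subseteq> top_cap d p" for Y
  proof -
    have "1 * emeasure \<nu> Y \<le> (?N * emeasure \<sigma> (top_cap d p)) * emeasure \<nu> Y"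
      using top1 by (rule mult_right_mono) simp
    also have "\<dots> = ?N * (emeasure \<sigma> (top_cap d p) * emeasure \<nu> Y)" by (simp add: mult_ac)
    also have "\<dots> \<le> ?N * (of_nat n * P * (emeasure \<sigma> Y * emeasure \<nu> (top_cap d p)))"
      using cmp[OF top_m _ Y] by (intro mult_left_mono) auto
    also have "\<dots> \<le> ?N * (of_nat n * P * (emeasure \<sigma> Y * 1))"
      by (intro mult_left_mono \<nu>.emeasure_le_1) auto
    finally show ?thesis by (simp add: mult_ac)
  qed
  have "emeasure \<sigma> A \<le> (\<Sum>q\<in>J. emeasure \<sigma> (pull q A \<inter> top_cap d p))" by (rule \<sigma>_sum[OF A])
  also have "\<dots> \<le> (\<Sum>q\<in>J. ?N * (of_nat n * P) * emeasure \<nu> A)"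
  proof (intro sum_mono)
    fix q assume qJ: "q \<in> J"
    have m: "pull q A \<inter> top_cap d p \<in> sets (Rn n)" using pull_m[OF qJ A] top_m by auto
    have "emeasure \<nu> (pull q A \<inter> top_cap d p) = emeasure \<nu> (piece q A)" using \<nu>_piece[OF qJ A] by simp
    also have "\<dots> \<le> emeasure \<nu> A" using A s\<nu> by (intro emeasure_mono) (auto simp: piece_def)
    finally show "emeasure \<sigma> (pull q A \<inter> top_cap d p) \<le> ?N * (of_nat n * P) * emeasure \<nu> A"
      using \<sigma>\<nu>[OF m] by (meson Int_lower2 mult_left_mono order_trans zero_le)
  qed
  also have "\<dots> = C * emeasure \<nu> A" by (simp add: Jc C_def mult_ac)
  finally show "emeasure \<sigma> A \<le> C * emeasure \<nu> A" .
  have "emeasure \<nu> A \<le> (\<Sum>q\<in>J. emeasure \<nu> (pull q A \<inter> top_cap d p))" by (rule \<nu>_sum[OF A])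
  also have "\<dots> \<le> (\<Sum>q\<in>J. ?N * (of_nat n * P) * emeasure \<sigma> A)"
  proof (intro sum_mono)
    fix q assume qJ: "q \<in> J"
    have m: "pull q A \<inter> top_cap d p \<in> sets (Rn n)" using pull_m[OF qJ A] top_m by auto
    have "emeasure \<sigma> (pull q A \<inter> top_cap d p) = emeasure \<sigma> (piece q A)" using \<sigma>_piece[OF qJ A] by simp
    also have "\<dots> \<le> emeasure \<sigma> A" using A s\<sigma> by (intro emeasure_mono) (auto simp: piece_def)
    finally show "emeasure \<nu> (pull q A \<inter> top_cap d p) \<le> ?N * (of_nat n * P) * emeasure \<sigma> A"
      using \<nu>\<sigma>[OF m] by (meson Int_lower2 mult_left_mono order_trans zero_le)
  qed
  also have "\<dots> = C * emeasure \<sigma> A" by (simp add: Jc C_def mult_ac)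
  finally show "emeasure \<nu> A \<le> C * emeasure \<sigma> A" .
qed

end

text \<open>The factor C of \<open>surface_cone_comparable\<close> is 4 n^3 P, and P \<le> 6 (p + 2)
  n^2, whence the fifth power in c. The condition n \<ge> 2 makes the dimension n - 1 of the
  Hausdorff measure positive.\<close>

lemma ratio_dev_surface:
  fixes b :: "nat \<Rightarrow> real"
  assumes p: "p \<ge> 1" and "k \<ge> 1" "n \<ge> 2" and prob: "prob_space (surface_measure n p)" and A: "A \<in> sets borel"
  defines "E \<equiv> {x \<in> space (Rn n). ratio_dev k p b n x \<in> A}"
  defines "c \<equiv> 24 * (p + 2) * real n ^ 5"
  shows "measure (surface_measure n p) E \<le> c * measure (gauss_vec n p) E"
    and "measure (gauss_vec n p) E \<le> c * measure (surface_measure n p) E"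
proof -
  obtain d where n: "n = Suc d" and d: "d \<ge> 1" using \<open>n \<ge> 2\<close> by (cases n) auto
  interpret S: prob_space "surface_measure n p" by fact
  interpret C: prob_space "cone_measure n p" using \<open>n \<ge> 2\<close> by (intro prob_space_cone[OF p]) simp
  have "ratio_dev k p b n \<in> borel_measurable (Rn n)" unfolding ratio_dev_def[abs_def] by measurable
  from measurable_sets[OF this A] have E: "E \<in> sets (Rn n)"
    unfolding E_def by (simp add: vimage_def Int_def conj_commute)
  define P where "P = 6 * (p * real d * (real d + 1) + 2)"
  have P: "P \<ge> 0" using p by (simp add: P_def)
  have eC: "of_nat (2 * n) * (of_nat (2 * n) * (of_nat n * ennreal P)) = ennreal (4 * real n ^ 3 * P)"
    using P by (simp add: ennreal_of_nat_eq_real_of_nat ennreal_mult[symmetric] power3_eq_cube mult_ac del: of_nat_mult)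
  have "4 * real n ^ 3 * P \<le> c"
  proof -
    have "p * real d * (real d + 1) \<le> p * real n * real n" using p by (intro mult_mono) (auto simp: n)
    moreover have "2 \<le> 2 * (real n * real n)" using \<open>n \<ge> 2\<close> by (simp add: mult_ge1_I)
    ultimately have "P \<le> 6 * ((p + 2) * (real n * real n))" by (simp add: P_def algebra_simps)
    then have "4 * real n ^ 3 * P \<le> 4 * real n ^ 3 * (6 * ((p + 2) * (real n * real n)))"
      by (intro mult_left_mono) auto
    also have "\<dots> = c" by (simp add: c_def eval_nat_numeral)
    finally show ?thesis .
  qed
  then have cC: "of_nat (2 * n) * (of_nat (2 * n) * (of_nat n * ennreal P)) \<le> ennreal c"
    unfolding eC by (rule ennreal_leI)
  note comp = surface_cone_comparable[OF p d prob[unfolded n] E[unfolded n], folded n P_def]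
  have "ennreal (measure (surface_measure n p) E) \<le> ennreal (c * measure (cone_measure n p) E)"
  proof -
    have "emeasure (surface_measure n p) E \<le> ennreal c * emeasure (cone_measure n p) E"
      using comp(1) cC by (meson mult_right_mono order_trans zero_le)
    then show ?thesis using p by (simp add: S.emeasure_eq_measure C.emeasure_eq_measure ennreal_mult c_def)
  qed
  then show "measure (surface_measure n p) E \<le> c * measure (gauss_vec n p) E"
    using ratio_dev_cone[OF p \<open>k \<ge> 1\<close> _ A, of n b] \<open>n \<ge> 2\<close> p
    by (simp add: E_def c_def ennreal_le_iff)
  have "ennreal (measure (cone_measure n p) E) \<le> ennreal (c * measure (surface_measure n p) E)"
  proof -
    have "emeasure (cone_measure n p) E \<le> ennreal c * emeasure (surface_measure n p) E"
      using comp(2) cC by (meson mult_right_mono order_trans zero_le)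
    then show ?thesis using p by (simp add: S.emeasure_eq_measure C.emeasure_eq_measure ennreal_mult c_def)
  qed
  then show "measure (gauss_vec n p) E \<le> c * measure (surface_measure n p) E"
    using ratio_dev_cone[OF p \<open>k \<ge> 1\<close> _ A, of n b] \<open>n \<ge> 2\<close> p
    by (simp add: E_def c_def ennreal_le_iff)
qed

section \<open>Transfer to the given random vectors and conclusion\<close>

lemma at_top_of_sqrt_ln:
  assumes "filterlim (\<lambda>n. b n / sqrt (ln (real n))) at_top sequentially"
  shows "filterlim b at_top sequentially"
proof -
  have "filterlim (\<lambda>n::nat. sqrt (ln (real n))) at_top sequentially" by real_asymp
  with assms have "filterlim (\<lambda>n. b n / sqrt (ln (real n)) * sqrt (ln (real n))) at_top sequentially"
    by (rule filterlim_at_top_mult_at_top)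
  then show ?thesis
  proof (rule filterlim_mono_eventually[OF _ order_refl order_refl])
    show "\<forall>\<^sub>F n in sequentially. b n / sqrt (ln (real n)) * sqrt (ln (real n)) = b n"
      using eventually_ge_at_top[of 2] by eventually_elim auto
  qed
qed

text \<open>Eventually b_n^2 \<ge> (6 / \<eta>) ln n, so the right-hand side is at least n^6; the
  sixth power leaves one factor n to absorb c.\<close>

lemma polynomial_subexp:
  assumes b: "filterlim (\<lambda>n. b n / sqrt (ln (real n))) at_top sequentially" and "c > 0" and "\<eta> > 0"
  shows "\<forall>\<^sub>F n in sequentially. c * real n ^ 5 \<le> exp (\<eta> * (b n)\<^sup>2)"
proof -
  have "\<forall>\<^sub>F n in sequentially. b n / sqrt (ln (real n)) \<ge> sqrt (6 / \<eta>)"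
    using b by (simp add: filterlim_at_top)
  moreover have "\<forall>\<^sub>F n in sequentially. c \<le> real n" by real_asymp
  ultimately show ?thesis using eventually_ge_at_top[of 2]
  proof eventually_elim
    case (elim n)
    have l: "ln (real n) > 0" using elim by simp
    have "sqrt (6 / \<eta>) * sqrt (ln (real n)) \<le> b n" using elim(1) l by (simp add: pos_le_divide_eq)
    then have "(sqrt (6 / \<eta>) * sqrt (ln (real n)))\<^sup>2 \<le> (b n)\<^sup>2"
      using l \<open>\<eta> > 0\<close> by (intro power_mono) auto
    then have "6 / \<eta> * ln (real n) \<le> (b n)\<^sup>2" using l \<open>\<eta> > 0\<close> by (simp add: power_mult_distrib)
    then have "6 * ln (real n) \<le> \<eta> * (b n)\<^sup>2" using \<open>\<eta> > 0\<close> by (simp add: field_simps)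
    then have "exp (6 * ln (real n)) \<le> exp (\<eta> * (b n)\<^sup>2)" by simp
    moreover have "exp (6 * ln (real n)) = real n ^ 6"
      using elim exp_of_nat_mult[of 6 "ln (real n)"] by simp
    moreover have "c * real n ^ 5 \<le> real n * real n ^ 5" using elim by (intro mult_right_mono) auto
    ultimately show ?case by (simp add: eval_nat_numeral)
  qed
qed

theorem theorem4:
  fixes k :: nat and p :: real and b :: "nat \<Rightarrow> real"
    and M :: "nat \<Rightarrow> 'a measure" and X :: "nat \<Rightarrow> 'a \<Rightarrow> nat \<Rightarrow> real"
    and N :: "nat \<Rightarrow> 'b measure" and R :: "nat \<Rightarrow> 'b \<Rightarrow> real"
  assumes "k \<ge> 1" and "p \<ge> 1"
    and "\<And>n. n \<ge> k \<Longrightarrow> prob_space (M n)"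
    and "\<And>n. n \<ge> k \<Longrightarrow> X n \<in> M n \<rightarrow>\<^sub>M Rn n"
    and "\<And>n. n \<ge> 1 \<Longrightarrow> b n > 0"
    and "(\<lambda>n. b n / sqrt (real n)) \<longlonglongrightarrow> 0"
    and "((\<forall>n\<ge>k. prob_space (N n) \<and> R n \<in> borel_measurable (N n) \<and>
                 (AE \<omega> in N n. R n \<omega> > 0) \<and>
                 distr (M n) (Rn n) (X n) = radial_law n p (N n) (R n)) \<and>
          filterlim b at_top sequentially)
       \<or> ((\<forall>n\<ge>k. distr (M n) (Rn n) (X n) = surface_measure n p) \<and>
          filterlim (\<lambda>n. b n / sqrt (ln (real n))) at_top sequentially)"
  shows "satisfies_LDP k M
           (\<lambda>n \<omega>. sqrt (real n) / b n * (exp (- m_const p) * mean_ratio k n n p (X n \<omega>) - 1))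
           (\<lambda>n. (b n)\<^sup>2)
           (\<lambda>t::real. ennreal (t\<^sup>2 / (2 * s_sq p)))"
proof -
  note k = assms(1) and p = assms(2) and prob = assms(3) and X = assms(4) and cases = assms(7)
  have binf: "filterlim b at_top sequentially" using cases at_top_of_sqrt_ln by auto
  interpret mod_scale p k b using assms(5,6) k p binf by unfold_locales auto
  define \<xi> where "\<xi> n \<omega> = ratio_dev k p b n (X n \<omega>)" for n \<omega>
  define G where "G n A = measure (gauss_vec n p) {x \<in> space (Rn n). ratio_dev k p b n x \<in> A}" for n A
  define Q where "Q n A = measure (M n) {\<omega> \<in> space (M n). \<xi> n \<omega> \<in> A}" for n A
  have QX: "Q n A = measure (distr (M n) (Rn n) (X n)) {x \<in> space (Rn n). ratio_dev k p b n x \<in> A}"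
    if "n \<ge> k" "A \<in> sets borel" for n A
  proof -
    have "{x \<in> space (Rn n). ratio_dev k p b n x \<in> A} \<in> sets (Rn n)"
      using measurable_sets[OF measurable_ratio_dev that(2), of n] by (simp add: vimage_def Int_def conj_commute)
    from measure_distr[OF X[OF that(1)] this] show ?thesis
      unfolding Q_def \<xi>_def using measurable_space[OF X[OF that(1)]]
      by (auto intro!: arg_cong[where f = "measure _"])
  qed
  \<comment> \<open>All that is used about the law of X n: for each Borel set the probability agrees
    with the Gaussian one up to a factor negligible at speed b_n^2, for all sets from the same n on.
    In case (i) the two are equal for n \<ge> k.\<close>
  have cmp: "\<forall>\<^sub>F n in sequentially. \<forall>A\<in>sets borel. Q n A \<le> exp (\<eta> * (b n)\<^sup>2) * G n A \<and> G n A \<le> exp (\<eta> * (b n)\<^sup>2) * Q n A"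
    if eta: "\<eta> > 0" for \<eta>
    using cases
  proof
    assume i: "(\<forall>n\<ge>k. prob_space (N n) \<and> R n \<in> borel_measurable (N n) \<and> (AE \<omega> in N n. R n \<omega> > 0) \<and>
      distr (M n) (Rn n) (X n) = radial_law n p (N n) (R n)) \<and> filterlim b at_top sequentially"
    show ?thesis
      using eventually_ge_at_top[of k]
    proof eventually_elim
      case (elim n)
      have "Q n A = G n A" if "A \<in> sets borel" for A
        using i elim k that unfolding QX[OF elim that] G_def by (simp add: ratio_dev_radial[OF p k])
      moreover have "G n A \<le> exp (\<eta> * (b n)\<^sup>2) * G n A" for A
        using eta mult_right_mono[of 1 "exp (\<eta> * (b n)\<^sup>2)" "G n A"] by (simp add: G_def)
      ultimately show ?case by simp
    qed
  next
    assume ii: "(\<forall>n\<ge>k. distr (M n) (Rn n) (X n) = surface_measure n p) \<and>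
      filterlim (\<lambda>n. b n / sqrt (ln (real n))) at_top sequentially"
    have "\<forall>\<^sub>F n in sequentially. 24 * (p + 2) * real n ^ 5 \<le> exp (\<eta> * (b n)\<^sup>2)"
      using ii p eta by (intro polynomial_subexp) auto
    then show ?thesis
      using eventually_ge_at_top[of "max k 2"]
    proof eventually_elim
      case (elim n)
      then have n: "n \<ge> k" "n \<ge> 2" by auto
      have law: "distr (M n) (Rn n) (X n) = surface_measure n p" using ii n by auto
      \<comment> \<open>As the law of X n, the surface measure has total mass 1, so it is not the
        zero measure to which \<open>measure_of\<close> would default.\<close>
      have ps: "prob_space (surface_measure n p)"
        unfolding law[symmetric] using prob[OF n(1)] X[OF n(1)] by (rule prob_space.prob_space_distr)
      show ?case
      proof (intro ballI conjI)
        fix A :: "real set" assume A: "A \<in> sets borel"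
        note S = ratio_dev_surface[OF p k n(2) ps A, of b]
        have "G n A \<ge> 0" "Q n A \<ge> 0" by (simp_all add: G_def Q_def)
        then show "Q n A \<le> exp (\<eta> * (b n)\<^sup>2) * G n A" "G n A \<le> exp (\<eta> * (b n)\<^sup>2) * Q n A"
          using S mult_right_mono[OF elim(1)] unfolding QX[OF n(1) A] law G_def
          by (meson order_trans)+
      qed
    qed
  qed
  have "satisfies_LDP k M \<xi> (\<lambda>n. (b n)\<^sup>2) (\<lambda>t::real. ennreal (t\<^sup>2 / (2 * s_sq p)))"
  proof (rule satisfies_LDP_quadratic[OF prob _ sq_b_at_top s_sq_pos[OF p]])
    show "\<xi> n \<in> borel_measurable (M n)" if "n \<ge> k" for n
      unfolding \<xi>_def using measurable_compose[OF X[OF that] measurable_ratio_dev] .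
    fix \<eta> :: real assume eta: "\<eta> > 0"
    \<comment> \<open>One half of \<eta> is spent on the Gaussian estimate, the other on the
      comparison \<open>cmp\<close>.\<close>
    then have eta2: "\<eta> / 2 > 0" by simp
    {
      fix t :: real assume t: "t > 0"
      have mA: "{z :: real. t \<le> \<bar>z\<bar>} \<in> sets borel" by measurable
      show "\<forall>\<^sub>F n in sequentially. measure (M n) {\<omega> \<in> space (M n). t \<le> \<bar>\<xi> n \<omega>\<bar>}
          \<le> exp (- (b n)\<^sup>2 * (t\<^sup>2 / (2 * s_sq p) - \<eta>))"
        using mod_upper_ratio_dev[unfolded mod_upper_def, rule_format, OF t eta2] cmp[OF eta2]
      proof eventually_elim
        case (elim n)
        have "measure (M n) {\<omega> \<in> space (M n). t \<le> \<bar>\<xi> n \<omega>\<bar>} \<le> exp (\<eta> / 2 * (b n)\<^sup>2) * G n {z. t \<le> \<bar>z\<bar>}"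
          using bspec[OF elim(2) mA] by (simp add: Q_def)
        also have "\<dots> \<le> exp (\<eta> / 2 * (b n)\<^sup>2) * exp (- (b n)\<^sup>2 * (t\<^sup>2 / (2 * s_sq p) - \<eta> / 2))"
          using elim(1) by (intro mult_left_mono) (auto simp: G_def space_gauss[OF p])
        also have "\<dots> = exp (- (b n)\<^sup>2 * (t\<^sup>2 / (2 * s_sq p) - \<eta>))"
          unfolding exp_add[symmetric] by (rule arg_cong[where f = exp]) (simp add: algebra_simps)
        finally show ?case .
      qed
    }
    {
      fix x \<epsilon> :: real assume e: "\<epsilon> > 0"
      have mA: "{z :: real. \<bar>z - x\<bar> < \<epsilon>} \<in> sets borel" by measurable
      show "\<forall>\<^sub>F n in sequentially. exp (- (b n)\<^sup>2 * (x\<^sup>2 / (2 * s_sq p) + \<eta>))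
          \<le> measure (M n) {\<omega> \<in> space (M n). \<bar>\<xi> n \<omega> - x\<bar> < \<epsilon>}"
        using mod_lower_ratio_dev[unfolded mod_lower_def, rule_format, OF e eta2, of x] cmp[OF eta2]
      proof eventually_elim
        case (elim n)
        have "exp (- (\<eta> / 2 * (b n)\<^sup>2)) * exp (- (b n)\<^sup>2 * (x\<^sup>2 / (2 * s_sq p) + \<eta> / 2))
            \<le> exp (- (\<eta> / 2 * (b n)\<^sup>2)) * G n {z. \<bar>z - x\<bar> < \<epsilon>}"
          using elim(1) by (intro mult_left_mono) (auto simp: G_def space_gauss[OF p])
        also have "\<dots> \<le> exp (- (\<eta> / 2 * (b n)\<^sup>2)) * (exp (\<eta> / 2 * (b n)\<^sup>2) * Q n {z. \<bar>z - x\<bar> < \<epsilon>})"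
          using elim(2) mA by (intro mult_left_mono) auto
        also have "\<dots> = Q n {z. \<bar>z - x\<bar> < \<epsilon>}" by (simp add: exp_minus)
        also have "exp (- (\<eta> / 2 * (b n)\<^sup>2)) * exp (- (b n)\<^sup>2 * (x\<^sup>2 / (2 * s_sq p) + \<eta> / 2))
            = exp (- (b n)\<^sup>2 * (x\<^sup>2 / (2 * s_sq p) + \<eta>))"
          unfolding exp_add[symmetric] by (rule arg_cong[where f = exp]) (simp add: algebra_simps)
        finally show ?case by (simp add: Q_def)
      qed
    }
  qed
  then show ?thesis by (simp add: \<xi>_def[abs_def] ratio_dev_def)
qed

end
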